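(* Let $(X,d,\mu)$ be a complete metric measure space and $\Omega\subset X$ a bounded domain. Suppose $\mu$ is doubling on $\Omega$ and $\Omega$ supports a local $q$-Poincaré inequality for some $1\le q<p$. For every $m\in\mathbb N$ let $(Y_m,d_m)$ be a complete metric space, $K_m\subset Y_m$ compact, and $u_m\in N^{1,p}(\Omega,Y_m)$. Suppose that $(K_m,d_m)$ is uniformly compact and $$\sup_{m\in\mathbb N}\int_\Omega d_m^p(u_m(x),y_m)\,d\mu(x)+E^p(u_m)<\infty$$ for some (and thus every) choice of $y_m\in K_m$. Then after possibly passing to a subsequence there exist a complete metric space $Z$, a compact subset $K\subset Z$, isometric embeddings $\varphi_m\colon Y_m\to Z$ and $v\in N^{1,p}(\Omega,Z)$ such that $\varphi_m(K_m)\subset K$ for all $m$ and $\varphi_m\circ u_m\to v$ in $L^p(\Omega,Z)$.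
   Context: $\mu$ doubling on $\Omega$: $0<\mu(B(x,2r)\cap\Omega)\le C_d\mu(B(x,r)\cap\Omega)<\infty$ for $x\in\overline\Omega,r>0$. Local $q$-Poincaré inequality: there are $C>0,\lambda\ge1$ with $\frac{1}{\mu(B(x,r)\cap\Omega)}\int_{B(x,r)\cap\Omega}|u-u_{B(x,r)\cap\Omega}|\,d\mu\le Cr\big(\frac{1}{\mu(B(x,\lambda r)\cap\Omega)}\int_{B(x,\lambda r)\cap\Omega}g^q\,d\mu\big)^{1/q}$ for all $x\in\Omega,r>0$, $u\in L^1_{loc}(\Omega)$, upper gradients $g$ of $u$. Upper gradient of $u:\Omega\to Z$: Borel $g\ge0$ with $d_Z(u(\gamma(b)),u(\gamma(a)))\le\int_\gamma g\,ds$ for all rectifiable $\gamma$ ($p$-weak: for $p$-a.e. curve); $g_u$ minimal $p$-weak upper gradient; $N^{1,p}(\Omega,Z)$: $u\in L^p(\Omega,Z)$ with $g_u\in L^p(\Omega)$; $E^p(u)=\int_\Omega g_u^p\,d\mu$. A sequence of compact metric spaces $(K_m,d_m)$ is uniformly compact if $\sup_m\operatorname{diam}K_m<\infty$ and for every $\varepsilon>0$ there is $N$ such that each $K_m$ can be covered by at most $N$ balls of radius $\varepsilon$. *)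

theory Defs
  imports "HOL-Analysis.Analysis"
begin

definition epow :: "ennreal \<Rightarrow> real \<Rightarrow> ennreal" where
  "epow x p = (if x = \<infinity> then \<infinity> else ennreal (enn2real x powr p))"

definition borel_of_top :: "'a topology \<Rightarrow> 'a measure" where
  "borel_of_top T = sigma (topspace T) {U. openin T U}"

definition curve_length :: "(real \<Rightarrow> 'x::metric_space) \<Rightarrow> real \<Rightarrow> real \<Rightarrow> ennreal" where
  "curve_length \<gamma> a b =
     (SUP (n, t) \<in> {(n, t). t 0 = a \<and> t n = b \<and> (\<forall>i<n. t i \<le> t (Suc i))}.
        ennreal (\<Sum>i<n. dist (\<gamma> (t i)) (\<gamma> (t (Suc i)))))"

definition arclength_curve :: "(real \<Rightarrow> 'x::metric_space) \<Rightarrow> real \<Rightarrow> bool" where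
  "arclength_curve \<gamma> L \<longleftrightarrow> 0 \<le> L \<and>
     (\<forall>s t. 0 \<le> s \<and> s \<le> t \<and> t \<le> L \<longrightarrow> curve_length \<gamma> s t = ennreal (t - s))"

text \<open>Line integral of a Borel function g \<ge> 0 along an arc-length parametrized curve.\<close>
definition line_integral :: "('x::metric_space \<Rightarrow> ennreal) \<Rightarrow> (real \<Rightarrow> 'x) \<Rightarrow> real \<Rightarrow> ennreal" where
  "line_integral g \<gamma> L = (\<integral>\<^sup>+ s \<in> {0..L}. g (\<gamma> s) \<partial>lborel)"

text \<open>Rectifiable curves in Omega (identified with their arc-length parametrizations).\<close>
definition curves_in :: "'x::metric_space set \<Rightarrow> ((real \<Rightarrow> 'x) \<times> real) set" where
  "curves_in \<Omega> = {(\<gamma>, L). arclength_curve \<gamma> L \<and> \<gamma> ` {0..L} \<subseteq> \<Omega>}"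

definition modulus :: "'x::metric_space measure \<Rightarrow> 'x set \<Rightarrow> real \<Rightarrow> ((real \<Rightarrow> 'x) \<times> real) set \<Rightarrow> ennreal" where
  "modulus \<mu> \<Omega> p \<Gamma> =
     (INF \<rho> \<in> {\<rho>. \<rho> \<in> borel_measurable borel \<and> (\<forall>(\<gamma>, L) \<in> \<Gamma>. 1 \<le> line_integral \<rho> \<gamma> L)}.
        (\<integral>\<^sup>+ x \<in> \<Omega>. epow (\<rho> x) p \<partial>\<mu>))"

definition upper_gradient :: "'x::metric_space set \<Rightarrow> 'z metric \<Rightarrow> ('x \<Rightarrow> 'z) \<Rightarrow> ('x \<Rightarrow> ennreal) \<Rightarrow> bool" where
  "upper_gradient \<Omega> Z u g \<longleftrightarrow> g \<in> borel_measurable borel \<and>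
     (\<forall>(\<gamma>, L) \<in> curves_in \<Omega>. ennreal (mdist Z (u (\<gamma> L)) (u (\<gamma> 0))) \<le> line_integral g \<gamma> L)"

definition weak_upper_gradient :: "'x::metric_space measure \<Rightarrow> real \<Rightarrow> 'x set \<Rightarrow> 'z metric \<Rightarrow> ('x \<Rightarrow> 'z) \<Rightarrow> ('x \<Rightarrow> ennreal) \<Rightarrow> bool" where
  "weak_upper_gradient \<mu> p \<Omega> Z u g \<longleftrightarrow> g \<in> borel_measurable borel \<and>
     (\<exists>\<Gamma> \<subseteq> curves_in \<Omega>. modulus \<mu> \<Omega> p \<Gamma> = 0 \<and>
        (\<forall>(\<gamma>, L) \<in> curves_in \<Omega> - \<Gamma>. ennreal (mdist Z (u (\<gamma> L)) (u (\<gamma> 0))) \<le> line_integral g \<gamma> L))"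

text \<open>E^p(u) = \<integral> g_u^p, written as the infimum over all p-weak upper gradients
  (the minimal p-weak upper gradient g_u attains this infimum).\<close>
definition p_energy :: "'x::metric_space measure \<Rightarrow> real \<Rightarrow> 'x set \<Rightarrow> 'z metric \<Rightarrow> ('x \<Rightarrow> 'z) \<Rightarrow> ennreal" where
  "p_energy \<mu> p \<Omega> Z u =
     (INF g \<in> {g. weak_upper_gradient \<mu> p \<Omega> Z u g}. (\<integral>\<^sup>+ x \<in> \<Omega>. epow (g x) p \<partial>\<mu>))"

definition Lp_metric :: "'x::metric_space measure \<Rightarrow> real \<Rightarrow> 'x set \<Rightarrow> 'z metric \<Rightarrow> ('x \<Rightarrow> 'z) \<Rightarrow> bool" where
  "Lp_metric \<mu> p \<Omega> Z u \<longleftrightarrow>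
     u \<in> measurable (restrict_space \<mu> \<Omega>) (borel_of_top (mtopology_of Z)) \<and>
     (\<exists>N \<in> null_sets \<mu>. separable_space (subtopology (mtopology_of Z) (u ` (\<Omega> - N)))) \<and>
     (\<exists>z0 \<in> mspace Z. (\<integral>\<^sup>+ x \<in> \<Omega>. ennreal (mdist Z (u x) z0 powr p) \<partial>\<mu>) < \<infinity>)"

definition N1p :: "'x::metric_space measure \<Rightarrow> real \<Rightarrow> 'x set \<Rightarrow> 'z metric \<Rightarrow> ('x \<Rightarrow> 'z) set" where
  "N1p \<mu> p \<Omega> Z = {u. Lp_metric \<mu> p \<Omega> Z u \<and>
     (\<exists>g. weak_upper_gradient \<mu> p \<Omega> Z u g \<and> (\<integral>\<^sup>+ x \<in> \<Omega>. epow (g x) p \<partial>\<mu>) < \<infinity>)}"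

definition doubling_on :: "'x::metric_space measure \<Rightarrow> 'x set \<Rightarrow> bool" where
  "doubling_on \<mu> \<Omega> \<longleftrightarrow> (\<exists>Cd. \<forall>x \<in> closure \<Omega>. \<forall>r > 0.
      0 < emeasure \<mu> (ball x (2 * r) \<inter> \<Omega>) \<and>
      emeasure \<mu> (ball x (2 * r) \<inter> \<Omega>) \<le> ennreal Cd * emeasure \<mu> (ball x r \<inter> \<Omega>) \<and>
      emeasure \<mu> (ball x r \<inter> \<Omega>) < \<infinity>)"

definition locally_integrable_on :: "'x::metric_space measure \<Rightarrow> 'x set \<Rightarrow> ('x \<Rightarrow> real) \<Rightarrow> bool" where
  "locally_integrable_on \<mu> \<Omega> u \<longleftrightarrow> u \<in> borel_measurable \<mu> \<and>
     (\<forall>C. compact C \<and> C \<subseteq> \<Omega> \<longrightarrow> set_integrable \<mu> C u)"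

definition avg :: "'x measure \<Rightarrow> 'x set \<Rightarrow> ('x \<Rightarrow> real) \<Rightarrow> real" where
  "avg \<mu> A u = (\<integral>x\<in>A. u x \<partial>\<mu>) / measure \<mu> A"

text \<open>Local q-Poincare inequality on Omega (real-valued functions, genuine upper gradients).
  The left-hand side is required whenever the mean value u_B is defined,
  i.e. u is integrable on B \<inter> Omega.\<close>
definition poincare_on :: "'x::metric_space measure \<Rightarrow> 'x set \<Rightarrow> real \<Rightarrow> bool" where
  "poincare_on \<mu> \<Omega> q \<longleftrightarrow> (\<exists>C lam. C > 0 \<and> lam \<ge> 1 \<and>
     (\<forall>x \<in> \<Omega>. \<forall>r > 0. \<forall>u g.
        locally_integrable_on \<mu> \<Omega> u \<and> set_integrable \<mu> (ball x r \<inter> \<Omega>) u \<and>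
        upper_gradient \<Omega> (metric (UNIV, dist)) u g \<longrightarrow>
        ennreal ((\<integral>y\<in>ball x r \<inter> \<Omega>. \<bar>u y - avg \<mu> (ball x r \<inter> \<Omega>) u\<bar> \<partial>\<mu>) / measure \<mu> (ball x r \<inter> \<Omega>))
          \<le> ennreal (C * r) *
            epow ((\<integral>\<^sup>+ y \<in> ball x (lam * r) \<inter> \<Omega>. epow (g y) q \<partial>\<mu>) / emeasure \<mu> (ball x (lam * r) \<inter> \<Omega>)) (1 / q)))"

definition uniformly_compact :: "(nat \<Rightarrow> 'y metric) \<Rightarrow> (nat \<Rightarrow> 'y set) \<Rightarrow> bool" where
  "uniformly_compact Y K \<longleftrightarrow>
     (\<exists>D. \<forall>m. \<forall>a \<in> K m. \<forall>b \<in> K m. mdist (Y m) a b \<le> D) \<and>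
     (\<forall>\<epsilon> > 0. \<exists>N::nat. \<forall>m. \<exists>C. finite C \<and> card C \<le> N \<and> C \<subseteq> K m \<and>
         K m \<subseteq> (\<Union>c \<in> C. {y \<in> K m. mdist (Y m) c y < \<epsilon>}))"

definition isometric_embedding :: "'a metric \<Rightarrow> 'b metric \<Rightarrow> ('a \<Rightarrow> 'b) \<Rightarrow> bool" where
  "isometric_embedding A B f \<longleftrightarrow> f ` mspace A \<subseteq> mspace B \<and>
     (\<forall>a \<in> mspace A. \<forall>b \<in> mspace A. mdist B (f a) (f b) = mdist A a b)"

end

theory Submission
  imports Defs "HOL-Library.Diagonal_Subsequence"
begin

text \<open>Averaging \<open>d(u, z)\<close> over balls centred at nets of scale \<open>4\<^sup>-\<^sup>k\<close> and telescoping, the Poincare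
  inequality gives \<open>d(u x, u y)\<^sup>p \<le> C (T x + T y)\<close> for almost all \<open>x\<close>, \<open>y\<close> in a common cell of scale
  \<open>4\<^sup>-\<^sup>k\<close>, where \<open>T\<close> does not depend on \<open>z\<close> and its integral is of order \<open>2\<^sup>-\<^sup>k\<close>. Hence every \<open>u\<^sub>m\<close> is
  close in \<open>L\<^sup>p\<close>, uniformly in \<open>m\<close>, to a map that takes finitely many values on fixed cells.
  Along a diagonal subsequence the mutual distances of all these values, and of the points of
  finite nets in the \<open>K\<^sub>m\<close>, converge; this allows one to glue the \<open>Y\<^sub>m\<close> inside a space of bounded
  functions so that the \<open>\<phi>\<^sub>m \<circ> u\<^sub>m\<close> form a Cauchy sequence in \<open>L\<^sup>p\<close>.

  Since bounded functions form a vector space, midpoints of maps have midpoints of upper gradients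
  as upper gradients. Uniform convexity of \<open>L\<^sup>p\<close> then shows that upper gradients of maps approaching
  the limit \<open>v\<close> with almost minimal energy are Cauchy in \<open>L\<^sup>p\<close>. A subsequence is dominated by a
  single \<open>L\<^sup>p\<close> function, and this common upper gradient passes to \<open>v\<close>.\<close>

text \<open>The assumed Poincare inequality speaks of real functions and genuine upper gradients,
  whereas \<open>u m\<close> takes values in a metric space and comes with a weak gradient. Hence
  each \<open>u m\<close> is first replaced by a representative with a gradient valid on every
  curve. That gradient then serves all functions \<open>mdist (Y m) (u m x) z\<close>, and distances
  between values are recovered by letting \<open>z\<close> approach a value. The strict inequality
  \<open>q < p\<close> enters through a truncation of the gradient, in place of a maximal function.

  The values of a discretization need not lie in \<open>K m\<close>, only at bounded distance from
  \<open>y m\<close>. Over all scales countably many sequences of points arise, so bounded distances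
  and a diagonal argument suffice to glue; uniform compactness is what yields \<open>KZ\<close>.

  Bounded functions on \<open>nat \<times> 'y\<close> form a complete linear space with room for the
  coordinates of all \<open>Y m\<close>. It is not separable, so measurability is expressed by
  distances to points together with a countable set approximating all values.\<close>

lemma mdist_self [simp]: "x \<in> mspace m \<Longrightarrow> mdist m x x = 0"
  by simp

subsection \<open>Powers of extended nonnegative reals\<close>

lemma epow_top [simp]: "epow top p = top"
  by (simp add: epow_def)

lemma epow_ennreal: "0 \<le> a \<Longrightarrow> epow (ennreal a) p = ennreal (a powr p)"
  by (simp add: epow_def)

lemma epow_0 [simp]: "epow 0 p = 0"
  using epow_ennreal[of 0 p] by simp

lemma epow_measurable [measurable]:
  assumes [measurable]: "f \<in> borel_measurable M"
  shows "(\<lambda>x. epow (f x) p) \<in> borel_measurable M"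
  unfolding epow_def by measurable

lemma epow_mono: "0 \<le> p \<Longrightarrow> x \<le> y \<Longrightarrow> epow x p \<le> epow y p"
  by (cases x; cases y) (auto simp: epow_ennreal top_unique intro: powr_mono2)

lemma epow_mult: "0 < c \<Longrightarrow> epow (ennreal c * x) p = ennreal (c powr p) * epow x p"
  by (cases x) (simp_all add: epow_ennreal ennreal_mult[symmetric] powr_mult ennreal_mult_top)

lemma epow_inverse_left: "0 < p \<Longrightarrow> epow (epow x (1 / p)) p = x"
  by (cases x) (auto simp: epow_ennreal powr_powr)

lemma epow_inverse_right: "0 < p \<Longrightarrow> epow (epow x p) (1 / p) = x"
  by (cases x) (auto simp: epow_ennreal powr_powr)

text \<open>Bounding the sum by twice the larger term gives the factor \<open>2 powr p\<close>
  without convexity, hence for every \<open>0 \<le> p\<close>.\<close>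

lemma epow_add_le:
  assumes "0 \<le> p" shows "epow (x + y) p \<le> ennreal (2 powr p) * (epow x p + epow y p)"
proof -
  have *: "epow (x + y) p \<le> ennreal (2 powr p) * epow y p" if "x \<le> y" for x y
  proof -
    have "x + y \<le> ennreal 2 * y"
      using add_right_mono[OF that, of y] by (simp add: mult_2)
    from epow_mono[OF assms this] show ?thesis
      by (simp add: epow_mult del: ennreal_numeral)
  qed
  show ?thesis
  proof (cases "x \<le> y")
    case True
    show ?thesis by (rule order_trans[OF *[OF True]]) (auto intro!: mult_left_mono)
  next
    case False
    then have "y \<le> x" by simp
    from *[OF this] have "epow (x + y) p \<le> ennreal (2 powr p) * epow x p" by (simp add: add.commute)
    then show ?thesis by (rule order_trans) (auto intro!: mult_left_mono)
  qed
qed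

text \<open>The pointwise \<open>p\<close>-norm of the sequence dominates every member, and its
  \<open>p\<close>-th power integrates termwise. Two measures occur because an upper gradient must
  be Borel on the whole space while energies are integrals over the domain only.\<close>

lemma Lp_countable_majorant:
  fixes \<rho> :: "nat \<Rightarrow> 'a \<Rightarrow> ennreal"
  assumes "0 < p" and \<rho>: "\<And>k. \<rho> k \<in> borel_measurable M"
    and sets: "\<And>f. f \<in> borel_measurable M \<Longrightarrow> (f :: 'a \<Rightarrow> ennreal) \<in> borel_measurable \<nu>"
  obtains g where "g \<in> borel_measurable M" "\<forall>k x. \<rho> k x \<le> g x"
    "(\<integral>\<^sup>+ x. epow (g x) p \<partial>\<nu>) = (\<Sum>k. \<integral>\<^sup>+ x. epow (\<rho> k x) p \<partial>\<nu>)"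
proof
  note [measurable] = \<rho>
  let ?g = "\<lambda>x. epow (\<Sum>k. epow (\<rho> k x) p) (1 / p)"
  show "?g \<in> borel_measurable M" by measurable
  show "\<forall>k x. \<rho> k x \<le> ?g x"
  proof (intro allI)
    fix k x
    have "epow (\<rho> k x) p \<le> (\<Sum>k. epow (\<rho> k x) p)"
      using sum_le_suminf[of "\<lambda>k. epow (\<rho> k x) p" "{k}"] by simp
    then have "epow (epow (\<rho> k x) p) (1 / p) \<le> ?g x"
      using \<open>0 < p\<close> by (intro epow_mono) auto
    then show "\<rho> k x \<le> ?g x" using \<open>0 < p\<close> by (simp add: epow_inverse_right)
  qed
  have "(\<integral>\<^sup>+ x. epow (?g x) p \<partial>\<nu>) = (\<integral>\<^sup>+ x. (\<Sum>k. epow (\<rho> k x) p) \<partial>\<nu>)"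
    using \<open>0 < p\<close> by (simp add: epow_inverse_left)
  also have "\<dots> = (\<Sum>k. \<integral>\<^sup>+ x. epow (\<rho> k x) p \<partial>\<nu>)"
    by (intro nn_integral_suminf epow_measurable sets \<rho>)
  finally show "(\<integral>\<^sup>+ x. epow (?g x) p \<partial>\<nu>) = (\<Sum>k. \<integral>\<^sup>+ x. epow (\<rho> k x) p \<partial>\<nu>)" .
qed

subsection \<open>Arc-length parametrized curves\<close>

lemma arclength_curve_dist_le:
  assumes "arclength_curve \<gamma> L" "0 \<le> s" "s \<le> t" "t \<le> L"
  shows "dist (\<gamma> s) (\<gamma> t) \<le> t - s"
proof -
  let ?t = "\<lambda>i::nat. if i = 0 then s else t"
  have "ennreal (\<Sum>i<(1::nat). dist (\<gamma> (?t i)) (\<gamma> (?t (Suc i)))) \<le> curve_length \<gamma> s t"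
    unfolding curve_length_def
    by (rule SUP_upper2[of "(1::nat, ?t)"]) (use assms in auto)
  also have "\<dots> = ennreal (t - s)"
    using assms by (auto simp: arclength_curve_def)
  finally show ?thesis using assms by simp
qed

lemma arclength_curve_continuous:
  assumes "arclength_curve \<gamma> L"
  shows "continuous_on {0..L} \<gamma>"
proof (rule continuous_onI)
  fix x e :: real assume x: "x \<in> {0..L}" "0 < e"
  have "dist (\<gamma> y) (\<gamma> x) \<le> \<bar>y - x\<bar>" if "y \<in> {0..L}" for y
    using arclength_curve_dist_le[OF assms, of x y] arclength_curve_dist_le[OF assms, of y x] x that
    by (cases "x \<le> y") (auto simp: dist_commute)
  then show "\<exists>d>0. \<forall>x'\<in>{0..L}. dist x' x < d \<longrightarrow> dist (\<gamma> x') (\<gamma> x) \<le> e"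
    using x by (intro exI[of _ e]) (fastforce simp: dist_real_def intro: order_trans less_imp_le)
qed

text \<open>A curve is controlled on \<open>{0..L}\<close> only and arbitrary elsewhere, so
  measurability holds for the product with the indicator rather than for the composition.\<close>

lemma curve_integrand_measurable:
  assumes "arclength_curve \<gamma> L" "g \<in> borel_measurable borel" "0 \<le> s" "t \<le> L"
  shows "(\<lambda>r. (g (\<gamma> r) :: ennreal) * indicator {s..t} r) \<in> borel_measurable borel"
proof -
  have "\<gamma> \<in> borel_measurable (restrict_space borel {s..t})"
    using continuous_on_subset[OF arclength_curve_continuous[OF assms(1)], of "{s..t}"] assms
    by (intro borel_measurable_continuous_on_restrict) auto
  then have "(\<lambda>r. g (\<gamma> r)) \<in> borel_measurable (restrict_space borel {s..t})"
    using assms(2) by measurable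
  then show ?thesis
    by (subst (asm) borel_measurable_restrict_space_iff_ennreal) auto
qed

lemma curve_length_shift: "curve_length (\<lambda>r. \<gamma> (s + r)) a b = curve_length \<gamma> (s + a) (s + b)"
  unfolding curve_length_def
proof (rule SUP_eq)
  fix i assume "i \<in> {(n, t). t 0 = a \<and> t n = b \<and> (\<forall>i<n. t i \<le> t (Suc i))}"
  then obtain n t where i: "i = (n, t)" "t 0 = a" "t n = b" "\<forall>i<n. t i \<le> t (Suc i)" by auto
  show "\<exists>j\<in>{(n, t). t 0 = s + a \<and> t n = s + b \<and> (\<forall>i<n. t i \<le> t (Suc i))}.
      (case i of (n, t) \<Rightarrow> ennreal (\<Sum>i<n. dist (\<gamma> (s + t i)) (\<gamma> (s + t (Suc i)))))
      \<le> (case j of (n, t) \<Rightarrow> ennreal (\<Sum>i<n. dist (\<gamma> (t i)) (\<gamma> (t (Suc i)))))"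
    by (rule bexI[of _ "(n, \<lambda>i. s + t i)"]) (use i in auto)
next
  fix j assume "j \<in> {(n, t). t 0 = s + a \<and> t n = s + b \<and> (\<forall>i<n. t i \<le> t (Suc i))}"
  then obtain n t where j: "j = (n, t)" "t 0 = s + a" "t n = s + b" "\<forall>i<n. t i \<le> t (Suc i)" by auto
  show "\<exists>i\<in>{(n, t). t 0 = a \<and> t n = b \<and> (\<forall>i<n. t i \<le> t (Suc i))}.
      (case j of (n, t) \<Rightarrow> ennreal (\<Sum>i<n. dist (\<gamma> (t i)) (\<gamma> (t (Suc i)))))
      \<le> (case i of (n, t) \<Rightarrow> ennreal (\<Sum>i<n. dist (\<gamma> (s + t i)) (\<gamma> (s + t (Suc i)))))"
    by (rule bexI[of _ "(n, \<lambda>i. t i - s)"]) (use j in auto)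
qed

lemma curves_in_subcurve:
  assumes "(\<gamma>, L) \<in> curves_in \<Omega>" "0 \<le> s" "s \<le> t" "t \<le> L"
  shows "(\<lambda>r. \<gamma> (s + r), t - s) \<in> curves_in \<Omega>"
proof -
  have L: "arclength_curve \<gamma> L" and im: "\<gamma> ` {0..L} \<subseteq> \<Omega>"
    using assms(1) by (auto simp: curves_in_def)
  have "arclength_curve (\<lambda>r. \<gamma> (s + r)) (t - s)"
    using L assms unfolding arclength_curve_def curve_length_shift by auto
  moreover have "(\<lambda>r. \<gamma> (s + r)) ` {0..t - s} \<subseteq> \<Omega>"
    using im assms by (auto simp: image_subset_iff)
  ultimately show ?thesis by (simp add: curves_in_def)
qed

lemma line_integral_subcurve:
  assumes "arclength_curve \<gamma> L" "g \<in> borel_measurable borel" "0 \<le> s" "s \<le> t" "t \<le> L"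
  shows "line_integral g (\<lambda>r. \<gamma> (s + r)) (t - s) = (\<integral>\<^sup>+ r \<in> {s..t}. g (\<gamma> r) \<partial>lborel)"
proof -
  have "(\<integral>\<^sup>+ r. g (\<gamma> r) * indicator {s..t} r \<partial>lborel)
      = ennreal \<bar>1\<bar> * (\<integral>\<^sup>+ r. g (\<gamma> (s + 1 * r)) * indicator {s..t} (s + 1 * r) \<partial>lborel)"
    using curve_integrand_measurable[OF assms(1,2,3,5)] by (intro nn_integral_real_affine) auto
  also have "\<dots> = (\<integral>\<^sup>+ r. g (\<gamma> (s + r)) * indicator {0..t - s} r \<partial>lborel)"
    by (auto simp: indicator_def intro!: nn_integral_cong)
  finally show ?thesis by (simp add: line_integral_def)
qed

lemma upper_gradient_subcurve:
  assumes "upper_gradient \<Omega> Z u g" "(\<gamma>, L) \<in> curves_in \<Omega>" "0 \<le> s" "s \<le> t" "t \<le> L"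
  shows "ennreal (mdist Z (u (\<gamma> t)) (u (\<gamma> s))) \<le> (\<integral>\<^sup>+ r \<in> {s..t}. g (\<gamma> r) \<partial>lborel)"
proof -
  have "ennreal (mdist Z (u (\<gamma> (s + (t - s)))) (u (\<gamma> (s + 0)))) \<le> line_integral g (\<lambda>r. \<gamma> (s + r)) (t - s)"
    using assms(1) curves_in_subcurve[OF assms(2-)] unfolding upper_gradient_def by fastforce
  then show ?thesis
    using line_integral_subcurve[of \<gamma> L g s t] assms by (simp add: upper_gradient_def curves_in_def)
qed

text \<open>A finite line integral of a function that is infinite on \<open>N\<close> has two
  effects. No parameter interval of positive length is mapped into \<open>N\<close>, and the
  integrals of \<open>G\<close> over intervals shrinking to \<open>t0\<close> tend to 0, by
  continuity from above of the measure with density \<open>F\<close>. A parameter outside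
  \<open>N\<close> in a short interval then has both properties.\<close>

lemma generic_parameter_near:
  assumes L: "arclength_curve \<gamma> L" "0 < L" and G: "G \<in> borel_measurable borel"
    and fin: "line_integral (\<lambda>x. G x + top * indicator N x) \<gamma> L < top"
    and t0: "t0 \<in> {0..L}" and "0 < e"
  obtains t where "t \<in> {0..L}" "\<gamma> t \<notin> N"
    "(\<integral>\<^sup>+ r \<in> {min t t0..max t t0}. G (\<gamma> r) \<partial>lborel) < e"
proof -
  define F where "F r = G (\<gamma> r) * indicator {0..L} r" for r
  have F[measurable]: "F \<in> borel_measurable borel"
    unfolding F_def using curve_integrand_measurable[OF L(1) G, of 0 L] by simp
  have Ffin: "(\<integral>\<^sup>+ r. F r \<partial>lborel) < top"
    using fin unfolding line_integral_def F_def
    by (rule le_less_trans[rotated]) (auto intro!: nn_integral_mono mult_right_mono)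
  define I where "I n = {t0 - 1 / Suc n..t0 + 1 / Suc n}" for n
  let ?\<kappa> = "density lborel F"
  have "(\<lambda>n. emeasure ?\<kappa> (I n)) \<longlonglongrightarrow> emeasure ?\<kappa> (\<Inter>n. I n)"
  proof (rule Lim_emeasure_decseq)
    show "range I \<subseteq> sets ?\<kappa>" by (auto simp: I_def)
    show "decseq I"
    proof (unfold decseq_def, intro allI impI)
      fix m n :: nat assume "m \<le> n"
      then have "1 / real (Suc n) \<le> 1 / real (Suc m)" by (simp add: frac_le)
      then show "I n \<subseteq> I m" unfolding I_def by (subst atLeastatMost_subset_iff) linarith
    qed
    have "emeasure ?\<kappa> (I n) \<le> (\<integral>\<^sup>+ r. F r \<partial>lborel)" for n
      by (subst emeasure_density) (auto simp: I_def indicator_def intro!: nn_integral_mono)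
    then show "emeasure ?\<kappa> (I n) \<noteq> \<infinity>" for n
      using le_less_trans[OF _ Ffin] by (metis infinity_ennreal_def less_irrefl)
  qed
  moreover have "(\<Inter>n. I n) = {t0}"
  proof -
    have "x = t0" if "\<And>n. x \<in> I n" for x
    proof (rule ccontr)
      assume "x \<noteq> t0"
      then obtain n where "1 / real (Suc n) < \<bar>x - t0\<bar>"
        using nat_approx_posE[of "\<bar>x - t0\<bar>"] by auto
      with that[of n] show False by (auto simp: I_def abs_if split: if_splits)
    qed
    then show ?thesis by (auto simp: I_def)
  qed
  moreover have "emeasure ?\<kappa> {t0} = 0"
    by (subst emeasure_density) (auto simp: nn_integral_0_iff_AE intro!: AE_I'[of "{t0}"] split: split_indicator_asm)
  ultimately have "(\<lambda>n. emeasure ?\<kappa> (I n)) \<longlonglongrightarrow> 0" by simp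
  then obtain n where n: "emeasure ?\<kappa> (I n) < e"
    using \<open>0 < e\<close> by (metis eventually_sequentially order_refl order_tendstoD(2))
  \<comment> \<open>The window is clipped to \<open>{0..L}\<close>; it keeps positive length even if
    \<open>t0\<close> is an endpoint, because \<open>0 < L\<close>.\<close>
  define a b where "a = max 0 (t0 - 1 / Suc n)" and "b = min L (t0 + 1 / Suc n)"
  have ab: "a < b" "{a..b} \<subseteq> {0..L} \<inter> I n" "t0 \<in> {a..b}"
  proof -
    have "0 < 1 / real (Suc n)" by simp
    then show "a < b" "{a..b} \<subseteq> {0..L} \<inter> I n" "t0 \<in> {a..b}"
      using t0 L unfolding a_def b_def I_def atLeastAtMost_iff
      by (auto simp del: of_nat_Suc simp: max_def min_def; linarith)+
  qed
  have "\<exists>t\<in>{a..b}. \<gamma> t \<notin> N"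
  proof (rule ccontr)
    assume "\<not> ?thesis"
    then have *: "\<And>t. t \<in> {a..b} \<Longrightarrow> \<gamma> t \<in> N" by blast
    have "(\<integral>\<^sup>+ r. top * indicator {a..b} r \<partial>lborel) = top * emeasure lborel {a..b}"
      by (rule nn_integral_cmult_indicator) simp
    then have "top = (\<integral>\<^sup>+ r. top * indicator {a..b} r \<partial>lborel)"
      using ab(1) by (simp add: ennreal_top_mult)
    also have "\<dots> \<le> line_integral (\<lambda>x. G x + top * indicator N x) \<gamma> L"
      unfolding line_integral_def using * ab
      by (intro nn_integral_mono) (auto split: split_indicator)
    finally show False using fin by (simp add: top_unique)
  qed
  then obtain t where t: "t \<in> {a..b}" "\<gamma> t \<notin> N" by blast
  have "(\<integral>\<^sup>+ r \<in> {min t t0..max t t0}. G (\<gamma> r) \<partial>lborel) \<le> (\<integral>\<^sup>+ r. F r * indicator (I n) r \<partial>lborel)"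
  proof (rule nn_integral_mono)
    fix r
    show "G (\<gamma> r) * indicator {min t t0..max t t0} r \<le> F r * indicator (I n) r"
    proof (cases "r \<in> {min t t0..max t t0}")
      case True
      then have "r \<in> {a..b}" using t ab(3) by auto
      then have "r \<in> {0..L}" "r \<in> I n" using ab(2) by auto
      then show ?thesis by (simp add: F_def indicator_def)
    qed simp
  qed
  also have "\<dots> = emeasure ?\<kappa> (I n)"
    by (subst emeasure_density) (auto simp: I_def)
  finally show thesis using that[of t] t ab(2) n by auto
qed

text \<open>The parameter is found from \<open>G\<close> alone, so one \<open>t\<close> serves all
  maps with upper gradient \<open>G\<close>. This uniformity is what transfers the Cauchy property
  of a whole sequence of maps from \<open>\<gamma> t\<close> to \<open>\<gamma> t0\<close>.\<close>

lemma upper_gradient_generic_parameter: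
  assumes \<gamma>: "(\<gamma>, L) \<in> curves_in \<Omega>" "0 < L" and G: "G \<in> borel_measurable borel"
    and fin: "line_integral (\<lambda>x. G x + top * indicator N x) \<gamma> L < top"
    and t0: "t0 \<in> {0..L}" and "0 < e"
  obtains t where "t \<in> {0..L}" "\<gamma> t \<in> \<Omega> - N"
    "\<forall>w. upper_gradient \<Omega> Z w G \<longrightarrow> mdist Z (w (\<gamma> t)) (w (\<gamma> t0)) < e"
proof -
  obtain t where t: "t \<in> {0..L}" "\<gamma> t \<notin> N"
    "(\<integral>\<^sup>+ r \<in> {min t t0..max t t0}. G (\<gamma> r) \<partial>lborel) < ennreal e"
    using generic_parameter_near[OF _ \<gamma>(2) G fin t0, of "ennreal e"] \<gamma> \<open>0 < e\<close>
    by (auto simp: curves_in_def)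
  have "mdist Z (w (\<gamma> t)) (w (\<gamma> t0)) < e" if w: "upper_gradient \<Omega> Z w G" for w
  proof -
    have "ennreal (mdist Z (w (\<gamma> (max t t0))) (w (\<gamma> (min t t0)))) < ennreal e"
      by (rule le_less_trans[OF upper_gradient_subcurve[OF w \<gamma>(1)] t(3)]) (use t t0 in auto)
    then show ?thesis
      by (cases "t \<le> t0") (auto simp: max_def min_def mdist_commute ennreal_less_iff split: if_splits)
  qed
  moreover have "\<gamma> t \<in> \<Omega>" using t(1) \<gamma> by (auto simp: curves_in_def)
  ultimately show thesis using that[of t] t by blast
qed

lemma upper_gradient_mono:
  assumes "upper_gradient \<Omega> Z w g" "h \<in> borel_measurable borel" "\<And>x. g x \<le> h x"
  shows "upper_gradient \<Omega> Z w h"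
proof -
  have "line_integral g \<gamma> L \<le> line_integral h \<gamma> L" for \<gamma> L
    unfolding line_integral_def by (intro nn_integral_mono mult_right_mono assms) auto
  then show ?thesis
    using assms unfolding upper_gradient_def by (blast intro: order_trans)
qed

subsection \<open>Separably valued measurable maps\<close>

text \<open>Strong measurability in a possibly nonseparable target. The countable set approximates
  the values at every point, not only almost everywhere, so that no null set has to be carried
  along.\<close>

definition separably_measurable :: "'x measure \<Rightarrow> 'z metric \<Rightarrow> ('x \<Rightarrow> 'z) \<Rightarrow> bool" where
  "separably_measurable \<nu> Z w \<longleftrightarrow> w ` space \<nu> \<subseteq> mspace Z \<and>
     (\<forall>z\<in>mspace Z. (\<lambda>x. mdist Z (w x) z) \<in> borel_measurable \<nu>) \<and>
     (\<exists>D. countable D \<and> D \<subseteq> mspace Z \<and> (\<forall>x\<in>space \<nu>. \<forall>e>0. \<exists>z\<in>D. mdist Z (w x) z < e))"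

lemma separably_measurableD:
  assumes "separably_measurable \<nu> Z w"
  shows "x \<in> space \<nu> \<Longrightarrow> w x \<in> mspace Z"
    and "z \<in> mspace Z \<Longrightarrow> (\<lambda>x. mdist Z (w x) z) \<in> borel_measurable \<nu>"
  using assms by (auto simp: separably_measurable_def)

lemma separably_measurable_dense:
  assumes "separably_measurable \<nu> Z w"
  obtains D where "countable D" "D \<subseteq> mspace Z" "\<forall>x\<in>space \<nu>. \<forall>e>0. \<exists>z\<in>D. mdist Z (w x) z < e"
  using assms unfolding separably_measurable_def by (elim conjE exE) (rule that)

text \<open>The strict inequality leaves a gap, and a point of \<open>D\<close> within half of it is
  a witness. A condition on the distance of two variable points thus becomes a countable union of
  conditions on distances to fixed points.\<close>

lemma mdist_less_iff_dense:
  assumes D: "D \<subseteq> mspace Z" "\<And>e. e > 0 \<Longrightarrow> \<exists>z\<in>D. mdist Z a z < e"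
    and a: "a \<in> mspace Z" and b: "b \<in> mspace Z"
  shows "mdist Z a b < c \<longleftrightarrow> (\<exists>z\<in>D. mdist Z a z + mdist Z b z < c)"
proof
  assume "mdist Z a b < c"
  then obtain z where z: "z \<in> D" "mdist Z a z < (c - mdist Z a b) / 2"
    using D(2)[of "(c - mdist Z a b) / 2"] by auto
  have "mdist Z b z \<le> mdist Z b a + mdist Z a z"
    using z D a b by (intro mdist_triangle) auto
  with z show "\<exists>z\<in>D. mdist Z a z + mdist Z b z < c"
    by (intro bexI[of _ z]) (auto simp: mdist_commute field_simps)
next
  assume "\<exists>z\<in>D. mdist Z a z + mdist Z b z < c"
  then obtain z where z: "z \<in> D" "mdist Z a z + mdist Z b z < c" by blast
  have "mdist Z a b \<le> mdist Z a z + mdist Z z b"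
    using z D a b by (intro mdist_triangle) auto
  with z show "mdist Z a b < c" by (simp add: mdist_commute)
qed

lemma separably_measurable_mdist:
  assumes w: "separably_measurable \<nu> Z w" and w': "separably_measurable \<nu> Z w'"
  shows "(\<lambda>x. mdist Z (w x) (w' x)) \<in> borel_measurable \<nu>"
proof -
  obtain D where D: "countable D" "D \<subseteq> mspace Z"
    "\<forall>x\<in>space \<nu>. \<forall>e>0. \<exists>z\<in>D. mdist Z (w x) z < e"
    by (rule separably_measurable_dense[OF w])
  have "{x \<in> space \<nu>. mdist Z (w x) (w' x) < c} \<in> sets \<nu>" for c
  proof -
    have "{x \<in> space \<nu>. mdist Z (w x) (w' x) < c}
        = (\<Union>z\<in>D. {x \<in> space \<nu>. mdist Z (w x) z + mdist Z (w' x) z < c})"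
      using mdist_less_iff_dense[of D Z] D separably_measurableD(1)[OF w]
        separably_measurableD(1)[OF w'] by fastforce
    also have "\<dots> \<in> sets \<nu>"
    proof (rule sets.countable_UN''[OF D(1)])
      fix z assume "z \<in> D"
      then have [measurable]: "(\<lambda>x. mdist Z (w x) z) \<in> borel_measurable \<nu>" "(\<lambda>x. mdist Z (w' x) z) \<in> borel_measurable \<nu>"
        using separably_measurableD(2)[OF w] separably_measurableD(2)[OF w'] D(2) by auto
      show "{x \<in> space \<nu>. mdist Z (w x) z + mdist Z (w' x) z < c} \<in> sets \<nu>" by measurable
    qed
    finally show ?thesis .
  qed
  then show ?thesis
    by (simp add: borel_measurable_iff_less)
qed

text \<open>An open subset of a nonseparable space need not be a countable union of balls. Its
  preimage is nevertheless that of the countably many balls around points of \<open>D\<close> with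
  radii \<open>1 / Suc n\<close> that lie inside it, since all values are limits of points of
  \<open>D\<close>.\<close>

lemma separably_measurable_imp_measurable:
  assumes w: "separably_measurable \<nu> Z w"
  shows "w \<in> measurable \<nu> (borel_of_top (mtopology_of Z))"
  unfolding borel_of_top_def
proof (rule measurable_sigma_sets[OF sets_measure_of])
  obtain D where D: "countable D" "D \<subseteq> mspace Z"
    "\<forall>x\<in>space \<nu>. \<forall>e>0. \<exists>z\<in>D. mdist Z (w x) z < e"
    by (rule separably_measurable_dense[OF w])
  interpret Metric_space "mspace Z" "mdist Z" by simp
  show "{U. openin (mtopology_of Z) U} \<subseteq> Pow (topspace (mtopology_of Z))"
    using openin_subset by blast
  show "{U. openin (mtopology_of Z) U} \<subseteq> Pow (topspace (mtopology_of Z))"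
    using openin_subset by blast
  show "w \<in> space \<nu> \<rightarrow> topspace (mtopology_of Z)"
    using separably_measurableD(1)[OF w] by auto
  fix U assume "U \<in> {U. openin (mtopology_of Z) U}"
  then have U: "U \<subseteq> mspace Z" "\<And>z. z \<in> U \<Longrightarrow> \<exists>r>0. mball z r \<subseteq> U"
    by (auto simp: mtopology_of_def openin_mtopology)
  let ?I = "{(z, n::nat). z \<in> D \<and> mball z (1 / Suc n) \<subseteq> U}"
  have "w -` U \<inter> space \<nu> = (\<Union>(z, n)\<in>?I. {x \<in> space \<nu>. mdist Z (w x) z < 1 / Suc n})"
  proof (intro set_eqI iffI)
    fix x assume x: "x \<in> w -` U \<inter> space \<nu>"
    then obtain r where r: "r > 0" "mball (w x) r \<subseteq> U" using U(2) by auto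
    obtain n where n: "1 / real (Suc n) < r / 2" using nat_approx_posE[of "r / 2"] r by auto
    obtain z where z: "z \<in> D" "mdist Z (w x) z < 1 / Suc n" using D(3) x by (metis IntE of_nat_0_less_iff zero_less_Suc zero_less_divide_1_iff)
    have "mball z (1 / Suc n) \<subseteq> mball (w x) r"
    proof
      fix y assume y: "y \<in> mball z (1 / Suc n)"
      have "mdist Z (w x) y \<le> mdist Z (w x) z + mdist Z z y"
        using x y z D(2) U(1) by (intro triangle) auto
      also have "\<dots> < r" using n y z(2) by auto
      finally show "y \<in> mball (w x) r" using x y U(1) by auto
    qed
    then have "(z, n) \<in> ?I" using z r by auto
    then show "x \<in> (\<Union>(z, n)\<in>?I. {x \<in> space \<nu>. mdist Z (w x) z < 1 / Suc n})"
      using z x by blast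
  next
    fix x assume "x \<in> (\<Union>(z, n)\<in>?I. {x \<in> space \<nu>. mdist Z (w x) z < 1 / Suc n})"
    then obtain z n where z: "z \<in> D" "mball z (1 / Suc n) \<subseteq> U" "x \<in> space \<nu>" "mdist Z (w x) z < 1 / Suc n"
      by blast
    then have "w x \<in> mball z (1 / Suc n)"
      using separably_measurableD(1)[OF w] D(2) commute by auto
    then show "x \<in> w -` U \<inter> space \<nu>" using z by auto
  qed
  also have "\<dots> \<in> sets \<nu>"
  proof (rule sets.countable_UN'')
    have "?I \<subseteq> D \<times> UNIV" by auto
    then show "countable ?I" by (rule countable_subset) (use D in auto)
    fix i assume i: "i \<in> ?I"
    then have [measurable]: "(\<lambda>x. mdist Z (w x) (fst i)) \<in> borel_measurable \<nu>"
      using separably_measurableD(2)[OF w] D(2) by auto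
    show "(case i of (z, n) \<Rightarrow> {x \<in> space \<nu>. mdist Z (w x) z < 1 / real (Suc n)}) \<in> sets \<nu>"
      unfolding case_prod_beta by measurable
  qed
  finally show "w -` U \<inter> space \<nu> \<in> sets \<nu>" .
qed

lemma separable_subspace_dense:
  assumes "separable_space (subtopology (mtopology_of Z) S)"
  obtains D where "countable D" "D \<subseteq> mspace Z"
    "\<forall>z\<in>S \<inter> mspace Z. \<forall>e>0. \<exists>d\<in>D. mdist Z z d < e"
proof -
  interpret Metric_space "mspace Z" "mdist Z" by simp
  let ?X = "subtopology (mtopology_of Z) S"
  obtain D where D: "countable D" "D \<subseteq> topspace ?X" "?X closure_of D = topspace ?X"
    using assms unfolding separable_space_def by blast
  have "\<exists>d\<in>D. mdist Z z d < e" if z: "z \<in> S" "z \<in> mspace Z" "0 < e" for z e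
  proof -
    have "z \<in> ?X closure_of D" using z D(3) by auto
    moreover have "openin ?X (S \<inter> mball z e)"
      unfolding openin_subtopology by (intro exI[of _ "mball z e"]) (auto simp: mtopology_of_def)
    ultimately obtain d where "d \<in> D" "d \<in> S \<inter> mball z e"
      using z unfolding in_closure_of by (metis IntI centre_in_mball_iff)
    then show ?thesis by auto
  qed
  then show thesis using that[of D] D by auto
qed

lemma measurable_mdist_borel_of_top:
  assumes u: "u \<in> measurable \<nu> (borel_of_top (mtopology_of Z))" and z: "z \<in> mspace Z"
  shows "(\<lambda>x. mdist Z (u x) z) \<in> borel_measurable \<nu>"
proof -
  interpret Metric_space "mspace Z" "mdist Z" by simp
  have sp: "space (borel_of_top (mtopology_of Z)) = mspace Z"
    unfolding borel_of_top_def by (simp add: space_measure_of_conv)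
  have "{x \<in> space \<nu>. mdist Z (u x) z < c} \<in> sets \<nu>" for c
  proof -
    have "mball z c \<in> sets (borel_of_top (mtopology_of Z))"
      unfolding borel_of_top_def
      using openin_subset[of mtopology]
      by (subst sets_measure_of) (auto simp: mtopology_of_def subset_iff)
    from measurable_sets[OF u this] show ?thesis
      using measurable_space[OF u] sp z by (auto simp: commute vimage_def Int_def conj_commute cong: conj_cong)
  qed
  then show ?thesis by (simp add: borel_measurable_iff_less)
qed

subsection \<open>Good representatives of Newton--Sobolev maps\<close>

lemma nn_integral_restrict_open:
  fixes \<mu> :: "'x::metric_space measure"
  assumes "sets \<mu> = sets borel" "open \<Omega>"
  shows "(\<integral>\<^sup>+ x. f x \<partial>restrict_space \<mu> \<Omega>) = (\<integral>\<^sup>+ x\<in>\<Omega>. f x \<partial>\<mu>)"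
  using assms sets_eq_imp_space_eq[OF assms(1)] by (intro nn_integral_restrict_space) auto

lemma borel_measurable_restrict_space_borel:
  assumes "sets \<mu> = sets borel" "f \<in> borel_measurable borel"
  shows "f \<in> borel_measurable (restrict_space \<mu> \<Omega>)"
  by (rule measurable_restrict_space1) (use assms measurable_cong_sets[OF assms(1) refl] in blast)

text \<open>Vanishing modulus gives functions of small energy whose integrals along the family are
  at least 1. Scaling lets these integrals exceed every bound while the energies stay summable,
  which is what a single majorant with infinite line integrals requires.\<close>

lemma modulus_zero_exceptional:
  fixes \<mu> :: "'x::metric_space measure"
  assumes sets: "sets \<mu> = sets borel" and \<Omega>: "open \<Omega>" and p: "0 < p" and mod0: "modulus \<mu> \<Omega> p \<Gamma> = 0"
    and \<Gamma>: "\<Gamma> \<subseteq> curves_in \<Omega>"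
  obtains \<sigma> :: "nat \<Rightarrow> 'x \<Rightarrow> ennreal" where "\<forall>k. \<sigma> k \<in> borel_measurable borel"
    "\<forall>k. (\<integral>\<^sup>+ x. epow (\<sigma> k x) p \<partial>restrict_space \<mu> \<Omega>) \<le> ennreal ((1 / 2) ^ Suc k)"
    "\<forall>k. \<forall>(\<gamma>, L)\<in>\<Gamma>. of_nat (Suc k) \<le> line_integral (\<sigma> k) \<gamma> L"
proof -
  \<comment> \<open>The divisor \<open>real (Suc k) powr p\<close> pays in advance for the factor
    \<open>Suc k\<close> in \<open>\<sigma> k\<close>.\<close>
  have "\<exists>\<rho>. \<rho> \<in> borel_measurable borel \<and> (\<forall>(\<gamma>, L)\<in>\<Gamma>. 1 \<le> line_integral \<rho> \<gamma> L) \<and>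
      (\<integral>\<^sup>+ x\<in>\<Omega>. epow (\<rho> x) p \<partial>\<mu>) < ennreal ((1 / 2) ^ Suc k / real (Suc k) powr p)" for k
  proof -
    have "modulus \<mu> \<Omega> p \<Gamma> < ennreal ((1 / 2) ^ Suc k / real (Suc k) powr p)"
      unfolding mod0 by simp
    then show ?thesis
      unfolding modulus_def INF_less_iff by simp
  qed
  then obtain \<rho> where "\<forall>k. \<rho> k \<in> borel_measurable borel \<and> (\<forall>(\<gamma>, L)\<in>\<Gamma>. 1 \<le> line_integral (\<rho> k) \<gamma> L) \<and>
      (\<integral>\<^sup>+ x\<in>\<Omega>. epow (\<rho> k x) p \<partial>\<mu>) < ennreal ((1 / 2) ^ Suc k / real (Suc k) powr p)"
    by (rule exE[OF choice[OF allI]])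
  then have \<rho>: "\<rho> k \<in> borel_measurable borel" "(\<gamma>, L) \<in> \<Gamma> \<Longrightarrow> 1 \<le> line_integral (\<rho> k) \<gamma> L"
    "(\<integral>\<^sup>+ x\<in>\<Omega>. epow (\<rho> k x) p \<partial>\<mu>) < ennreal ((1 / 2) ^ Suc k / real (Suc k) powr p)" for k \<gamma> L
    by auto
  note [measurable] = \<rho>(1)
  define \<sigma> where "\<sigma> k x = ennreal (Suc k) * \<rho> k x" for k x
  have "(\<integral>\<^sup>+ x. epow (\<sigma> k x) p \<partial>restrict_space \<mu> \<Omega>) \<le> ennreal ((1 / 2) ^ Suc k)" for k
  proof -
    have [measurable]: "\<rho> k \<in> borel_measurable (restrict_space \<mu> \<Omega>)"
      using sets by (intro borel_measurable_restrict_space_borel) auto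
    have "(\<integral>\<^sup>+ x. epow (\<sigma> k x) p \<partial>restrict_space \<mu> \<Omega>)
        = (\<integral>\<^sup>+ x. ennreal (real (Suc k) powr p) * epow (\<rho> k x) p \<partial>restrict_space \<mu> \<Omega>)"
      unfolding \<sigma>_def by (subst epow_mult) auto
    also have "\<dots> = ennreal (real (Suc k) powr p) * (\<integral>\<^sup>+ x\<in>\<Omega>. epow (\<rho> k x) p \<partial>\<mu>)"
      by (subst nn_integral_cmult) (measurable, simp add: nn_integral_restrict_open[OF sets \<Omega>])
    also have "\<dots> \<le> ennreal (real (Suc k) powr p) * ennreal ((1 / 2) ^ Suc k / real (Suc k) powr p)"
      using \<rho>(3)[of k] by (intro mult_left_mono) auto
    also have "\<dots> = ennreal ((1 / 2) ^ Suc k)"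
      by (subst ennreal_mult[symmetric]) auto
    finally show ?thesis .
  qed
  moreover have "of_nat (Suc k) \<le> line_integral (\<sigma> k) \<gamma> L" if "(\<gamma>, L) \<in> \<Gamma>" for k \<gamma> L
  proof -
    have \<gamma>: "arclength_curve \<gamma> L" using that \<Gamma> by (auto simp: curves_in_def)
    have "line_integral (\<sigma> k) \<gamma> L = ennreal (Suc k) * line_integral (\<rho> k) \<gamma> L"
      unfolding line_integral_def \<sigma>_def mult.assoc
      using curve_integrand_measurable[OF \<gamma> \<rho>(1), of 0 L k] by (intro nn_integral_cmult) auto
    also have "\<dots> \<ge> ennreal (Suc k) * 1"
      using \<rho>(2)[OF that] by (intro mult_left_mono) auto
    finally show ?thesis by (simp only: ennreal_of_nat_eq_real_of_nat mult_1_right)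
  qed
  moreover have "\<sigma> k \<in> borel_measurable borel" for k
    unfolding \<sigma>_def by measurable
  ultimately show thesis by (intro that[of \<sigma>]) auto
qed


text \<open>Along an exceptional curve a common majorant of all \<open>\<sigma> k\<close> has
  infinite integral, so the gradient inequality is void there; along all other curves it suffices
  that the majorant exceeds \<open>g\<close>. The additional energy 1 is the sum of the half
  powers.\<close>

lemma weak_upper_gradient_imp_upper_gradient:
  fixes \<mu> :: "'x::metric_space measure"
  assumes sets: "sets \<mu> = sets borel" and \<Omega>: "open \<Omega>" and p: "0 < p"
    and g: "weak_upper_gradient \<mu> p \<Omega> Z u g"
  obtains h where "upper_gradient \<Omega> Z u h"
    "(\<integral>\<^sup>+ x. epow (h x) p \<partial>restrict_space \<mu> \<Omega>) \<le> (\<integral>\<^sup>+ x\<in>\<Omega>. epow (g x) p \<partial>\<mu>) + 1"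
proof -
  obtain \<Gamma> where \<Gamma>: "\<Gamma> \<subseteq> curves_in \<Omega>" "modulus \<mu> \<Omega> p \<Gamma> = 0" and g_borel: "g \<in> borel_measurable borel"
    and g_ug: "\<forall>(\<gamma>, L) \<in> curves_in \<Omega> - \<Gamma>. ennreal (mdist Z (u (\<gamma> L)) (u (\<gamma> 0))) \<le> line_integral g \<gamma> L"
    using g unfolding weak_upper_gradient_def by (elim conjE exE) (rule that)
  obtain \<sigma> :: "nat \<Rightarrow> 'x \<Rightarrow> ennreal" where \<sigma>: "\<forall>k. \<sigma> k \<in> borel_measurable borel"
    "\<forall>k. (\<integral>\<^sup>+ x. epow (\<sigma> k x) p \<partial>restrict_space \<mu> \<Omega>) \<le> ennreal ((1 / 2) ^ Suc k)"
    "\<forall>k. \<forall>(\<gamma>, L)\<in>\<Gamma>. of_nat (Suc k) \<le> line_integral (\<sigma> k) \<gamma> L"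
    by (rule modulus_zero_exceptional[OF sets \<Omega> p \<Gamma>(2,1)])
  define \<rho> where "\<rho> n = (case n of 0 \<Rightarrow> g | Suc k \<Rightarrow> \<sigma> k)" for n
  have \<rho>: "\<rho> n \<in> borel_measurable borel" for n
    using g_borel \<sigma>(1) by (cases n) (auto simp: \<rho>_def)
  obtain h where h: "h \<in> borel_measurable borel" "\<forall>k x. \<rho> k x \<le> h x"
    "(\<integral>\<^sup>+ x. epow (h x) p \<partial>restrict_space \<mu> \<Omega>) = (\<Sum>k. \<integral>\<^sup>+ x. epow (\<rho> k x) p \<partial>restrict_space \<mu> \<Omega>)"
    by (rule Lp_countable_majorant[of p \<rho> borel "restrict_space \<mu> \<Omega>", OF p \<rho> borel_measurable_restrict_space_borel[OF sets]])
  have line_mono: "line_integral (\<rho> n) \<gamma> L \<le> line_integral h \<gamma> L" for n \<gamma> L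
    unfolding line_integral_def by (intro nn_integral_mono mult_right_mono h(2)[rule_format]) auto
  have "upper_gradient \<Omega> Z u h"
    unfolding upper_gradient_def
  proof (intro conjI h(1) ballI, clarify)
    fix \<gamma> L assume \<gamma>: "(\<gamma>, L) \<in> curves_in \<Omega>"
    show "ennreal (mdist Z (u (\<gamma> L)) (u (\<gamma> 0))) \<le> line_integral h \<gamma> L"
    proof (cases "(\<gamma>, L) \<in> \<Gamma>")
      case False
      then have "ennreal (mdist Z (u (\<gamma> L)) (u (\<gamma> 0))) \<le> line_integral g \<gamma> L"
        using bspec[OF g_ug, of "(\<gamma>, L)"] \<gamma> by simp
      also have "\<dots> \<le> line_integral h \<gamma> L"
        using line_mono[of 0 \<gamma> L] by (simp add: \<rho>_def)
      finally show ?thesis .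
    next
      case True
      have "of_nat (Suc k) \<le> line_integral h \<gamma> L" for k
        using bspec[OF spec[OF \<sigma>(3)] True, of k] line_mono[of "Suc k" \<gamma> L] by (simp add: \<rho>_def)
      then have "line_integral h \<gamma> L = top"
      proof (cases "line_integral h \<gamma> L")
        case (real r)
        obtain n where "r < real n" using reals_Archimedean2 by blast
        moreover have "ennreal (real (Suc n)) \<le> ennreal r"
          using \<open>\<And>k. of_nat (Suc k) \<le> line_integral h \<gamma> L\<close>[of n] real
          by (simp only: ennreal_of_nat_eq_real_of_nat)
        ultimately show ?thesis using real(1) by (simp add: ennreal_le_iff del: of_nat_Suc)
      qed simp
      then show ?thesis by simp
    qed
  qed
  moreover have "(\<integral>\<^sup>+ x. epow (h x) p \<partial>restrict_space \<mu> \<Omega>) \<le> (\<integral>\<^sup>+ x\<in>\<Omega>. epow (g x) p \<partial>\<mu>) + 1"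
  proof -
    let ?I = "\<lambda>f. \<integral>\<^sup>+ x. epow (f x) p \<partial>restrict_space \<mu> \<Omega>"
    have "(\<Sum>k. ?I (\<rho> k)) = (\<Sum>k. ?I (\<sigma> k)) + ?I g"
      using suminf_offset[of "\<lambda>k. ?I (\<rho> k)" 1] by (simp add: \<rho>_def add.commute)
    also have "(\<Sum>k. ?I (\<sigma> k)) \<le> (\<Sum>k. ennreal ((1 / 2) ^ Suc k))"
      by (intro suminf_le \<sigma>(2)[rule_format]) auto
    also have "(\<Sum>k. ennreal ((1 / 2) ^ Suc k)) = 1"
      using power_half_series by (subst suminf_ennreal_eq[of _ 1]) auto
    finally show ?thesis
      unfolding h(3) nn_integral_restrict_open[OF sets \<Omega>, symmetric] by (simp add: add.commute add_mono)
  qed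
  ultimately show thesis by (rule that)
qed

text \<open>A gradient that is infinite on the exceptional null set forces each curve with finite integral
  to avoid this set at almost all times; the remaining times are reached because \<open>u\<close> is
  continuous along such a curve.\<close>

lemma N1p_good_representative:
  fixes \<mu> :: "'x::metric_space measure"
  assumes sets: "sets \<mu> = sets borel" and \<Omega>: "open \<Omega>" and p: "0 < p"
    and u: "u \<in> N1p \<mu> p \<Omega> Z" and E: "p_energy \<mu> p \<Omega> Z u \<le> ennreal B" and z0: "z0 \<in> mspace Z"
  obtains u' g where "separably_measurable (restrict_space \<mu> \<Omega>) Z u'"
    "AE x in restrict_space \<mu> \<Omega>. u' x = u x" "upper_gradient \<Omega> Z u' g"
    "(\<integral>\<^sup>+ x. epow (g x) p \<partial>restrict_space \<mu> \<Omega>) \<le> ennreal B + 2"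
proof -
  let ?\<nu> = "restrict_space \<mu> \<Omega>"
  have sp: "space ?\<nu> = \<Omega>"
    using sets_eq_imp_space_eq[OF sets] by (simp add: space_restrict_space)
  have \<Omega>_sets: "\<Omega> \<in> sets \<mu>" using sets \<Omega> by simp
  \<comment> \<open>The energy is an infimum, so a gradient is taken within 1 of it; the passage to
    a genuine upper gradient costs another 1. This explains the bound
    \<open>ennreal B + 2\<close>.\<close>
  have "p_energy \<mu> p \<Omega> Z u < ennreal B + 1"
    using E by (rule le_less_trans) (simp add: ennreal_add_left_cancel_less[of "ennreal B" 0 1, simplified])
  then obtain g0 where g0: "weak_upper_gradient \<mu> p \<Omega> Z u g0" "(\<integral>\<^sup>+ x\<in>\<Omega>. epow (g0 x) p \<partial>\<mu>) < ennreal B + 1"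
    unfolding p_energy_def INF_less_iff by auto
  obtain h where h: "upper_gradient \<Omega> Z u h"
    "(\<integral>\<^sup>+ x. epow (h x) p \<partial>?\<nu>) \<le> (\<integral>\<^sup>+ x\<in>\<Omega>. epow (g0 x) p \<partial>\<mu>) + 1"
    by (rule weak_upper_gradient_imp_upper_gradient[OF sets \<Omega> p g0(1)])
  have h_borel[measurable]: "h \<in> borel_measurable borel" using h(1) by (simp add: upper_gradient_def)
  have Lp: "u \<in> measurable ?\<nu> (borel_of_top (mtopology_of Z))"
    "\<exists>N \<in> null_sets \<mu>. separable_space (subtopology (mtopology_of Z) (u ` (\<Omega> - N)))"
    using u by (auto simp: N1p_def Lp_metric_def)
  have u_Z: "u x \<in> mspace Z" if "x \<in> \<Omega>" for x
    using measurable_space[OF Lp(1), of x] that sp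
    by (simp add: borel_of_top_def space_measure_of_conv)
  obtain N where N: "N \<in> null_sets \<mu>" "separable_space (subtopology (mtopology_of Z) (u ` (\<Omega> - N)))"
    using Lp(2) by blast
  obtain D0 where D0: "countable D0" "D0 \<subseteq> mspace Z"
    "\<forall>z\<in>u ` (\<Omega> - N) \<inter> mspace Z. \<forall>e>0. \<exists>d\<in>D0. mdist Z z d < e"
    by (rule separable_subspace_dense[OF N(2)])
  define D where "D = insert z0 D0"
  have D: "countable D" "D \<subseteq> mspace Z" using D0 z0 by (auto simp: D_def)
  \<comment> \<open>\<open>E\<close> is described by approximability of the value instead of as the
    complement of \<open>N\<close>: this is a countable condition, hence measurable, and it passes
    to limits of values along a curve.\<close>
  define E where "E = {x \<in> \<Omega>. \<forall>n::nat. \<exists>d\<in>D. mdist Z (u x) d < 1 / Suc n}"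
  have [measurable]: "(\<lambda>x. mdist Z (u x) z) \<in> borel_measurable ?\<nu>" if "z \<in> mspace Z" for z
    using measurable_mdist_borel_of_top[OF Lp(1) that] .
  have E_eq: "E = (\<Inter>n::nat. \<Union>d\<in>D. {x \<in> space ?\<nu>. mdist Z (u x) d < 1 / Suc n})"
    unfolding E_def sp by auto
  have E_sets: "E \<in> sets ?\<nu>"
    unfolding E_eq
  proof (intro sets.countable_INT' image_subsetI sets.countable_UN''[OF D(1)])
    fix n :: nat and d assume "d \<in> D"
    then have [measurable]: "(\<lambda>x. mdist Z (u x) d) \<in> borel_measurable ?\<nu>"
      using D(2) measurable_mdist_borel_of_top[OF Lp(1)] by blast
    show "{x \<in> space ?\<nu>. mdist Z (u x) d < 1 / real (Suc n)} \<in> sets ?\<nu>" by measurable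
  qed auto
  have E_dense: "\<exists>d\<in>D. mdist Z (u x) d < e" if "x \<in> E" "0 < e" for x e
  proof -
    obtain n where n: "1 / real (Suc n) < e" using nat_approx_posE[OF \<open>0 < e\<close>] by auto
    obtain d where "d \<in> D" "mdist Z (u x) d < 1 / Suc n" using \<open>x \<in> E\<close> unfolding E_def by blast
    then show ?thesis using n by (intro bexI[of _ d]) auto
  qed
  have E_ge: "\<Omega> - N \<subseteq> E"
  proof
    fix x assume x: "x \<in> \<Omega> - N"
    have "\<exists>d\<in>D. mdist Z (u x) d < 1 / real (Suc n)" for n
    proof -
      have "u x \<in> u ` (\<Omega> - N) \<inter> mspace Z" using x u_Z by auto
      then have "\<exists>d\<in>D0. mdist Z (u x) d < 1 / real (Suc n)"
        using D0(3) by (metis of_nat_0_less_iff zero_less_Suc zero_less_divide_1_iff)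
      then show ?thesis by (auto simp: D_def)
    qed
    then show "x \<in> E" using x by (auto simp: E_def)
  qed
  define N1 where "N1 = \<Omega> - E"
  have E_\<mu>: "E \<in> sets \<mu>" "E \<subseteq> \<Omega>"
    using E_sets \<Omega>_sets sets_eq_imp_space_eq[OF sets] by (auto simp: sets_restrict_space_iff E_def)
  have N1: "N1 \<in> null_sets \<mu>" "N1 \<in> sets borel"
    using E_\<mu> \<Omega>_sets N(1) E_ge sets unfolding N1_def
    by (auto intro!: null_sets_subset[OF N(1)])
  define u' where "u' x = (if x \<in> E then u x else z0)" for x
  have AE_N1: "AE x in ?\<nu>. x \<notin> N1"
    using N1(1) \<Omega>_sets by (subst AE_restrict_space_iff) (auto intro!: AE_I'[OF N1(1)] simp: sets_eq_imp_space_eq[OF sets])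
  then have u'_AE: "AE x in ?\<nu>. u' x = u x"
    by (auto simp: u'_def N1_def AE_restrict_space_iff \<Omega>_sets sets_eq_imp_space_eq[OF sets] elim!: eventually_mono)
  have u'_sep: "separably_measurable ?\<nu> Z u'"
    unfolding separably_measurable_def sp
  proof (intro conjI)
    show "u' ` \<Omega> \<subseteq> mspace Z" using u_Z z0 by (auto simp: u'_def)
    show "\<forall>z\<in>mspace Z. (\<lambda>x. mdist Z (u' x) z) \<in> borel_measurable ?\<nu>"
    proof
      fix z assume z: "z \<in> mspace Z"
      have "(\<lambda>x. if x \<in> E then mdist Z (u x) z else mdist Z z0 z) \<in> borel_measurable ?\<nu>"
        by (rule measurable_If_set) (use measurable_mdist_borel_of_top[OF Lp(1) z] E_sets in \<open>auto simp: sp Int_absorb2 E_\<mu>\<close>)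
      then show "(\<lambda>x. mdist Z (u' x) z) \<in> borel_measurable ?\<nu>"
        by (rule back_subst[of "\<lambda>f. f \<in> borel_measurable ?\<nu>"]) (auto simp: u'_def)
    qed
    show "\<exists>D. countable D \<and> D \<subseteq> mspace Z \<and> (\<forall>x\<in>\<Omega>. \<forall>e>0. \<exists>z\<in>D. mdist Z (u' x) z < e)"
    proof (intro exI[of _ D] conjI D ballI allI impI)
      fix x and e :: real assume "x \<in> \<Omega>" "0 < e"
      then show "\<exists>z\<in>D. mdist Z (u' x) z < e"
        using E_dense[of x e] z0 by (cases "x \<in> E") (auto simp: u'_def D_def mdist_self)
    qed
  qed
  define g where "g x = h x + top * indicator N1 x" for x
  have g_borel: "g \<in> borel_measurable borel"
    unfolding g_def using N1(2) by measurable
  have "upper_gradient \<Omega> Z u' g"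
    unfolding upper_gradient_def
  proof (intro conjI g_borel ballI, clarify)
    fix \<gamma> L assume \<gamma>: "(\<gamma>, L) \<in> curves_in \<Omega>"
    then have L0: "0 \<le> L" by (auto simp: curves_in_def arclength_curve_def)
    show "ennreal (mdist Z (u' (\<gamma> L)) (u' (\<gamma> 0))) \<le> line_integral g \<gamma> L"
    proof (cases "L = 0 \<or> line_integral g \<gamma> L = top")
      case True
      have "u' (\<gamma> 0) \<in> mspace Z"
        using \<gamma> L0 u_Z z0 by (auto simp: u'_def curves_in_def image_subset_iff)
      then show ?thesis using True by (auto simp: mdist_self)
    next
      case False
      then have fin: "line_integral (\<lambda>x. h x + top * indicator N1 x) \<gamma> L < top" "0 < L"
        using L0 by (auto simp: less_top g_def[abs_def])
      have in_E: "\<gamma> s \<in> E" if s: "s \<in> {0..L}" for s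
      proof -
        have s\<Omega>: "\<gamma> s \<in> \<Omega>" using \<gamma> s by (auto simp: curves_in_def)
        have "\<exists>d\<in>D. mdist Z (u (\<gamma> s)) d < 1 / real (Suc n)" for n
        proof -
          let ?e = "1 / real (Suc n) / 2"
          have e: "0 < ?e" by simp
          obtain t where t: "t \<in> {0..L}" "\<gamma> t \<in> \<Omega> - N1"
            "\<forall>w. upper_gradient \<Omega> Z w h \<longrightarrow> mdist Z (w (\<gamma> t)) (w (\<gamma> s)) < ?e"
            by (rule upper_gradient_generic_parameter[OF \<gamma> fin(2) h_borel fin(1) s e])
          have "\<gamma> t \<in> E" using t(2) by (auto simp: N1_def)
          then obtain d where d: "d \<in> D" "mdist Z (u (\<gamma> t)) d < ?e" using E_dense[OF _ e] by blast
          have "mdist Z (u (\<gamma> s)) d \<le> mdist Z (u (\<gamma> s)) (u (\<gamma> t)) + mdist Z (u (\<gamma> t)) d"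
            using s\<Omega> t(2) u_Z d(1) D(2) by (intro mdist_triangle) auto
          also have "\<dots> < ?e + ?e"
            using t(3) h(1) d(2) by (intro add_strict_mono) (auto simp: mdist_commute)
          finally show ?thesis using d(1) unfolding field_sum_of_halves by blast
        qed
        then show ?thesis using s\<Omega> by (simp add: E_def)
      qed
      have "ennreal (mdist Z (u (\<gamma> L)) (u (\<gamma> 0))) \<le> line_integral h \<gamma> L"
        using h(1) \<gamma> unfolding upper_gradient_def by blast
      also have "\<dots> \<le> line_integral g \<gamma> L"
        unfolding line_integral_def g_def by (intro nn_integral_mono mult_right_mono) auto
      finally show ?thesis using in_E[of L] in_E[of 0] L0 by (simp add: u'_def)
    qed
  qed
  moreover have "(\<integral>\<^sup>+ x. epow (g x) p \<partial>?\<nu>) \<le> ennreal B + 2"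
  proof -
    have "(\<integral>\<^sup>+ x. epow (g x) p \<partial>?\<nu>) = (\<integral>\<^sup>+ x. epow (h x) p \<partial>?\<nu>)"
      by (rule nn_integral_cong_AE) (use AE_N1 in \<open>auto simp: g_def elim!: eventually_mono\<close>)
    also have "\<dots> \<le> (ennreal B + 1) + 1"
      by (rule order_trans[OF h(2)]) (use g0(2) in \<open>auto intro!: add_right_mono\<close>)
    finally show ?thesis by (simp add: add.assoc one_add_one)
  qed
  ultimately show thesis using that u'_sep u'_AE by blast
qed

section \<open>Bounded functions as a complete linear target\<close>

definition bfun_metric :: "('a \<Rightarrow> real) metric" where
  "bfun_metric = funspace UNIV euclidean_metric"

lemma mspace_bfun_metric: "f \<in> mspace bfun_metric \<longleftrightarrow> (\<exists>B. \<forall>x. \<bar>f x\<bar> \<le> B)"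
proof -
  have "f \<in> mspace bfun_metric \<longleftrightarrow> bounded (range f)"
    unfolding bfun_metric_def mspace_funspace Metric_space.fspace_def[OF Metric_space_mspace_mdist]
    by simp
  then show ?thesis
    unfolding bounded_iff by auto
qed

lemma abs_diff_le_mdist_bfun:
  assumes "f \<in> mspace bfun_metric" "g \<in> mspace bfun_metric"
  shows "\<bar>f x - g x\<bar> \<le> mdist bfun_metric f g"
  using funspace_mdist_le[of f UNIV euclidean_metric g "mdist bfun_metric f g"] assms
  by (auto simp: bfun_metric_def dist_real_def)

lemma mdist_bfun_le:
  assumes "f \<in> mspace bfun_metric" "g \<in> mspace bfun_metric" "\<And>x. \<bar>f x - g x\<bar> \<le> c"
  shows "mdist bfun_metric f g \<le> c"
  using funspace_mdist_le[of f UNIV euclidean_metric g c] assms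
  by (auto simp: bfun_metric_def dist_real_def)

lemma mcomplete_bfun_metric: "mcomplete_of bfun_metric"
proof -
  have "mcomplete_of (funspace UNIV (Met_TC.Self :: real metric))"
    by (rule Met_TC.mcomplete_funspace) (simp add: complete_UNIV)
  then show ?thesis
    by (simp add: bfun_metric_def Met_TC.Self_def euclidean_metric_def)
qed

text \<open>Midpoints are all that is used of the linear structure; isolating them allows the limit
  theorem to be stated for any midpoint operation with the contraction property of
  \<open>mdist_bfun_mid\<close>.\<close>

definition bfun_mid :: "('a \<Rightarrow> real) \<Rightarrow> ('a \<Rightarrow> real) \<Rightarrow> 'a \<Rightarrow> real" where
  "bfun_mid f g = (\<lambda>x. (f x + g x) / 2)"

lemma bfun_mid_in_mspace:
  assumes "f \<in> mspace bfun_metric" "g \<in> mspace bfun_metric"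
  shows "bfun_mid f g \<in> mspace bfun_metric"
proof -
  obtain A B where "\<And>x. \<bar>f x\<bar> \<le> A" "\<And>x. \<bar>g x\<bar> \<le> B"
    using assms mspace_bfun_metric by metis
  then have "\<bar>(f x + g x) / 2\<bar> \<le> A + B" for x
    using abs_ge_zero[of "f x"] abs_ge_zero[of "g x"] by (auto simp: abs_le_iff field_simps) (smt (verit))+
  then show ?thesis
    unfolding mspace_bfun_metric bfun_mid_def by blast
qed

lemma mdist_bfun_mid:
  assumes "f \<in> mspace bfun_metric" "g \<in> mspace bfun_metric"
    "f' \<in> mspace bfun_metric" "g' \<in> mspace bfun_metric"
  shows "mdist bfun_metric (bfun_mid f g) (bfun_mid f' g')
    \<le> (mdist bfun_metric f f' + mdist bfun_metric g g') / 2"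
proof (rule mdist_bfun_le)
  fix x
  have "\<bar>f x - f' x\<bar> \<le> mdist bfun_metric f f'" "\<bar>g x - g' x\<bar> \<le> mdist bfun_metric g g'"
    using assms by (auto intro: abs_diff_le_mdist_bfun)
  then show "\<bar>bfun_mid f g x - bfun_mid f' g' x\<bar> \<le> (mdist bfun_metric f f' + mdist bfun_metric g g') / 2"
    unfolding bfun_mid_def by (simp add: field_simps abs_if split: if_splits)
qed (use assms in \<open>auto intro: bfun_mid_in_mspace\<close>)

lemma bfun_mid_self [simp]: "bfun_mid f f = f"
  by (simp add: bfun_mid_def)

section \<open>Gluing metric spaces along convergent distances\<close>

lemma diagonal_convergent_subseq:
  fixes X :: "nat \<Rightarrow> nat \<Rightarrow> real"
  assumes "\<And>i. \<exists>B. \<forall>m. \<bar>X m i\<bar> \<le> B"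
  shows "\<exists>r. strict_mono r \<and> (\<forall>i. convergent (\<lambda>k. X (r k) i))"
proof -
  interpret subseqs "\<lambda>i s. convergent (\<lambda>k. X (s k) i)"
  proof
    fix i and s :: "nat \<Rightarrow> nat" assume "strict_mono s"
    obtain B where B: "\<And>m. \<bar>X m i\<bar> \<le> B" using assms by blast
    have "bounded (range (\<lambda>k. X (s k) i))"
      using B by (auto simp: bounded_iff)
    then obtain l r where "strict_mono (r::nat\<Rightarrow>nat)" "((\<lambda>k. X (s k) i) \<circ> r) \<longlonglongrightarrow> l"
      using bounded_imp_convergent_subsequence by blast
    then show "\<exists>r'. strict_mono r' \<and> convergent (\<lambda>k. X ((s \<circ> r') k) i)"
      by (auto simp: o_def convergent_def)
  qed
  \<comment> \<open>Only from index \<open>Suc i\<close> on is the diagonal sequence a subsequence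
    of the one chosen for coordinate \<open>i\<close>; the shift does not affect
    convergence.\<close>
  have "convergent (\<lambda>k. X (diagseq (k + Suc i)) i)" for i
  proof -
    have "convergent (\<lambda>k. X ((diagseq \<circ> (+) (Suc i)) k) i)"
    proof (rule diagseq_holds)
      fix r s :: "nat \<Rightarrow> nat" and n assume "strict_mono r" "convergent (\<lambda>k. X (s k) n)"
      then show "convergent (\<lambda>k. X ((s \<circ> r) k) n)"
        using convergent_subseq_convergent[of "\<lambda>k. X (s k) n" r] by (simp add: o_def)
    qed
    then show ?thesis by (simp add: o_def add.commute)
  qed
  then have "convergent (\<lambda>k. X (diagseq k) i)" for i
    using convergent_ignore_initial_segment[of "\<lambda>k. X (diagseq k) i" "Suc i"] by blast
  then show ?thesis
    using subseq_diagseq by blast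
qed

text \<open>Each function \<open>d\<^sub>m(\<cdot>, b)\<close> is transported along the approximate correspondences
  \<open>e\<^sub>m a \<leftrightarrow> a \<leftrightarrow> e\<^sub>m\<^sub>' a\<close> to a 1-Lipschitz function on the other spaces; these functions are the coordinates
  of a common Kuratowski embedding. The error \<open>c\<^sub>m a\<close> compares \<open>d\<^sub>m(e\<^sub>m a, e\<^sub>m b)\<close>
  with its limit for all \<open>b \<le> a\<close> only, which suffices by symmetry.\<close>

definition glue_err :: "(nat \<Rightarrow> nat \<Rightarrow> real) \<Rightarrow> (nat \<Rightarrow> nat \<Rightarrow> real) \<Rightarrow> nat \<Rightarrow> real" where
  "glue_err D \<delta> a = (MAX b\<in>{..a}. \<bar>D a b - \<delta> a b\<bar>)"

lemma abs_diff_le_glue_err: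
  assumes "\<And>a b. D a b = D b a" "\<And>a b. \<delta> a b = \<delta> b a"
  shows "\<bar>D a b - \<delta> a b\<bar> \<le> glue_err D \<delta> a + glue_err D \<delta> b"
proof -
  have *: "\<bar>D a b - \<delta> a b\<bar> \<le> glue_err D \<delta> a" if "b \<le> a" for a b
    unfolding glue_err_def by (rule Max_ge) (use that in auto)
  have 0: "0 \<le> glue_err D \<delta> a" for a
    using *[of a a] by linarith
  show ?thesis
    using *[of a b] *[of b a] 0[of a] 0[of b] assms[of a b] by (cases "b \<le> a") auto
qed

lemma glue_err_nonneg: "0 \<le> glue_err D \<delta> a"
proof -
  have "\<bar>D a a - \<delta> a a\<bar> \<le> glue_err D \<delta> a"
    unfolding glue_err_def by (rule Max_ge) auto
  then show ?thesis by linarith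
qed

text \<open>A maximum over finitely many \<open>b\<close> is dominated by a finite sum of null
  sequences. A supremum over all \<open>b\<close> could fail to tend to 0 under pointwise
  convergence.\<close>

lemma glue_err_tendsto:
  assumes "\<And>a b. (\<lambda>m. D m a b) \<longlonglongrightarrow> \<delta> a b"
  shows "(\<lambda>m. glue_err (D m) \<delta> a) \<longlonglongrightarrow> 0"
proof (rule tendsto_sandwich[OF _ _ tendsto_const])
  have "(\<lambda>m. \<Sum>b\<le>a. \<bar>D m a b - \<delta> a b\<bar>) \<longlonglongrightarrow> (\<Sum>b\<le>a. \<bar>\<delta> a b - \<delta> a b\<bar>)"
    by (intro tendsto_intros assms)
  then show "(\<lambda>m. \<Sum>b\<le>a. \<bar>D m a b - \<delta> a b\<bar>) \<longlonglongrightarrow> 0" by simp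
  have "glue_err (D m) \<delta> a \<le> (\<Sum>b\<le>a. \<bar>D m a b - \<delta> a b\<bar>)" for m
    unfolding glue_err_def by (subst Max_le_iff) (auto intro!: member_le_sum)
  then show "\<forall>\<^sub>F m in sequentially. glue_err (D m) \<delta> a \<le> (\<Sum>b\<le>a. \<bar>D m a b - \<delta> a b\<bar>)" by simp
qed (simp add: glue_err_nonneg)

lemma gromov_gluing_limit:
  fixes Y :: "nat \<Rightarrow> 'y metric" and e :: "nat \<Rightarrow> nat \<Rightarrow> 'y"
  assumes e: "\<And>m a. e m a \<in> mspace (Y m)"
    and lim: "\<And>a b. (\<lambda>m. mdist (Y m) (e m a) (e m b)) \<longlonglongrightarrow> \<delta> a b"
  obtains \<phi> :: "nat \<Rightarrow> 'y \<Rightarrow> nat \<times> 'y \<Rightarrow> real"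
  where "\<And>m. isometric_embedding (Y m) bfun_metric (\<phi> m)"
    "\<And>a \<epsilon>. \<epsilon> > 0 \<Longrightarrow> \<exists>N. \<forall>m\<ge>N. \<forall>n\<ge>N. mdist bfun_metric (\<phi> m (e m a)) (\<phi> n (e n a)) < \<epsilon>"
proof -
  define D where "D m a b = mdist (Y m) (e m a) (e m b)" for m a b
  define c where "c m a = glue_err (D m) \<delta> a" for m a
  have Dsym: "D m a b = D m b a" for m a b by (simp add: D_def mdist_commute)
  have D_lim: "(\<lambda>m. D m a b) \<longlonglongrightarrow> \<delta> a b" for a b
    using lim by (simp add: D_def)
  have \<delta>sym: "\<delta> a b = \<delta> b a" for a b
    using LIMSEQ_unique[OF D_lim[of a b]] D_lim[of b a] by (simp add: Dsym)
  have \<delta>tri: "\<delta> a b \<le> \<delta> a x + \<delta> x b" for a b x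
    using D_lim[of a b] tendsto_add[OF D_lim[of a x] D_lim[of x b]]
    by (rule LIMSEQ_le) (auto simp: D_def intro!: exI[of _ 0] mdist_triangle e)
  have \<delta>0: "\<delta> a b \<ge> 0" for a b
    by (rule LIMSEQ_le_const[OF D_lim]) (auto simp: D_def)
  have \<delta>self: "\<delta> a a = 0" for a
  proof -
    have "D m a a = 0" for m
      using e by (simp add: D_def)
    then have "(\<lambda>m. 0) \<longlonglongrightarrow> \<delta> a a"
      using D_lim[of a a] by simp
    then show ?thesis
      by (simp add: LIMSEQ_const_iff)
  qed
  have Dc: "\<bar>D m a b - \<delta> a b\<bar> \<le> c m a + c m b" for m a b
    unfolding c_def by (rule abs_diff_le_glue_err) (auto simp: Dsym \<delta>sym)
  have c0: "0 \<le> c m a" for m a by (simp add: c_def glue_err_nonneg)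
  have c_lim: "(\<lambda>m. c m a) \<longlonglongrightarrow> 0" for a
    unfolding c_def by (rule glue_err_tendsto) (rule D_lim)
  \<comment> \<open>First leg of the transport: the distance to \<open>b\<close> becomes a function
    of the index. As an infimum of translates of \<delta> it is 1-Lipschitz for \<delta>; the
    summand \<open>c m a\<close> charges for the passage from \<open>e m a\<close> to
    \<open>a\<close>.\<close>
  define G where "G m b x = (INF a. mdist (Y m) (e m a) b + c m a + \<delta> a x)" for m b x
  have Gbdd: "bdd_below (range (\<lambda>a. mdist (Y m) (e m a) b + c m a + \<delta> a x))" for m b x
    using c0 \<delta>0 by (intro bdd_belowI2[of _ 0]) (simp add: add_nonneg_nonneg)
  have Gle: "G m b x \<le> mdist (Y m) (e m a) b + c m a + \<delta> a x" for m b x a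
    unfolding G_def by (rule cINF_lower[OF Gbdd]) auto
  have G0: "0 \<le> G m b x" for m b x
    unfolding G_def using c0 \<delta>0 by (intro cINF_greatest) (simp_all add: add_nonneg_nonneg)
  have GLip: "G m b x \<le> G m b x' + \<delta> x x'" for m b x x'
  proof -
    have "G m b x - \<delta> x x' \<le> G m b x'"
      unfolding G_def[of m b x']
    proof (rule cINF_greatest)
      fix a
      have "\<delta> a x \<le> \<delta> a x' + \<delta> x x'" using \<delta>tri[of a x x'] \<delta>sym[of x x'] by simp
      then show "G m b x - \<delta> x x' \<le> mdist (Y m) (e m a) b + c m a + \<delta> a x'"
        using Gle[of m b x a] by linarith
    qed simp
    then show ?thesis by simp
  qed
  \<comment> \<open>Second leg, from indices into \<open>Y m'\<close>. For \<open>m' = m\<close> the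
    exact distance is kept, because transporting it through the indices and back need not reproduce
    it, and the embedding has to be exactly isometric.\<close>
  define H where "H m b m' y = (if m' = m then mdist (Y m) y b
      else (INF x. mdist (Y m') y (e m' x) + c m' x + G m b x))" for m b m' y
  have Hbdd: "bdd_below (range (\<lambda>x. mdist (Y m') y (e m' x) + c m' x + G m b x))" for m b m' y
    using c0 G0 by (intro bdd_belowI2[of _ 0]) (simp add: add_nonneg_nonneg)
  have HLip: "H m b m' y \<le> H m b m' y' + mdist (Y m') y y'"
    if "y \<in> mspace (Y m')" "y' \<in> mspace (Y m')" "b \<in> mspace (Y m)" for m b m' y y'
  proof (cases "m' = m")
    case True
    with that show ?thesis using mdist_triangle[of y "Y m" y' b] by (simp add: H_def)
  next
    case False
    have "H m b m' y - mdist (Y m') y y' \<le> H m b m' y'"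
      using False unfolding H_def
    proof (simp, intro cINF_greatest)
      fix x
      have "(INF x. mdist (Y m') y (e m' x) + c m' x + G m b x) \<le> mdist (Y m') y (e m' x) + c m' x + G m b x"
        by (rule cINF_lower[OF Hbdd]) auto
      then show "(INF x. mdist (Y m') y (e m' x) + c m' x + G m b x) - mdist (Y m') y y'
          \<le> mdist (Y m') y' (e m' x) + c m' x + G m b x"
        using mdist_triangle[of y "Y m'" y' "e m' x"] that e by simp
    qed simp
    then show ?thesis by simp
  qed
  \<comment> \<open>At \<open>e m' x\<close> every coordinate agrees with \<open>G m b x\<close>,
    which does not involve \<open>m'\<close>, up to an error independent of the coordinate
    \<open>(m, b)\<close>. This uniformity gives closeness in the supremum norm.\<close>
  have HG: "\<bar>H m b m' (e m' x) - G m b x\<bar> \<le> c m' x" if b: "b \<in> mspace (Y m)" for m b m' x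
  proof (cases "m' = m")
    case True
    have "G m b x \<le> mdist (Y m) (e m x) b + c m x"
      using Gle[of m b x x] \<delta>self by simp
    moreover have "mdist (Y m) (e m x) b - c m x \<le> G m b x"
      unfolding G_def
    proof (rule cINF_greatest)
      fix a
      show "mdist (Y m) (e m x) b - c m x \<le> mdist (Y m) (e m a) b + c m a + \<delta> a x"
        using mdist_triangle[of "e m x" "Y m" "e m a" b] e b Dc[of m x a] \<delta>sym[of x a]
        by (simp add: D_def)
    qed simp
    ultimately show ?thesis using True by (simp add: H_def)
  next
    case False
    let ?f = "\<lambda>z. mdist (Y m') (e m' x) (e m' z) + c m' z + G m b z"
    have "(INF z. ?f z) \<le> ?f x"
      by (rule cINF_lower[OF Hbdd]) auto
    then have "(INF z. ?f z) \<le> c m' x + G m b x"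
      by (simp add: mdist_self[OF e])
    moreover have "G m b x - c m' x \<le> (INF z. ?f z)"
    proof (rule cINF_greatest)
      fix z
      show "G m b x - c m' x \<le> ?f z"
        using Dc[of m' x z] GLip[of m b x z] by (simp add: D_def)
    qed simp
    ultimately show ?thesis using False by (simp add: H_def)
  qed
  \<comment> \<open>As in the Kuratowski embedding of an unbounded space, a reference value is
    subtracted from each coordinate, here the value \<open>G m b 0\<close> at index 0. The bound
    obtained does not depend on \<open>(m, b)\<close>; pairs that denote no point get the value
    0.\<close>
  define \<phi> where "\<phi> m' y = (\<lambda>(m, b). if b \<in> mspace (Y m) then H m b m' y - G m b 0 else 0)" for m' y
  have in_Z: "\<phi> m' y \<in> mspace bfun_metric" if y: "y \<in> mspace (Y m')" for m' y
  proof -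
    have "\<bar>\<phi> m' y p\<bar> \<le> mdist (Y m') y (e m' 0) + c m' 0" for p
    proof -
      obtain m b where p: "p = (m, b)" by force
      show ?thesis
      proof (cases "b \<in> mspace (Y m)")
        case True
        show ?thesis
          using HLip[OF y e[of m' 0] True] HLip[OF e[of m' 0] y True] HG[OF True, of m' 0] True
          by (simp add: \<phi>_def p mdist_commute abs_le_iff)
      qed (use c0 in \<open>simp add: \<phi>_def p add_nonneg_nonneg\<close>)
    qed
    then show ?thesis unfolding mspace_bfun_metric by blast
  qed
  have iso: "isometric_embedding (Y m') bfun_metric (\<phi> m')" for m'
    unfolding isometric_embedding_def
  proof (intro conjI ballI)
    show "\<phi> m' ` mspace (Y m') \<subseteq> mspace bfun_metric" using in_Z by auto
  next
    fix y y' assume y: "y \<in> mspace (Y m')" "y' \<in> mspace (Y m')"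
    show "mdist bfun_metric (\<phi> m' y) (\<phi> m' y') = mdist (Y m') y y'"
    proof (rule antisym)
      show "mdist bfun_metric (\<phi> m' y) (\<phi> m' y') \<le> mdist (Y m') y y'"
      proof (rule mdist_bfun_le)
        fix p :: "nat \<times> 'y"
        obtain m b where p: "p = (m, b)" by force
        show "\<bar>\<phi> m' y p - \<phi> m' y' p\<bar> \<le> mdist (Y m') y y'"
          using HLip[OF y, of b m] HLip[OF y(2,1), of b m]
          by (auto simp: \<phi>_def p mdist_commute abs_le_iff)
      qed (use y in_Z in auto)
      \<comment> \<open>The coordinate given by the second point itself attains the
        distance.\<close>
      have "\<bar>\<phi> m' y (m', y') - \<phi> m' y' (m', y')\<bar> = mdist (Y m') y y'"
        using y by (simp add: \<phi>_def H_def)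
      then show "mdist (Y m') y y' \<le> mdist bfun_metric (\<phi> m' y) (\<phi> m' y')"
        using abs_diff_le_mdist_bfun[OF in_Z[OF y(1)] in_Z[OF y(2)], of "(m', y')"] by simp
    qed
  qed
  have close: "mdist bfun_metric (\<phi> m (e m a)) (\<phi> n (e n a)) \<le> c m a + c n a" for m n a
  proof (rule mdist_bfun_le)
    fix p :: "nat \<times> 'y"
    obtain k b where p: "p = (k, b)" by force
    show "\<bar>\<phi> m (e m a) p - \<phi> n (e n a) p\<bar> \<le> c m a + c n a"
      using HG[of b k m a] HG[of b k n a] c0[of m a] c0[of n a] by (auto simp: \<phi>_def p)
  qed (use e in_Z in auto)
  show thesis
  proof (rule that[OF iso])
    fix a and \<epsilon> :: real assume "\<epsilon> > 0"
    then obtain N where N: "\<And>n. n \<ge> N \<Longrightarrow> c n a < \<epsilon> / 2"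
      using c_lim[of a] c0 unfolding LIMSEQ_iff by (metis half_gt_zero diff_zero real_norm_def abs_of_nonneg)
    have "mdist bfun_metric (\<phi> m (e m a)) (\<phi> n (e n a)) < \<epsilon>" if "m \<ge> N" "n \<ge> N" for m n
      using close[of m a n] N[OF that(1)] N[OF that(2)] by simp
    then show "\<exists>N. \<forall>m\<ge>N. \<forall>n\<ge>N. mdist bfun_metric (\<phi> m (e m a)) (\<phi> n (e n a)) < \<epsilon>" by blast
  qed
qed

lemma gromov_gluing:
  fixes Y :: "nat \<Rightarrow> 'y metric" and e :: "nat \<Rightarrow> nat \<Rightarrow> 'y"
  assumes e: "\<And>m a. e m a \<in> mspace (Y m)"
    and bd: "\<And>a b. \<exists>B. \<forall>m. mdist (Y m) (e m a) (e m b) \<le> B"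
  obtains r :: "nat \<Rightarrow> nat" and \<phi> :: "nat \<Rightarrow> 'y \<Rightarrow> nat \<times> 'y \<Rightarrow> real"
  where "strict_mono r" "\<And>k. isometric_embedding (Y (r k)) bfun_metric (\<phi> k)"
    "\<And>a \<epsilon>. \<epsilon> > 0 \<Longrightarrow> \<exists>N. \<forall>m\<ge>N. \<forall>n\<ge>N. mdist bfun_metric (\<phi> m (e (r m) a)) (\<phi> n (e (r n) a)) < \<epsilon>"
proof -
  define X where "X m i = (case prod_decode i of (a, b) \<Rightarrow> mdist (Y m) (e m a) (e m b))" for m i
  have "\<exists>B. \<forall>m. \<bar>X m i\<bar> \<le> B" for i
    using bd[of "fst (prod_decode i)" "snd (prod_decode i)"] by (auto simp: X_def case_prod_beta)
  then obtain r where r: "strict_mono r" and "\<And>i. convergent (\<lambda>k. X (r k) i)"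
    using diagonal_convergent_subseq by blast
  then obtain l where l: "\<And>i. (\<lambda>k. X (r k) i) \<longlonglongrightarrow> l i"
    unfolding convergent_def by metis
  have "(\<lambda>k. mdist (Y (r k)) (e (r k) a) (e (r k) b)) \<longlonglongrightarrow> l (prod_encode (a, b))" for a b
    using l[of "prod_encode (a, b)"] by (simp add: X_def)
  from gromov_gluing_limit[of "\<lambda>k. e (r k)" "\<lambda>k. Y (r k)" "\<lambda>a b. l (prod_encode (a, b))", OF e this]
  show ?thesis using that[OF r] by blast
qed

text \<open>Total boundedness asks for centres in \<open>S\<close>, whereas the nets are given in
  the ambient space. Replacing each centre by a point of \<open>S\<close> in its ball of half the
  radius remedies this; completeness then makes the closure of \<open>S\<close> compact.\<close>

lemma mcomplete_totally_bounded_subset_compact: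
  assumes Z: "mcomplete_of Z" and S: "S \<subseteq> mspace Z"
    and tb: "\<And>\<epsilon>. \<epsilon> > 0 \<Longrightarrow> \<exists>F. finite F \<and> F \<subseteq> mspace Z \<and> (\<forall>y\<in>S. \<exists>c\<in>F. mdist Z c y < \<epsilon>)"
  shows "\<exists>K. compactin (mtopology_of Z) K \<and> S \<subseteq> K"
proof -
  interpret Metric_space "mspace Z" "mdist Z" by simp
  have "mtotally_bounded S"
    unfolding mtotally_bounded_def
  proof (intro allI impI)
    fix \<epsilon> :: real assume "\<epsilon> > 0"
    then obtain F where F: "finite F" "F \<subseteq> mspace Z" "\<And>y. y \<in> S \<Longrightarrow> \<exists>c\<in>F. mdist Z c y < \<epsilon> / 2"
      using tb[of "\<epsilon> / 2"] by auto
    define pick where "pick c = (SOME y. y \<in> S \<and> mdist Z c y < \<epsilon> / 2)" for c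
    let ?K = "pick ` {c \<in> F. \<exists>y. y \<in> S \<and> mdist Z c y < \<epsilon> / 2}"
    have pick: "pick c \<in> S \<and> mdist Z c (pick c) < \<epsilon> / 2" if "\<exists>y. y \<in> S \<and> mdist Z c y < \<epsilon> / 2" for c
      unfolding pick_def using that by (rule someI_ex)
    have "S \<subseteq> (\<Union>x\<in>?K. mball x \<epsilon>)"
    proof
      fix y assume y: "y \<in> S"
      then obtain c where c: "c \<in> F" "mdist Z c y < \<epsilon> / 2" using F(3) by blast
      have p: "pick c \<in> S" "mdist Z c (pick c) < \<epsilon> / 2" using pick[of c] c y by blast+
      have "mdist Z (pick c) y \<le> mdist Z (pick c) c + mdist Z c y"
        using p c y S F(2) by (intro triangle) auto
      then have "y \<in> mball (pick c) \<epsilon>"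
        using p c y S commute[of "pick c" c] by auto
      then show "y \<in> (\<Union>x\<in>?K. mball x \<epsilon>)" using c y by blast
    qed
    moreover have "finite ?K" "?K \<subseteq> S" using F(1) pick by auto
    ultimately show "\<exists>K. finite K \<and> K \<subseteq> S \<and> S \<subseteq> (\<Union>x\<in>K. mball x \<epsilon>)" by blast
  qed
  then have "compactin mtopology (mtopology closure_of S)"
    using mtotally_bounded_eq_compact_closure_of Z by (simp add: mcomplete_of_def)
  then show ?thesis
    using closure_of_subset[of S mtopology] S by (auto simp: mtopology_of_def)
qed

subsection \<open>Nets in doubling domains\<close>

locale doubling_domain =
  fixes \<mu> :: "'x::metric_space measure" and \<Omega> :: "'x set" and Cd :: real
  assumes sets_\<mu>: "sets \<mu> = sets borel" and open_\<Omega>: "open \<Omega>" and nonempty: "\<Omega> \<noteq> {}" and bounded: "bounded \<Omega>"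
    and Cd: "1 \<le> Cd"
    and ball_pos: "x \<in> \<Omega> \<Longrightarrow> 0 < r \<Longrightarrow> 0 < emeasure \<mu> (ball x r \<inter> \<Omega>)"
    and ball_fin: "x \<in> \<Omega> \<Longrightarrow> 0 < r \<Longrightarrow> emeasure \<mu> (ball x r \<inter> \<Omega>) < \<infinity>"
    and doubling: "x \<in> \<Omega> \<Longrightarrow> 0 < r \<Longrightarrow> emeasure \<mu> (ball x (2 * r) \<inter> \<Omega>) \<le> ennreal Cd * emeasure \<mu> (ball x r \<inter> \<Omega>)"

lemma doubling_domainI:
  assumes "sets \<mu> = sets borel" "open \<Omega>" "\<Omega> \<noteq> {}" "bounded \<Omega>" "doubling_on \<mu> \<Omega>"
  obtains Cd where "doubling_domain \<mu> \<Omega> Cd"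
proof -
  obtain C where C: "\<forall>x \<in> closure \<Omega>. \<forall>r > 0.
      0 < emeasure \<mu> (ball x (2 * r) \<inter> \<Omega>) \<and>
      emeasure \<mu> (ball x (2 * r) \<inter> \<Omega>) \<le> ennreal C * emeasure \<mu> (ball x r \<inter> \<Omega>) \<and>
      emeasure \<mu> (ball x r \<inter> \<Omega>) < \<infinity>"
    using assms(5) unfolding doubling_on_def by (elim exE)
  have "doubling_domain \<mu> \<Omega> (max 1 C)"
  proof
    fix x and r :: real assume x: "x \<in> \<Omega>" and r: "0 < r"
    have xc: "x \<in> closure \<Omega>" using x closure_subset by blast
    show "0 < emeasure \<mu> (ball x r \<inter> \<Omega>)" using C[rule_format, OF xc, of "r / 2"] r by simp
    show "emeasure \<mu> (ball x r \<inter> \<Omega>) < \<infinity>" using C[rule_format, OF xc r] by simp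
    have "emeasure \<mu> (ball x (2 * r) \<inter> \<Omega>) \<le> ennreal C * emeasure \<mu> (ball x r \<inter> \<Omega>)"
      using C[rule_format, OF xc r] by simp
    also have "\<dots> \<le> ennreal (max 1 C) * emeasure \<mu> (ball x r \<inter> \<Omega>)"
      by (intro mult_right_mono ennreal_leI) auto
    finally show "emeasure \<mu> (ball x (2 * r) \<inter> \<Omega>) \<le> ennreal (max 1 C) * emeasure \<mu> (ball x r \<inter> \<Omega>)" .
  qed (use assms in auto)
  then show thesis by (rule that)
qed

context doubling_domain
begin

definition V :: "'x \<Rightarrow> real \<Rightarrow> real" where "V x r = measure \<mu> (ball x r \<inter> \<Omega>)"

lemma ball_sets [measurable]: "ball x r \<inter> \<Omega> \<in> sets \<mu>"
  using sets_\<mu> open_\<Omega> by simp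

lemma \<Omega>_sets [measurable]: "\<Omega> \<in> sets \<mu>"
  using sets_\<mu> open_\<Omega> by simp

lemma space_\<mu>: "space \<mu> = UNIV"
  using sets_eq_imp_space_eq[OF sets_\<mu>] by simp

lemma emeasure_ball: "x \<in> \<Omega> \<Longrightarrow> 0 < r \<Longrightarrow> emeasure \<mu> (ball x r \<inter> \<Omega>) = ennreal (V x r)"
  unfolding V_def using ball_fin[of x r] by (intro emeasure_eq_ennreal_measure) auto

lemma V_pos: "x \<in> \<Omega> \<Longrightarrow> 0 < r \<Longrightarrow> 0 < V x r"
  using ball_pos[of x r] emeasure_ball[of x r] by simp

lemma ball_fmeasurable: "x \<in> \<Omega> \<Longrightarrow> 0 < r \<Longrightarrow> ball x r \<inter> \<Omega> \<in> fmeasurable \<mu>"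
  using ball_fin[of x r] by (intro fmeasurableI) auto

lemma V_mono:
  assumes "x \<in> \<Omega>" "0 < r" "ball y s \<inter> \<Omega> \<subseteq> ball x r"
  shows "V y s \<le> V x r"
  unfolding V_def using assms by (intro measure_mono_fmeasurable ball_fmeasurable) auto

lemma V_doubling: "x \<in> \<Omega> \<Longrightarrow> 0 < r \<Longrightarrow> V x (2 * r) \<le> Cd * V x r"
  using doubling[of x r] Cd V_pos[of x r]
  by (simp add: emeasure_ball ennreal_mult[symmetric] ennreal_le_iff)

lemma V_doubling_iter: "x \<in> \<Omega> \<Longrightarrow> 0 < r \<Longrightarrow> V x (2 ^ n * r) \<le> Cd ^ n * V x r"
proof (induction n)
  case (Suc n)
  have "V x (2 ^ Suc n * r) = V x (2 * (2 ^ n * r))" by (simp add: algebra_simps)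
  also have "\<dots> \<le> Cd * V x (2 ^ n * r)" using Suc.prems by (intro V_doubling) auto
  also have "\<dots> \<le> Cd * (Cd ^ n * V x r)" using Suc Cd by (intro mult_left_mono) auto
  finally show ?case by (simp add: mult.assoc)
qed simp

lemma \<Omega>_fmeasurable: "\<Omega> \<in> fmeasurable \<mu>"
proof -
  obtain x where x: "x \<in> \<Omega>" using nonempty by blast
  obtain R where R: "\<Omega> \<subseteq> ball x R" "0 < R" using bounded_subset_ballD[OF bounded] by blast
  then show ?thesis using ball_fmeasurable[OF x R(2)] by (simp add: Int_absorb1)
qed

text \<open>A volume count. The balls of radius \<open>s / 2\<close> about the points of
  \<open>F\<close> are disjoint and lie in \<open>ball x ((R + 1) * s)\<close>, and by doubling each
  carries a fixed fraction of its measure. The bound depends on \<open>R\<close> alone, which later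
  makes overlap constants independent of the scale.\<close>

lemma separated_card_bound:
  assumes "0 < R"
  obtains M :: nat where "\<forall>s>0. \<forall>x\<in>\<Omega>. \<forall>F\<subseteq>\<Omega>. (\<forall>c\<in>F. dist x c < R * s) \<and>
    (\<forall>c\<in>F. \<forall>c'\<in>F. c \<noteq> c' \<longrightarrow> s \<le> dist c c') \<longrightarrow> finite F \<and> card F \<le> M"
proof -
  \<comment> \<open>Seen from a point within \<open>R * s\<close> of \<open>x\<close>, the big ball
    lies within distance \<open>(2 * R + 1) * s\<close>; \<open>n\<close> doublings of the radius
    \<open>s / 2\<close> reach that far.\<close>
  obtain n where n: "4 * (R + 1) \<le> 2 ^ n"
    using real_arch_pow[of 2 "4 * (R + 1)"] by (auto intro: less_imp_le)
  have *: "finite F \<and> card F \<le> nat \<lceil>Cd ^ n\<rceil>"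
    if s: "0 < s" and x: "x \<in> \<Omega>" and F: "F \<subseteq> \<Omega>" "\<forall>c\<in>F. dist x c < R * s"
      "\<forall>c\<in>F. \<forall>c'\<in>F. c \<noteq> c' \<longrightarrow> s \<le> dist c c'" for s x F
  \<comment> \<open>Finiteness of \<open>F\<close> is part of the claim, so the count is carried out
    for finite subsets.\<close>
  proof (rule finite_if_finite_subsets_card_bdd)
    fix G assume G: "G \<subseteq> F" "finite G"
    let ?W = "V x ((R + 1) * s)"
    have W: "0 < ?W" using V_pos[OF x, of "(R + 1) * s"] s \<open>0 < R\<close> by simp
    have "?W \<le> Cd ^ n * V c (s / 2)" if c: "c \<in> G" for c
    proof -
      have c\<Omega>: "c \<in> \<Omega>" "dist x c < R * s" using c G F by auto
      have "2 ^ n * (s / 2) \<ge> 4 * (R + 1) * (s / 2)" using n s by (intro mult_right_mono) auto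
      then have big: "(2 * R + 1) * s \<le> 2 ^ n * (s / 2)" using s \<open>0 < R\<close> by (simp add: algebra_simps)
      have "ball x ((R + 1) * s) \<subseteq> ball c (2 ^ n * (s / 2))"
      proof
        fix y assume "y \<in> ball x ((R + 1) * s)"
        then have "dist c y < R * s + (R + 1) * s"
          using c\<Omega>(2) dist_triangle[of c y x] by (simp add: dist_commute)
        also have "\<dots> = (2 * R + 1) * s" by (simp add: algebra_simps)
        finally show "y \<in> ball c (2 ^ n * (s / 2))" using big by simp
      qed
      then have "?W \<le> V c (2 ^ n * (s / 2))"
        using c\<Omega> s by (intro V_mono) auto
      also have "\<dots> \<le> Cd ^ n * V c (s / 2)" using c\<Omega> s by (intro V_doubling_iter) auto
      finally show ?thesis .
    qed
    then have "(\<Sum>c\<in>G. ?W) \<le> (\<Sum>c\<in>G. Cd ^ n * V c (s / 2))" by (rule sum_mono)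
    also have "\<dots> = Cd ^ n * (\<Sum>c\<in>G. V c (s / 2))" by (simp add: sum_distrib_left)
    also have "(\<Sum>c\<in>G. V c (s / 2)) = measure \<mu> (\<Union>c\<in>G. ball c (s / 2) \<inter> \<Omega>)"
    proof -
      have "disjoint_family_on (\<lambda>c. ball c (s / 2) \<inter> \<Omega>) G"
        unfolding disjoint_family_on_def
      proof (intro ballI impI)
        fix c c' assume cc: "c \<in> G" "c' \<in> G" "c \<noteq> c'"
        have "s \<le> dist c c'" using F(3) cc G by blast
        show "ball c (s / 2) \<inter> \<Omega> \<inter> (ball c' (s / 2) \<inter> \<Omega>) = {}"
        proof (rule ccontr)
          assume "\<not> ?thesis"
          then obtain y where "dist c y < s / 2" "dist c' y < s / 2" by auto
          then have "dist c c' < s" using dist_triangle_half_r[of y c s c'] by (simp add: dist_commute)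
          then show False using \<open>s \<le> dist c c'\<close> by simp
        qed
      qed
      moreover have "emeasure \<mu> (ball c (s / 2) \<inter> \<Omega>) \<noteq> \<infinity>" if "c \<in> G" for c
        using ball_fin[of c "s / 2"] that G F s by auto
      ultimately show ?thesis
        unfolding V_def using G by (intro measure_finite_Union[symmetric]) auto
    qed
    also have "\<dots> \<le> ?W"
      unfolding V_def
    proof (rule measure_mono_fmeasurable)
      show "ball x ((R + 1) * s) \<inter> \<Omega> \<in> fmeasurable \<mu>" using x s \<open>0 < R\<close> by (intro ball_fmeasurable) auto
      show "(\<Union>c\<in>G. ball c (s / 2) \<inter> \<Omega>) \<subseteq> ball x ((R + 1) * s) \<inter> \<Omega>"
      proof clarsimp
        fix c y assume c: "c \<in> G" and y: "dist c y * 2 < s" "y \<in> \<Omega>"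
        have "dist x c < R * s" using c G F by auto
        have "dist c y < s" using y(1) zero_le_dist[of c y] by linarith
        then have "dist x y < R * s + s"
          using \<open>dist x c < R * s\<close> dist_triangle[of x y c] by (simp add: dist_commute)
        then show "dist x y < (R + 1) * s" by (simp add: algebra_simps)
      qed
      show "(\<Union>c\<in>G. ball c (s / 2) \<inter> \<Omega>) \<in> sets \<mu>" using G by (intro sets.finite_UN) auto
    qed
    finally have "real (card G) * ?W \<le> Cd ^ n * ?W" using Cd by (simp add: mult_left_mono)
    then have "real (card G) \<le> Cd ^ n" using W by simp
    then show "card G \<le> nat \<lceil>Cd ^ n\<rceil>" by linarith
  qed
  show thesis
    by (rule that[of "nat \<lceil>Cd ^ n\<rceil>"], intro allI impI ballI, elim conjE) (rule *)
qed

definition is_net :: "real \<Rightarrow> nat \<Rightarrow> (nat \<Rightarrow> 'x) \<Rightarrow> bool" where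
  "is_net s n c \<longleftrightarrow> (\<forall>i<n. c i \<in> \<Omega>) \<and> (\<forall>i<n. \<forall>j<n. i \<noteq> j \<longrightarrow> s \<le> dist (c i) (c j)) \<and>
     (\<forall>x\<in>\<Omega>. \<exists>i<n. dist x (c i) < s)"

text \<open>A separated set of greatest cardinality covers, since an uncovered point could be added
  to it. The cardinalities are bounded because \<Omega> lies in one ball.\<close>

lemma net_exists:
  assumes s: "0 < s"
  shows "\<exists>n c. is_net s n c"
proof -
  obtain x where x: "x \<in> \<Omega>" using nonempty by blast
  obtain R where R: "\<Omega> \<subseteq> ball x R" "0 < R" using bounded_subset_ballD[OF bounded] by blast
  obtain M where M: "\<forall>t>0. \<forall>x\<in>\<Omega>. \<forall>F\<subseteq>\<Omega>. (\<forall>c\<in>F. dist x c < R / s * t) \<and>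
    (\<forall>c\<in>F. \<forall>c'\<in>F. c \<noteq> c' \<longrightarrow> t \<le> dist c c') \<longrightarrow> finite F \<and> card F \<le> M"
    by (rule separated_card_bound[of "R / s"]) (use s R in simp)
  let ?P = "\<lambda>F. F \<subseteq> \<Omega> \<and> (\<forall>c\<in>F. \<forall>c'\<in>F. c \<noteq> c' \<longrightarrow> s \<le> dist c c')"
  have bd: "finite F \<and> card F \<le> M" if "?P F" for F
  proof -
    have "\<forall>c\<in>F. dist x c < R / s * s" using that R(1) s by auto
    then show ?thesis by (intro M[rule_format, OF s x]) (use that in auto)
  qed
  have "\<exists>F. ?P F \<and> (\<forall>F'. ?P F' \<longrightarrow> card F' \<le> card F)"
    by (rule ex_has_greatest_nat[of ?P "{}" card "Suc M"]) (use bd in \<open>auto simp: less_Suc_eq_le\<close>)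
  then obtain F where F: "?P F" "\<And>F'. ?P F' \<Longrightarrow> card F' \<le> card F" by auto
  have fin: "finite F" using bd[OF F(1)] by simp
  have cover: "\<exists>c\<in>F. dist y c < s" if y: "y \<in> \<Omega>" for y
  proof (rule ccontr)
    assume no: "\<not> ?thesis"
    then have "y \<notin> F" using s by (metis dist_self)
    moreover have "?P (insert y F)" using F(1) y no by (auto simp: dist_commute not_less)
    ultimately show False using F(2)[of "insert y F"] fin by simp
  qed
  obtain c where c: "bij_betw c {0..<card F} F" using ex_bij_betw_nat_finite[OF fin] by blast
  have "is_net s (card F) c"
    unfolding is_net_def
  proof (intro conjI allI impI ballI)
    fix i assume i: "i < card F"
    then have ci: "c i \<in> F" using bij_betwE[OF c] by auto
    then show "c i \<in> \<Omega>" using F(1) by auto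
    fix j assume j: "j < card F" "i \<noteq> j"
    then have "c j \<in> F" "c i \<noteq> c j"
      using bij_betwE[OF c] bij_betw_imp_inj_on[OF c] i by (auto dest: inj_onD)
    then show "s \<le> dist (c i) (c j)" using F(1) ci by auto
  next
    fix y assume "y \<in> \<Omega>"
    then obtain d where d: "d \<in> F" "dist y d < s" using cover by blast
    then obtain i where "i < card F" "c i = d"
      using bij_betw_imp_surj_on[OF c] by (metis atLeastLessThan_iff imageE)
    then show "\<exists>i<card F. dist y (c i) < s" using d by auto
  qed
  then show ?thesis by blast
qed

text \<open>The centres of the balls containing a given point are separated and close to that point,
  so their number is bounded independently of the scale \<open>s\<close>.\<close>

lemma net_overlap:
  assumes R: "0 < R"
  obtains M :: nat where "\<forall>s n c. 0 < s \<longrightarrow> is_net s n c \<longrightarrow>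
    (\<forall>h\<in>borel_measurable \<mu>. (\<Sum>i<n. \<integral>\<^sup>+ y\<in>ball (c i) (R * s) \<inter> \<Omega>. h y \<partial>\<mu>) \<le> of_nat M * (\<integral>\<^sup>+ y\<in>\<Omega>. h y \<partial>\<mu>))"
proof -
  obtain M where M: "\<forall>s>0. \<forall>x\<in>\<Omega>. \<forall>F\<subseteq>\<Omega>. (\<forall>c\<in>F. dist x c < R * s) \<and>
    (\<forall>c\<in>F. \<forall>c'\<in>F. c \<noteq> c' \<longrightarrow> s \<le> dist c c') \<longrightarrow> finite F \<and> card F \<le> M"
    by (rule separated_card_bound[OF R])
  have *: "(\<Sum>i<n. \<integral>\<^sup>+ y\<in>ball (c i) (R * s) \<inter> \<Omega>. h y \<partial>\<mu>) \<le> of_nat M * (\<integral>\<^sup>+ y\<in>\<Omega>. h y \<partial>\<mu>)"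
    if s: "0 < s" and net: "is_net s n c" and h[measurable]: "h \<in> borel_measurable \<mu>" for s n c and h :: "'x \<Rightarrow> ennreal"
  proof -
    have "(\<Sum>i<n. \<integral>\<^sup>+ y\<in>ball (c i) (R * s) \<inter> \<Omega>. h y \<partial>\<mu>)
        = (\<integral>\<^sup>+ y. (\<Sum>i<n. h y * indicator (ball (c i) (R * s) \<inter> \<Omega>) y) \<partial>\<mu>)"
      by (intro nn_integral_sum[symmetric] borel_measurable_times_ennreal h borel_measurable_indicator ball_sets)
    also have "\<dots> \<le> (\<integral>\<^sup>+ y. of_nat M * (h y * indicator \<Omega> y) \<partial>\<mu>)"
    proof (rule nn_integral_mono)
      fix y
      show "(\<Sum>i<n. h y * indicator (ball (c i) (R * s) \<inter> \<Omega>) y) \<le> of_nat M * (h y * indicator \<Omega> y)"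
      proof (cases "y \<in> \<Omega>")
        case True
        let ?I = "{i. i < n \<and> dist y (c i) < R * s}"
        have inj: "inj_on c ?I"
          using net s unfolding is_net_def inj_on_def by (metis (no_types, lifting) dist_self mem_Collect_eq not_le)
        have c\<Omega>: "c i \<in> \<Omega>" if "i < n" for i using net that unfolding is_net_def by simp
        have sep: "s \<le> dist (c i) (c j)" if "i < n" "j < n" "c i \<noteq> c j" for i j
          using net that unfolding is_net_def by metis
        have "finite (c ` ?I) \<and> card (c ` ?I) \<le> M"
          by (intro M[rule_format, OF s True]) (use c\<Omega> sep in auto)
        then have "card (c ` ?I) \<le> M" ..
        then have card: "card ?I \<le> M" by (simp add: card_image[OF inj])
        have "(\<Sum>i<n. h y * indicator (ball (c i) (R * s) \<inter> \<Omega>) y) = (\<Sum>i<n. if i \<in> ?I then h y else 0)"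
          using True by (intro sum.cong) (auto simp: indicator_def dist_commute)
        also have "\<dots> = of_nat (card ?I) * h y"
          by (simp add: sum.If_cases Int_def conj_commute cong: conj_cong)
        also have "\<dots> \<le> of_nat M * h y" using card by (intro mult_right_mono) auto
        finally show ?thesis using True by simp
      qed simp
    qed
    also have "\<dots> = of_nat M * (\<integral>\<^sup>+ y\<in>\<Omega>. h y \<partial>\<mu>)" by (rule nn_integral_cmult) measurable
    finally show ?thesis .
  qed
  show thesis by (rule that[of M], intro allI impI ballI) (rule *)
qed

end

subsection \<open>The Poincare inequality on balls\<close>

text \<open>Meant for nested balls with \<open>m\<close> the mean over the larger one
  \<open>B\<close>: the oscillation on \<open>B\<close> controls the mean on \<open>A\<close> after
  division by the smaller measure.\<close>

lemma abs_avg_diff_le: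
  fixes f :: "'a \<Rightarrow> real"
  assumes B: "B \<in> sets \<mu>" and A: "A \<in> fmeasurable \<mu>" "A \<subseteq> B" and pos: "0 < measure \<mu> A"
    and fB: "set_integrable \<mu> B (\<lambda>y. f y - m)" and f: "set_integrable \<mu> A f"
  shows "\<bar>avg \<mu> A f - m\<bar> \<le> (\<integral>y\<in>B. \<bar>f y - m\<bar> \<partial>\<mu>) / measure \<mu> A"
proof -
  have A_sets: "A \<in> sets \<mu>" using A by auto
  have m: "set_integrable \<mu> A (\<lambda>y. m)"
    using A by (simp add: set_integrable_def fmeasurable_def integrable_real_mult_indicator)
  have fA: "set_integrable \<mu> A (\<lambda>y. f y - m)"
    using f m by (rule set_integral_diff(1))
  have "(\<integral>y\<in>A. f y - m \<partial>\<mu>) = (\<integral>y\<in>A. f y \<partial>\<mu>) - (\<integral>y\<in>A. m \<partial>\<mu>)"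
    using f m by (rule set_integral_diff(2))
  also have "(\<integral>y\<in>A. m \<partial>\<mu>) = measure \<mu> A * m"
    using A_sets sets.sets_into_space[OF A_sets] by (simp add: set_lebesgue_integral_def Int_absorb2)
  finally have "avg \<mu> A f - m = (\<integral>y\<in>A. f y - m \<partial>\<mu>) / measure \<mu> A"
    using pos by (simp add: avg_def field_simps)
  moreover have "\<bar>\<integral>y\<in>A. f y - m \<partial>\<mu>\<bar> \<le> (\<integral>y\<in>A. \<bar>f y - m\<bar> \<partial>\<mu>)"
    using set_integral_norm_bound[OF fA] by simp
  moreover have "(\<integral>y\<in>A. \<bar>f y - m\<bar> \<partial>\<mu>) \<le> (\<integral>y\<in>B. \<bar>f y - m\<bar> \<partial>\<mu>)"
    unfolding set_lebesgue_integral_def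
  proof (rule integral_mono)
    show "integrable \<mu> (\<lambda>y. indicat_real A y *\<^sub>R \<bar>f y - m\<bar>)"
      using set_integrable_abs[OF fA] by (simp add: set_integrable_def)
    show "integrable \<mu> (\<lambda>y. indicat_real B y *\<^sub>R \<bar>f y - m\<bar>)"
      using set_integrable_abs[OF fB] by (simp add: set_integrable_def)
    show "indicat_real A y *\<^sub>R \<bar>f y - m\<bar> \<le> indicat_real B y *\<^sub>R \<bar>f y - m\<bar>" for y
      using A(2) by (auto simp: indicator_def)
  qed
  ultimately show ?thesis
    using pos by (simp add: divide_right_mono)
qed

text \<open>With \<open>t\<^sup>p\<close> comparable to the mean of \<open>x\<^sup>p\<close> this takes the place of Jensen's inequality.\<close>

lemma epow_le_truncate:
  assumes "0 < q" "q < p" "0 < t"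
  shows "epow x q \<le> ennreal (t powr q) + ennreal (t powr (q - p)) * epow x p"
proof (cases x)
  case (real a)
  have "a powr q \<le> t powr q + t powr (q - p) * a powr p"
  proof (cases "a \<le> t")
    case True
    then have "a powr q \<le> t powr q" using real assms by (intro powr_mono2) auto
    then show ?thesis by (simp add: add_increasing2)
  next
    case False
    then have "a powr q = a powr (q - p) * a powr p" using assms by (simp add: powr_add[symmetric])
    also have "\<dots> \<le> t powr (q - p) * a powr p"
      using False assms by (intro mult_right_mono powr_mono2') auto
    finally show ?thesis by (simp add: add_increasing)
  qed
  then show ?thesis
    using real by (simp add: epow_ennreal ennreal_mult[symmetric] ennreal_plus[symmetric] ennreal_leI del: ennreal_plus)
next
  case top
  then show ?thesis using assms by (simp add: ennreal_mult_top)
qed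

locale poincare_domain = doubling_domain \<mu> \<Omega> Cd
  for \<mu> :: "'x::metric_space measure" and \<Omega> :: "'x set" and Cd :: real +
  fixes p q Cp lam :: real
  assumes q: "1 \<le> q" and qp: "q < p" and Cp: "0 < Cp" and lam: "1 \<le> lam"
    and poincare: "x \<in> \<Omega> \<Longrightarrow> 0 < r \<Longrightarrow>
        locally_integrable_on \<mu> \<Omega> f \<Longrightarrow> set_integrable \<mu> (ball x r \<inter> \<Omega>) f \<Longrightarrow>
        upper_gradient \<Omega> euclidean_metric f g \<Longrightarrow>
        ennreal ((\<integral>y\<in>ball x r \<inter> \<Omega>. \<bar>f y - avg \<mu> (ball x r \<inter> \<Omega>) f\<bar> \<partial>\<mu>) / measure \<mu> (ball x r \<inter> \<Omega>))
          \<le> ennreal (Cp * r) *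
            epow ((\<integral>\<^sup>+ y \<in> ball x (lam * r) \<inter> \<Omega>. epow (g y) q \<partial>\<mu>) / emeasure \<mu> (ball x (lam * r) \<inter> \<Omega>)) (1 / q)"

lemma poincare_domainI:
  assumes "doubling_domain \<mu> \<Omega> Cd" "1 \<le> q" "q < p" "poincare_on \<mu> \<Omega> q"
  obtains Cp lam where "poincare_domain \<mu> \<Omega> Cd p q Cp lam"
proof -
  obtain C lam where "C > 0 \<and> lam \<ge> 1 \<and>
     (\<forall>x \<in> \<Omega>. \<forall>r > 0. \<forall>u g.
        locally_integrable_on \<mu> \<Omega> u \<and> set_integrable \<mu> (ball x r \<inter> \<Omega>) u \<and>
        upper_gradient \<Omega> (metric (UNIV, dist)) u g \<longrightarrow>
        ennreal ((\<integral>y\<in>ball x r \<inter> \<Omega>. \<bar>u y - avg \<mu> (ball x r \<inter> \<Omega>) u\<bar> \<partial>\<mu>) / measure \<mu> (ball x r \<inter> \<Omega>))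
          \<le> ennreal (C * r) *
            epow ((\<integral>\<^sup>+ y \<in> ball x (lam * r) \<inter> \<Omega>. epow (g y) q \<partial>\<mu>) / emeasure \<mu> (ball x (lam * r) \<inter> \<Omega>)) (1 / q))"
    using assms(4) unfolding poincare_on_def by (elim exE)
  then have "poincare_domain \<mu> \<Omega> Cd p q C lam"
    unfolding poincare_domain_def poincare_domain_axioms_def euclidean_metric_def
    using assms(1-3) by simp
  then show thesis by (rule that)
qed

context poincare_domain
begin

lemma p_gt_1: "1 < p" using q qp by simp

definition E :: "('x \<Rightarrow> ennreal) \<Rightarrow> 'x \<Rightarrow> real \<Rightarrow> real" where
  "E g x r = enn2real (\<integral>\<^sup>+ y\<in>ball x r \<inter> \<Omega>. epow (g y) p \<partial>\<mu>)"

text \<open>For finite energy this is the mean of \<open>1 + g^p\<close> over the ball. The summand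
  1 keeps it at least 1, so that its \<open>p\<close>-th root is positive and never larger than
  itself.\<close>

definition \<tau> :: "('x \<Rightarrow> ennreal) \<Rightarrow> 'x \<Rightarrow> real \<Rightarrow> real" where
  "\<tau> g x r = 1 + E g x r / V x r"

lemma E_nonneg: "0 \<le> E g x r" by (simp add: E_def)

lemma \<tau>_ge_1: "1 \<le> \<tau> g x r"
  unfolding \<tau>_def V_def by (simp add: E_nonneg)

lemma measurable_\<mu>: "g \<in> borel_measurable borel \<Longrightarrow> (g :: 'x \<Rightarrow> ennreal) \<in> borel_measurable \<mu>"
  using measurable_cong_sets[OF sets_\<mu> refl] by blast

lemma ennreal_E:
  assumes "(\<integral>\<^sup>+ y\<in>\<Omega>. epow (g y) p \<partial>\<mu>) < top"
  shows "ennreal (E g x r) = (\<integral>\<^sup>+ y\<in>ball x r \<inter> \<Omega>. epow (g y) p \<partial>\<mu>)"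
proof -
  have "(\<integral>\<^sup>+ y\<in>ball x r \<inter> \<Omega>. epow (g y) p \<partial>\<mu>) \<le> (\<integral>\<^sup>+ y\<in>\<Omega>. epow (g y) p \<partial>\<mu>)"
    by (intro nn_integral_mono) (auto simp: indicator_def)
  then show ?thesis using assms unfolding E_def by (intro ennreal_enn2real) (rule le_less_trans)
qed

definition admissible :: "('x \<Rightarrow> real) \<Rightarrow> ('x \<Rightarrow> ennreal) \<Rightarrow> bool" where
  "admissible f g \<longleftrightarrow> f \<in> borel_measurable \<mu> \<and> set_integrable \<mu> \<Omega> f \<and>
     upper_gradient \<Omega> euclidean_metric f g \<and> (\<integral>\<^sup>+ y\<in>\<Omega>. epow (g y) p \<partial>\<mu>) < top"

lemma admissible_set_integrable:
  assumes "admissible f g" "A \<in> sets \<mu>" "A \<subseteq> \<Omega>"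
  shows "set_integrable \<mu> A f"
  using assms unfolding admissible_def by (blast intro: set_integrable_subset)

lemma set_integrable_const_ball:
  "x \<in> \<Omega> \<Longrightarrow> 0 < r \<Longrightarrow> set_integrable \<mu> (ball x r \<inter> \<Omega>) (\<lambda>_. m :: real)"
  using ball_fmeasurable[of x r] by (simp add: set_integrable_def fmeasurable_def integrable_real_mult_indicator)

text \<open>The gradient is truncated at the level \<open>t\<close> with \<open>t powr p\<close>
  equal to \<tau> on the enlarged ball. Then both terms of \<open>epow_le_truncate\<close> have mean
  at most \<open>t powr q\<close>, and the \<open>q\<close>-mean in the Poincare inequality is at
  most \<open>2 * t\<close>.\<close>

lemma oscillation_le:
  assumes adm: "admissible f g" and x: "x \<in> \<Omega>" and r: "0 < r"
  shows "(\<integral>y\<in>ball x r \<inter> \<Omega>. \<bar>f y - avg \<mu> (ball x r \<inter> \<Omega>) f\<bar> \<partial>\<mu>)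
    \<le> 2 * Cp * r * \<tau> g x (lam * r) powr (1 / p) * V x r"
proof -
  let ?B = "ball x (lam * r) \<inter> \<Omega>"
  have lr: "0 < lam * r" using lam r by simp
  have g[measurable]: "g \<in> borel_measurable \<mu>"
    using adm by (intro measurable_\<mu>) (simp add: admissible_def upper_gradient_def)
  have fin: "(\<integral>\<^sup>+ y\<in>\<Omega>. epow (g y) p \<partial>\<mu>) < top" using adm by (simp add: admissible_def)
  define t where "t = \<tau> g x (lam * r) powr (1 / p)"
  have T1: "1 \<le> \<tau> g x (lam * r)" by (rule \<tau>_ge_1)
  have t: "0 < t" "t powr p = \<tau> g x (lam * r)"
    using T1 p_gt_1 by (auto simp: t_def powr_powr)
  let ?W = "V x (lam * r)"
  have W: "0 < ?W" using V_pos[OF x lr] .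
  have "(\<integral>\<^sup>+ y\<in>?B. epow (g y) q \<partial>\<mu>)
      \<le> (\<integral>\<^sup>+ y\<in>?B. ennreal (t powr q) + ennreal (t powr (q - p)) * epow (g y) p \<partial>\<mu>)"
    using q qp t(1) by (intro nn_integral_mono mult_right_mono epow_le_truncate) auto
  also have "\<dots> = (\<integral>\<^sup>+ y\<in>?B. ennreal (t powr q) \<partial>\<mu>) + (\<integral>\<^sup>+ y\<in>?B. ennreal (t powr (q - p)) * epow (g y) p \<partial>\<mu>)"
    by (rule nn_set_integral_add) auto
  also have "(\<integral>\<^sup>+ y\<in>?B. ennreal (t powr q) \<partial>\<mu>) = ennreal (t powr q * ?W)"
    using W by (simp add: nn_integral_cmult_indicator emeasure_ball[OF x lr] ennreal_mult)
  also have "(\<integral>\<^sup>+ y\<in>?B. ennreal (t powr (q - p)) * epow (g y) p \<partial>\<mu>) = ennreal (t powr (q - p) * E g x (lam * r))"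
    unfolding mult.assoc by (subst nn_integral_cmult) (auto simp: ennreal_E[OF fin, symmetric] ennreal_mult E_nonneg)
  also have "ennreal (t powr q * ?W) + ennreal (t powr (q - p) * E g x (lam * r))
      = ennreal (t powr q * ?W + t powr (q - p) * E g x (lam * r))"
    using W by (simp add: E_nonneg)
  also have "\<dots> \<le> ennreal (2 * t powr q * ?W)"
  proof (rule ennreal_leI)
    have "E g x (lam * r) \<le> t powr p * ?W" unfolding t(2) \<tau>_def using W by (simp add: field_simps)
    then have "t powr (q - p) * E g x (lam * r) \<le> t powr (q - p) * (t powr p * ?W)"
      by (intro mult_left_mono) auto
    also have "\<dots> = t powr q * ?W" by (simp add: powr_add[symmetric] mult.assoc[symmetric])
    finally show "t powr q * ?W + t powr (q - p) * E g x (lam * r) \<le> 2 * t powr q * ?W" by simp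
  qed
  finally have Iq: "(\<integral>\<^sup>+ y\<in>?B. epow (g y) q \<partial>\<mu>) \<le> ennreal (2 * t powr q * ?W)" .
  have "(\<integral>\<^sup>+ y\<in>?B. epow (g y) q \<partial>\<mu>) / emeasure \<mu> ?B \<le> ennreal (2 * t powr q * ?W) / ennreal ?W"
    unfolding emeasure_ball[OF x lr] by (rule divide_right_mono_ennreal[OF Iq])
  also have "\<dots> = ennreal (2 * t powr q)" using W by (simp add: divide_ennreal)
  finally have "epow ((\<integral>\<^sup>+ y\<in>?B. epow (g y) q \<partial>\<mu>) / emeasure \<mu> ?B) (1 / q) \<le> epow (ennreal (2 * t powr q)) (1 / q)"
    using q by (intro epow_mono) auto
  also have "\<dots> = ennreal (2 powr (1 / q) * t)"
    using q t(1) by (simp add: epow_ennreal powr_mult powr_powr)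
  also have "\<dots> \<le> ennreal (2 * t)"
  proof (intro ennreal_leI mult_right_mono)
    have "(2::real) powr (1 / q) \<le> 2 powr 1" using q by (intro powr_mono) auto
    then show "(2::real) powr (1 / q) \<le> 2" by simp
  qed (use t in auto)
  finally have RHS: "epow ((\<integral>\<^sup>+ y\<in>?B. epow (g y) q \<partial>\<mu>) / emeasure \<mu> ?B) (1 / q) \<le> ennreal (2 * t)" .
  let ?A = "ball x r \<inter> \<Omega>"
  have loc: "locally_integrable_on \<mu> \<Omega> f"
    unfolding locally_integrable_on_def
  proof (intro conjI allI impI)
    show "f \<in> borel_measurable \<mu>" using adm by (simp add: admissible_def)
    fix C assume "compact C \<and> C \<subseteq> \<Omega>"
    then show "set_integrable \<mu> C f"
      using sets_\<mu> by (intro admissible_set_integrable[OF adm]) (auto dest: compact_imp_closed)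
  qed
  have int: "set_integrable \<mu> ?A f" by (rule admissible_set_integrable[OF adm]) auto
  have ug: "upper_gradient \<Omega> euclidean_metric f g" using adm by (simp add: admissible_def)
  have "ennreal ((\<integral>y\<in>?A. \<bar>f y - avg \<mu> ?A f\<bar> \<partial>\<mu>) / V x r) \<le> ennreal (Cp * r) * ennreal (2 * t)"
    unfolding V_def
    by (rule order_trans[OF poincare[OF x r loc int ug] mult_left_mono[OF RHS]]) simp
  also have "\<dots> = ennreal (2 * Cp * r * t)"
    using Cp r t by (simp add: ennreal_mult[symmetric] mult.assoc mult.commute mult.left_commute)
  finally have "(\<integral>y\<in>?A. \<bar>f y - avg \<mu> ?A f\<bar> \<partial>\<mu>) / V x r \<le> 2 * Cp * r * t"
    using Cp r t by (simp add: ennreal_le_iff)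
  then show ?thesis
    using V_pos[OF x r] by (simp add: t_def pos_divide_le_eq)
qed

subsection \<open>Discretization\<close>

abbreviation \<nu> where "\<nu> \<equiv> restrict_space \<mu> \<Omega>"

lemma space_\<nu>: "space \<nu> = \<Omega>"
  by (simp add: space_restrict_space space_\<mu>)

lemma nn_integral_\<nu>: "(\<integral>\<^sup>+ x. f x \<partial>\<nu>) = (\<integral>\<^sup>+ x\<in>\<Omega>. f x \<partial>\<mu>)"
  by (rule nn_integral_restrict_open[OF sets_\<mu> open_\<Omega>])

lemma measurable_\<nu>: "f \<in> borel_measurable \<mu> \<Longrightarrow> f \<in> borel_measurable \<nu>"
  by (rule measurable_restrict_space1)

text \<open>Twice the net scale: such balls contain the cells, and the ball of the next level around
  a nearby centre still fits inside, since \<open>5/4 + 1/2 < 2\<close> in units of the net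
  scale.\<close>

definition rad :: "nat \<Rightarrow> real" where "rad k = 2 * (1 / 4) ^ k"

definition net_n :: "nat \<Rightarrow> nat" where "net_n k = (SOME n. \<exists>c. is_net ((1 / 4) ^ k) n c)"

definition net_c :: "nat \<Rightarrow> nat \<Rightarrow> 'x" where "net_c k = (SOME c. is_net ((1 / 4) ^ k) (net_n k) c)"

text \<open>Choosing the least index turns the overlapping balls of the net into a Borel
  partition.\<close>

definition cell :: "nat \<Rightarrow> 'x \<Rightarrow> nat" where
  "cell k x = (LEAST i. i < net_n k \<and> dist x (net_c k i) < (1 / 4) ^ k)"

definition center :: "nat \<Rightarrow> 'x \<Rightarrow> 'x" where "center k x = net_c k (cell k x)"

lemma rad_pos: "0 < rad k" by (simp add: rad_def)

lemma lam_rad_pos: "0 < lam * rad k" using rad_pos[of k] lam by simp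

lemma net: "is_net ((1 / 4) ^ k) (net_n k) (net_c k)"
proof -
  have "\<exists>n c. is_net ((1 / 4) ^ k) n c" by (rule net_exists) simp
  then have "\<exists>c. is_net ((1 / 4) ^ k) (net_n k) c" unfolding net_n_def by (rule someI_ex)
  then show ?thesis unfolding net_c_def by (rule someI_ex)
qed

lemma net_c_in: "i < net_n k \<Longrightarrow> net_c k i \<in> \<Omega>"
  using net[of k] by (simp add: is_net_def)

lemma cell:
  assumes "x \<in> \<Omega>"
  shows "cell k x < net_n k" "dist x (center k x) < (1 / 4) ^ k"
proof -
  have "\<exists>i. i < net_n k \<and> dist x (net_c k i) < (1 / 4) ^ k"
    using net[of k] assms by (simp add: is_net_def)
  from LeastI_ex[OF this] show "cell k x < net_n k" "dist x (center k x) < (1 / 4) ^ k"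
    by (simp_all add: cell_def center_def)
qed

lemma center_in: "x \<in> \<Omega> \<Longrightarrow> center k x \<in> \<Omega>"
  unfolding center_def by (intro net_c_in cell)

lemma in_cell_ball: "x \<in> \<Omega> \<Longrightarrow> x \<in> ball (center k x) (rad k) \<inter> \<Omega>"
  using cell(2)[of x k] unfolding rad_def by (auto simp: dist_commute intro: less_le_trans)

lemma cell_sets: "{x \<in> \<Omega>. cell k x = i} \<in> sets borel"
proof -
  let ?U = "\<lambda>j. if j < net_n k then ball (net_c k j) ((1 / 4) ^ k) else {}"
  have *: "cell k x = i \<longleftrightarrow> x \<in> ?U i \<and> (\<forall>j<i. x \<notin> ?U j)" if x: "x \<in> \<Omega>" for x
  proof
    assume i: "cell k x = i"
    show "x \<in> ?U i \<and> (\<forall>j<i. x \<notin> ?U j)"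
    proof (intro conjI allI impI)
      show "x \<in> ?U i" using cell[OF x, of k] i by (simp add: center_def dist_commute)
      fix j assume "j < i"
      then have "\<not> (j < net_n k \<and> dist x (net_c k j) < (1 / 4) ^ k)"
        unfolding i[symmetric] cell_def by (rule not_less_Least)
      then show "x \<notin> ?U j" by (simp add: dist_commute)
    qed
  next
    assume i: "x \<in> ?U i \<and> (\<forall>j<i. x \<notin> ?U j)"
    show "cell k x = i"
      unfolding cell_def
    proof (rule Least_equality)
      show "i < net_n k \<and> dist x (net_c k i) < (1 / 4) ^ k"
        using i by (auto simp: dist_commute split: if_splits)
      show "i \<le> j" if "j < net_n k \<and> dist x (net_c k j) < (1 / 4) ^ k" for j
        using i that by (metis dist_commute mem_ball not_le)
    qed
  qed
  have "{x \<in> \<Omega>. cell k x = i} = {x \<in> \<Omega>. x \<in> ?U i \<and> (\<forall>j<i. x \<notin> ?U j)}"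
    by (intro Collect_cong conj_cong refl *)
  also have "\<dots> = \<Omega> \<inter> ?U i - (\<Union>j<i. ?U j)" by blast
  also have "\<dots> \<in> sets borel"
  proof (intro sets.Diff sets.Int sets.finite_UN)
    show "?U j \<in> sets borel" for j by simp
  qed (use open_\<Omega> in simp_all)
  finally show ?thesis .
qed

lemma cell_measurable: "cell k \<in> measurable \<nu> (count_space UNIV)"
proof (subst measurable_count_space_eq_countable)
  have "cell k -` {a} \<inter> space \<nu> \<in> sets \<nu>" for a
  proof -
    have "cell k -` {a} \<inter> space \<nu> = \<Omega> \<inter> {x \<in> \<Omega>. cell k x = a}" by (auto simp: space_\<nu>)
    then show ?thesis
      unfolding sets_restrict_space sets_\<mu> by (rule image_eqI) (rule cell_sets)
  qed
  then show "cell k \<in> space \<nu> \<rightarrow> UNIV \<and> (\<forall>a\<in>UNIV. cell k -` {a} \<inter> space \<nu> \<in> sets \<nu>)" by simp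
qed simp

lemma cell_compose_measurable: "(\<lambda>x. H (cell k x)) \<in> borel_measurable \<nu>"
  by (rule measurable_compose[OF cell_measurable]) simp

lemma nn_integral_cells_le:
  assumes F: "\<And>i. F i \<in> borel_measurable \<mu>"
  shows "(\<integral>\<^sup>+ x. F (cell k x) x \<partial>\<nu>) \<le> (\<Sum>i<net_n k. \<integral>\<^sup>+ y\<in>ball (net_c k i) (rad k) \<inter> \<Omega>. F i y \<partial>\<mu>)"
proof -
  have "(\<integral>\<^sup>+ x. F (cell k x) x \<partial>\<nu>) \<le> (\<integral>\<^sup>+ y. (\<Sum>i<net_n k. F i y * indicator (ball (net_c k i) (rad k) \<inter> \<Omega>) y) \<partial>\<mu>)"
    unfolding nn_integral_\<nu>
  proof (rule nn_integral_mono)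
    fix x
    show "F (cell k x) x * indicator \<Omega> x \<le> (\<Sum>i<net_n k. F i x * indicator (ball (net_c k i) (rad k) \<inter> \<Omega>) x)"
    proof (cases "x \<in> \<Omega>")
      case True
      have "F (cell k x) x * indicator \<Omega> x
          = F (cell k x) x * indicator (ball (net_c k (cell k x)) (rad k) \<inter> \<Omega>) x"
        using in_cell_ball[OF True, of k] True by (simp add: center_def)
      also have "\<dots> \<le> (\<Sum>i<net_n k. F i x * indicator (ball (net_c k i) (rad k) \<inter> \<Omega>) x)"
        using cell(1)[OF True] by (intro member_le_sum) auto
      finally show ?thesis .
    qed simp
  qed
  also have "\<dots> = (\<Sum>i<net_n k. \<integral>\<^sup>+ y\<in>ball (net_c k i) (rad k) \<inter> \<Omega>. F i y \<partial>\<mu>)"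
    by (intro nn_integral_sum borel_measurable_times_ennreal F borel_measurable_indicator ball_sets)
  finally show ?thesis .
qed

text \<open>For finite energy, the integral of \<open>1 + g^p\<close> over the enlarged ball. Unlike
  the mean \<tau> it can be summed over a net by the overlap bound.\<close>

definition P :: "('x \<Rightarrow> ennreal) \<Rightarrow> nat \<Rightarrow> nat \<Rightarrow> real" where
  "P g k i = V (net_c k i) (lam * rad k) + E g (net_c k i) (lam * rad k)"

lemma V_nonneg: "0 \<le> V x r" by (simp add: V_def)

lemma V_tau_le_P:
  assumes "i < net_n k"
  shows "\<tau> g (net_c k i) (lam * rad k) * V (net_c k i) (rad k) \<le> P g k i"
proof -
  let ?c = "net_c k i"
  have c: "?c \<in> \<Omega>" by (rule net_c_in[OF assms])
  have "rad k \<le> lam * rad k" using lam rad_pos[of k] by simp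
  then have "V ?c (rad k) \<le> V ?c (lam * rad k)"
    using c lam_rad_pos by (intro V_mono) auto
  then have "\<tau> g ?c (lam * rad k) * V ?c (rad k) \<le> \<tau> g ?c (lam * rad k) * V ?c (lam * rad k)"
    using \<tau>_ge_1[of g ?c "lam * rad k"] by (intro mult_left_mono) auto
  also have "\<dots> = P g k i"
    using V_pos[OF c lam_rad_pos, of k] by (simp add: \<tau>_def P_def field_simps)
  finally show ?thesis .
qed

text \<open>The enlarged balls have radius \<open>2 * lam\<close> times the net scale, a fixed
  ratio, so a single overlap constant serves all levels \<open>k\<close> and all gradients.\<close>

lemma sum_P_bound:
  obtains M :: real where "0 \<le> M" "\<forall>k g B. g \<in> borel_measurable borel \<longrightarrow> 0 \<le> B \<longrightarrow>
    (\<integral>\<^sup>+ y\<in>\<Omega>. epow (g y) p \<partial>\<mu>) \<le> ennreal B \<longrightarrow> (\<Sum>i<net_n k. P g k i) \<le> M * (measure \<mu> \<Omega> + B)"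
proof -
  obtain M :: nat where M: "\<forall>s n c. 0 < s \<longrightarrow> is_net s n c \<longrightarrow>
    (\<forall>h\<in>borel_measurable \<mu>. (\<Sum>i<n. \<integral>\<^sup>+ y\<in>ball (c i) ((2 * lam) * s) \<inter> \<Omega>. h y \<partial>\<mu>) \<le> of_nat M * (\<integral>\<^sup>+ y\<in>\<Omega>. h y \<partial>\<mu>))"
    by (rule net_overlap[of "2 * lam"]) (use lam in simp)
  have *: "(\<Sum>i<net_n k. P g k i) \<le> real M * (measure \<mu> \<Omega> + B)"
    if g: "g \<in> borel_measurable borel" and B: "0 \<le> B" and fin: "(\<integral>\<^sup>+ y\<in>\<Omega>. epow (g y) p \<partial>\<mu>) \<le> ennreal B" for k g B
  proof -
    have g\<mu>[measurable]: "g \<in> borel_measurable \<mu>" by (rule measurable_\<mu>[OF g])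
    have fin': "(\<integral>\<^sup>+ y\<in>\<Omega>. epow (g y) p \<partial>\<mu>) < top" using fin by (rule le_less_trans) simp
    have add: "(\<integral>\<^sup>+ y\<in>A. 1 + epow (g y) p \<partial>\<mu>) = emeasure \<mu> A + (\<integral>\<^sup>+ y\<in>A. epow (g y) p \<partial>\<mu>)" if "A \<in> sets \<mu>" for A
      using that by (subst nn_set_integral_add) auto
    have "ennreal (\<Sum>i<net_n k. P g k i) = (\<Sum>i<net_n k. ennreal (P g k i))"
      by (rule sum_ennreal[symmetric]) (simp add: P_def V_nonneg E_nonneg)
    also have "\<dots> = (\<Sum>i<net_n k. \<integral>\<^sup>+ y\<in>ball (net_c k i) ((2 * lam) * (1 / 4) ^ k) \<inter> \<Omega>. 1 + epow (g y) p \<partial>\<mu>)"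
    proof (rule sum.cong)
      fix i assume "i \<in> {..<net_n k}"
      then have c: "net_c k i \<in> \<Omega>" by (simp add: net_c_in)
      have eq: "(2 * lam) * (1 / 4) ^ k = lam * rad k" by (simp add: rad_def)
      show "ennreal (P g k i) = (\<integral>\<^sup>+ y\<in>ball (net_c k i) ((2 * lam) * (1 / 4) ^ k) \<inter> \<Omega>. 1 + epow (g y) p \<partial>\<mu>)"
        unfolding eq P_def add[OF ball_sets] emeasure_ball[OF c lam_rad_pos] ennreal_E[OF fin', symmetric]
        by (rule ennreal_plus) (auto simp: V_nonneg E_nonneg)
    qed simp
    also have "\<dots> \<le> of_nat M * (\<integral>\<^sup>+ y\<in>\<Omega>. 1 + epow (g y) p \<partial>\<mu>)"
      by (rule M[rule_format, OF _ net]) auto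
    also have "\<dots> \<le> of_nat M * (emeasure \<mu> \<Omega> + ennreal B)"
      unfolding add[OF \<Omega>_sets] by (intro mult_left_mono add_left_mono fin) simp
    also have "\<dots> = ennreal (real M * (measure \<mu> \<Omega> + B))"
      using \<Omega>_fmeasurable B
      by (simp add: emeasure_eq_measure2 ennreal_of_nat_eq_real_of_nat ennreal_mult ennreal_plus)
    finally show ?thesis using B by (simp add: ennreal_le_iff)
  qed
  show thesis by (rule that[of "real M"], simp, intro allI impI) (rule *)
qed

definition approx :: "('x \<Rightarrow> real) \<Rightarrow> nat \<Rightarrow> 'x \<Rightarrow> real" where
  "approx f k x = avg \<mu> (ball (center k x) (rad k) \<inter> \<Omega>) f"

definition tau :: "('x \<Rightarrow> ennreal) \<Rightarrow> nat \<Rightarrow> 'x \<Rightarrow> real" where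
  "tau g k x = \<tau> g (center k x) (lam * rad k)"

lemma tau_ge_1: "1 \<le> tau g k x" unfolding tau_def by (rule \<tau>_ge_1)

lemma tau_measurable: "(\<lambda>x. tau g k x) \<in> borel_measurable \<nu>"
  unfolding tau_def center_def by (rule cell_compose_measurable)

lemma approx_measurable: "(\<lambda>x. approx f k x) \<in> borel_measurable \<nu>"
  unfolding approx_def center_def by (rule cell_compose_measurable)

text \<open>The two averaging balls around a point are nested and of comparable measure, so the
  oscillation on the larger one bounds the change of the mean. The constant combines the factor 2 of
  \<open>oscillation_le\<close>, the 2 in \<open>rad\<close> and three doublings.\<close>

lemma approx_step:
  assumes adm: "admissible f g" and x: "x \<in> \<Omega>"
  shows "\<bar>approx f (Suc k) x - approx f k x\<bar> \<le> (4 * Cp * Cd ^ 3) * (1 / 4) ^ k * tau g k x powr (1 / p)"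
proof -
  let ?c = "center k x" and ?c' = "center (Suc k) x"
  let ?B = "ball ?c (rad k) \<inter> \<Omega>" and ?A = "ball ?c' (rad (Suc k)) \<inter> \<Omega>"
  have c: "?c \<in> \<Omega>" "?c' \<in> \<Omega>" using center_in[OF x] by auto
  have "dist ?c ?c' < (1 / 4) ^ k + (1 / 4) ^ k / 4"
    using cell(2)[OF x, of k] cell(2)[OF x, of "Suc k"] dist_triangle[of ?c ?c' x] by (simp add: dist_commute)
  then have d: "dist ?c ?c' < 5 / 4 * (1 / 4) ^ k" by simp
  have s: "0 < (1 / 4 :: real) ^ k" by simp
  have AB: "?A \<subseteq> ?B"
  proof
    fix y assume y: "y \<in> ?A"
    then have "dist ?c' y < (1 / 4) ^ k / 2" by (simp add: rad_def)
    then have "dist ?c y < rad k" using d dist_triangle[of ?c y ?c'] s unfolding rad_def by linarith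
    then show "y \<in> ?B" using y by simp
  qed
  \<comment> \<open>The larger radius plus the distance of the centres is less than
    \<open>13/4\<close> of the net scale, while three doublings of \<open>rad (Suc k)\<close> give 4
    times that scale.\<close>
  have "ball ?c (rad k) \<subseteq> ball ?c' (2 ^ 3 * rad (Suc k))"
  proof
    fix y assume "y \<in> ball ?c (rad k)"
    then have "dist ?c y < 2 * (1 / 4) ^ k" by (simp add: rad_def)
    then have "dist ?c' y < 4 * (1 / 4) ^ k"
      using d dist_triangle[of ?c' y ?c] s unfolding dist_commute[of ?c' ?c] by linarith
    then show "y \<in> ball ?c' (2 ^ 3 * rad (Suc k))" by (simp add: rad_def)
  qed
  then have "V ?c (rad k) \<le> V ?c' (2 ^ 3 * rad (Suc k))"
    using c rad_pos[of "Suc k"] by (intro V_mono) auto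
  also have "\<dots> \<le> Cd ^ 3 * V ?c' (rad (Suc k))" by (rule V_doubling_iter[OF c(2) rad_pos])
  finally have VV: "V ?c (rad k) \<le> Cd ^ 3 * V ?c' (rad (Suc k))" .
  have VA: "0 < V ?c' (rad (Suc k))" by (rule V_pos[OF c(2) rad_pos])
  have "\<bar>avg \<mu> ?A f - approx f k x\<bar> \<le> (\<integral>y\<in>?B. \<bar>f y - approx f k x\<bar> \<partial>\<mu>) / measure \<mu> ?A"
  proof (rule abs_avg_diff_le[OF ball_sets ball_fmeasurable[OF c(2) rad_pos] AB])
    show "0 < measure \<mu> ?A" using VA by (simp add: V_def)
    show "set_integrable \<mu> ?A f" by (rule admissible_set_integrable[OF adm]) auto
    show "set_integrable \<mu> ?B (\<lambda>y. f y - approx f k x)"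
      by (intro set_integral_diff(1) admissible_set_integrable[OF adm] set_integrable_const_ball c rad_pos) auto
  qed
  also have "\<dots> \<le> (2 * Cp * rad k * tau g k x powr (1 / p) * V ?c (rad k)) / measure \<mu> ?A"
    unfolding approx_def tau_def by (rule divide_right_mono[OF oscillation_le[OF adm c(1) rad_pos]]) simp
  also have "\<dots> \<le> (2 * Cp * rad k * tau g k x powr (1 / p) * (Cd ^ 3 * V ?c' (rad (Suc k)))) / measure \<mu> ?A"
    using Cp rad_pos[of k] by (intro divide_right_mono mult_left_mono VV) auto
  also have "\<dots> = (4 * Cp * Cd ^ 3) * (1 / 4) ^ k * tau g k x powr (1 / p)"
    using VA by (simp add: V_def rad_def)
  finally show ?thesis by (simp add: approx_def)
qed

text \<open>This serves to identify the limit of the means. Since only summability in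
  \<open>k\<close> matters, the \<open>p\<close>-th root of \<tau> may be replaced by \<tau> itself,
  whose integral over the balls is controlled by \<open>P\<close>.\<close>

lemma approx_L1:
  assumes adm: "admissible f g" and S: "(\<Sum>i<net_n k. P g k i) \<le> S"
  shows "(\<integral>\<^sup>+ x. ennreal \<bar>f x - approx f k x\<bar> \<partial>\<nu>) \<le> ennreal (4 * Cp * S * (1 / 4) ^ k)"
proof -
  let ?m = "\<lambda>i. avg \<mu> (ball (net_c k i) (rad k) \<inter> \<Omega>) f"
  have f[measurable]: "f \<in> borel_measurable \<mu>" using adm by (simp add: admissible_def)
  have "(\<integral>\<^sup>+ x. ennreal \<bar>f x - approx f k x\<bar> \<partial>\<nu>)
      \<le> (\<Sum>i<net_n k. \<integral>\<^sup>+ y\<in>ball (net_c k i) (rad k) \<inter> \<Omega>. ennreal \<bar>f y - ?m i\<bar> \<partial>\<mu>)"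
    unfolding approx_def center_def
    by (rule nn_integral_cells_le[of "\<lambda>i y. ennreal \<bar>f y - ?m i\<bar>"]) measurable
  also have "\<dots> \<le> (\<Sum>i<net_n k. ennreal (2 * Cp * rad k * P g k i))"
  proof (rule sum_mono)
    fix i assume "i \<in> {..<net_n k}"
    then have i: "i < net_n k" by simp
    let ?c = "net_c k i"
    let ?A = "ball ?c (rad k) \<inter> \<Omega>"
    have c: "?c \<in> \<Omega>" by (rule net_c_in[OF i])
    have int: "set_integrable \<mu> ?A (\<lambda>y. f y - ?m i)"
      by (intro set_integral_diff(1) admissible_set_integrable[OF adm] set_integrable_const_ball c rad_pos) auto
    have "(\<integral>\<^sup>+ y\<in>?A. ennreal \<bar>f y - ?m i\<bar> \<partial>\<mu>) = ennreal (\<integral>y\<in>?A. \<bar>f y - ?m i\<bar> \<partial>\<mu>)"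
    proof -
      have "(\<integral>\<^sup>+ y\<in>?A. ennreal \<bar>f y - ?m i\<bar> \<partial>\<mu>) = (\<integral>\<^sup>+ y. ennreal (indicat_real ?A y *\<^sub>R \<bar>f y - ?m i\<bar>) \<partial>\<mu>)"
        by (intro nn_integral_cong) (auto simp: indicator_def)
      also have "\<dots> = ennreal (\<integral>y\<in>?A. \<bar>f y - ?m i\<bar> \<partial>\<mu>)"
        unfolding set_lebesgue_integral_def
        using set_integrable_abs[OF int] by (intro nn_integral_eq_integral) (auto simp: set_integrable_def)
      finally show ?thesis .
    qed
    also have "\<dots> \<le> ennreal (2 * Cp * rad k * P g k i)"
    proof (rule ennreal_leI)
      have "(\<integral>y\<in>?A. \<bar>f y - ?m i\<bar> \<partial>\<mu>) \<le> 2 * Cp * rad k * \<tau> g ?c (lam * rad k) powr (1 / p) * V ?c (rad k)"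
        by (rule oscillation_le[OF adm c rad_pos])
      also have "\<dots> \<le> 2 * Cp * rad k * \<tau> g ?c (lam * rad k) * V ?c (rad k)"
      proof (intro mult_right_mono mult_left_mono)
        have "\<tau> g ?c (lam * rad k) powr (1 / p) \<le> \<tau> g ?c (lam * rad k) powr 1"
          using p_gt_1 by (intro powr_mono \<tau>_ge_1) auto
        then show "\<tau> g ?c (lam * rad k) powr (1 / p) \<le> \<tau> g ?c (lam * rad k)"
          using \<tau>_ge_1[of g ?c "lam * rad k"] by simp
      qed (use Cp rad_pos[of k] in \<open>auto simp: V_nonneg\<close>)
      also have "\<dots> \<le> 2 * Cp * rad k * P g k i"
        unfolding mult.assoc using V_tau_le_P[OF i, of g] Cp rad_pos[of k] by (intro mult_left_mono) auto
      finally show "(\<integral>y\<in>?A. \<bar>f y - ?m i\<bar> \<partial>\<mu>) \<le> 2 * Cp * rad k * P g k i" .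
    qed
    finally show "(\<integral>\<^sup>+ y\<in>?A. ennreal \<bar>f y - ?m i\<bar> \<partial>\<mu>) \<le> ennreal (2 * Cp * rad k * P g k i)" .
  qed
  also have "\<dots> = ennreal (2 * Cp * rad k * (\<Sum>i<net_n k. P g k i))"
    using Cp rad_pos[of k] by (subst sum_ennreal) (auto simp: P_def V_nonneg E_nonneg sum_distrib_left)
  also have "\<dots> \<le> ennreal (4 * Cp * S * (1 / 4) ^ k)"
  proof (rule ennreal_leI)
    have "2 * Cp * rad k * (\<Sum>i<net_n k. P g k i) \<le> 2 * Cp * rad k * S"
      using Cp rad_pos[of k] S by (intro mult_left_mono) auto
    then show "2 * Cp * rad k * (\<Sum>i<net_n k. P g k i) \<le> 4 * Cp * S * (1 / 4) ^ k"
      by (simp add: rad_def algebra_simps)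
  qed
  finally show ?thesis .
qed

lemma nn_integral_tau_le:
  assumes S: "(\<Sum>i<net_n k. P g k i) \<le> S"
  shows "(\<integral>\<^sup>+ x. ennreal (tau g k x) \<partial>\<nu>) \<le> ennreal S"
proof -
  have "(\<integral>\<^sup>+ x. ennreal (tau g k x) \<partial>\<nu>)
      \<le> (\<Sum>i<net_n k. \<integral>\<^sup>+ y\<in>ball (net_c k i) (rad k) \<inter> \<Omega>. ennreal (\<tau> g (net_c k i) (lam * rad k)) \<partial>\<mu>)"
    unfolding tau_def center_def
    by (rule nn_integral_cells_le[of "\<lambda>i y. ennreal (\<tau> g (net_c k i) (lam * rad k))"]) simp
  also have "\<dots> \<le> (\<Sum>i<net_n k. ennreal (P g k i))"
  proof (rule sum_mono)
    fix i assume "i \<in> {..<net_n k}"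
    then have i: "i < net_n k" by simp
    let ?c = "net_c k i"
    have "(\<integral>\<^sup>+ y\<in>ball ?c (rad k) \<inter> \<Omega>. ennreal (\<tau> g ?c (lam * rad k)) \<partial>\<mu>)
        = ennreal (\<tau> g ?c (lam * rad k)) * emeasure \<mu> (ball ?c (rad k) \<inter> \<Omega>)"
      by (rule nn_integral_cmult_indicator) simp
    also have "\<dots> = ennreal (\<tau> g ?c (lam * rad k) * V ?c (rad k))"
      using \<tau>_ge_1[of g ?c "lam * rad k"] unfolding emeasure_ball[OF net_c_in[OF i] rad_pos]
      by (intro ennreal_mult[symmetric]) (auto simp: V_nonneg)
    also have "\<dots> \<le> ennreal (P g k i)" by (rule ennreal_leI[OF V_tau_le_P[OF i]])
    finally show "(\<integral>\<^sup>+ y\<in>ball ?c (rad k) \<inter> \<Omega>. ennreal (\<tau> g ?c (lam * rad k)) \<partial>\<mu>) \<le> ennreal (P g k i)" .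
  qed
  also have "\<dots> = ennreal (\<Sum>i<net_n k. P g k i)"
    by (rule sum_ennreal) (simp add: P_def V_nonneg E_nonneg)
  also have "\<dots> \<le> ennreal S" by (rule ennreal_leI[OF S])
  finally show ?thesis .
qed

text \<open>The weights are a compromise: with \<open>(1/2)^k\<close> the integral of the tail
  starting at \<open>k0\<close> is of order \<open>(1/2)^k0\<close>, and the resulting pointwise
  bound \<open>tau g k x \<le> 2^k * T g k0 x\<close> is still beaten by the factor
  \<open>(1/4)^k\<close> in \<open>approx_step\<close>.\<close>

definition T :: "('x \<Rightarrow> ennreal) \<Rightarrow> nat \<Rightarrow> 'x \<Rightarrow> ennreal" where
  "T g k0 x = (\<Sum>k. ennreal ((1 / 2) ^ (k0 + k) * tau g (k0 + k) x))"

lemma T_measurable: "T g k0 \<in> borel_measurable \<nu>"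
proof -
  have [measurable]: "(\<lambda>x. tau g k x) \<in> borel_measurable \<nu>" for k by (rule tau_measurable)
  show ?thesis unfolding T_def[abs_def] by measurable
qed

lemma T_ge: "ennreal ((1 / 2) ^ (k0 + k) * tau g (k0 + k) x) \<le> T g k0 x"
  unfolding T_def using sum_le_suminf[of "\<lambda>k. ennreal ((1 / 2) ^ (k0 + k) * tau g (k0 + k) x)" "{k}"] by simp

lemma T_pos: "0 < T g k0 x"
proof -
  have "0 < ennreal ((1 / 2) ^ (k0 + 0) * tau g (k0 + 0) x)"
    using tau_ge_1[of g k0 x] by simp
  then show ?thesis using T_ge by (rule less_le_trans)
qed

lemma nn_integral_T_le:
  assumes S: "\<And>k. (\<Sum>i<net_n k. P g k i) \<le> S" and S0: "0 \<le> S"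
  shows "(\<integral>\<^sup>+ x. T g k0 x \<partial>\<nu>) \<le> ennreal (2 * S * (1 / 2) ^ k0)"
proof -
  have [measurable]: "(\<lambda>x. tau g k x) \<in> borel_measurable \<nu>" for k by (rule tau_measurable)
  have "(\<integral>\<^sup>+ x. T g k0 x \<partial>\<nu>) = (\<Sum>k. \<integral>\<^sup>+ x. ennreal ((1 / 2) ^ (k0 + k) * tau g (k0 + k) x) \<partial>\<nu>)"
    unfolding T_def by (rule nn_integral_suminf) measurable
  also have "\<dots> \<le> (\<Sum>k. ennreal (S * (1 / 2) ^ k0 * (1 / 2) ^ k))"
  proof (intro suminf_le)
    fix k
    have "(\<integral>\<^sup>+ x. ennreal ((1 / 2) ^ (k0 + k) * tau g (k0 + k) x) \<partial>\<nu>)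
        = ennreal ((1 / 2) ^ (k0 + k)) * (\<integral>\<^sup>+ x. ennreal (tau g (k0 + k) x) \<partial>\<nu>)"
      by (subst nn_integral_cmult[symmetric]) (measurable, simp add: ennreal_mult')
    also have "\<dots> \<le> ennreal ((1 / 2) ^ (k0 + k)) * ennreal S"
      by (intro mult_left_mono nn_integral_tau_le S) simp
    also have "\<dots> = ennreal (S * (1 / 2) ^ k0 * (1 / 2) ^ k)"
      using S0 by (subst ennreal_mult[symmetric]) (auto simp: power_add mult_ac)
    finally show "(\<integral>\<^sup>+ x. ennreal ((1 / 2) ^ (k0 + k) * tau g (k0 + k) x) \<partial>\<nu>) \<le> ennreal (S * (1 / 2) ^ k0 * (1 / 2) ^ k)" .
  qed auto
  also have "\<dots> = ennreal (S * (1 / 2) ^ k0 * 2)"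
  proof (rule suminf_ennreal_eq)
    have "(\<lambda>k. (1 / 2 :: real) ^ k) sums 2" using geometric_sums[of "1 / 2 :: real"] by simp
    then show "(\<lambda>k. S * (1 / 2) ^ k0 * (1 / 2) ^ k) sums (S * (1 / 2) ^ k0 * 2)" by (rule sums_mult)
  qed (use S0 in simp)
  finally show ?thesis by (simp add: mult_ac)
qed

text \<open>The errors in mean sum to a finite integral, hence they are summable at almost every
  point. This takes the place of a differentiation theorem for the measure.\<close>

lemma approx_tendsto_AE:
  assumes adm: "admissible f g" and S: "\<And>k. (\<Sum>i<net_n k. P g k i) \<le> S" and S0: "0 \<le> S"
  shows "AE x in \<nu>. (\<lambda>k. approx f k x) \<longlonglongrightarrow> f x"
proof -
  have [measurable]: "f \<in> borel_measurable \<nu>" using adm by (intro measurable_\<nu>) (simp add: admissible_def)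
  have [measurable]: "(\<lambda>x. approx f k x) \<in> borel_measurable \<nu>" for k by (rule approx_measurable)
  have "(\<integral>\<^sup>+ x. (\<Sum>k. ennreal \<bar>f x - approx f k x\<bar>) \<partial>\<nu>) = (\<Sum>k. \<integral>\<^sup>+ x. ennreal \<bar>f x - approx f k x\<bar> \<partial>\<nu>)"
    by (rule nn_integral_suminf) measurable
  also have "\<dots> \<le> (\<Sum>k. ennreal (4 * Cp * S * (1 / 4) ^ k))"
    by (intro suminf_le approx_L1[OF adm S]) auto
  also have "\<dots> < top"
    using Cp S0 by (subst suminf_ennreal2) (auto intro!: summable_mult simp: complete_algebra_summable_geometric)
  finally have "AE x in \<nu>. (\<Sum>k. ennreal \<bar>f x - approx f k x\<bar>) \<noteq> \<infinity>"
    by (intro nn_integral_noteq_infinite) auto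
  then show ?thesis
  proof (rule eventually_mono)
    fix x assume "(\<Sum>k. ennreal \<bar>f x - approx f k x\<bar>) \<noteq> \<infinity>"
    then have "summable (\<lambda>k. \<bar>f x - approx f k x\<bar>)"
      by (intro summable_suminf_not_top) (auto simp: infinity_ennreal_def)
    then have "(\<lambda>k. \<bar>f x - approx f k x\<bar>) \<longlonglongrightarrow> 0" by (rule summable_LIMSEQ_zero)
    then have "(\<lambda>k. f x - approx f k x) \<longlonglongrightarrow> 0" by (rule tendsto_rabs_zero_cancel)
    from tendsto_diff[OF tendsto_const[of "f x"] this] show "(\<lambda>k. approx f k x) \<longlonglongrightarrow> f x" by simp
  qed
qed

definition Kc :: real where "Kc = 4 * Cp * Cd ^ 3"

lemma Kc_pos: "0 < Kc" using Cp Cd by (simp add: Kc_def)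

lemma approx_tail:
  assumes adm: "admissible f g" and x: "x \<in> \<Omega>" and lim: "(\<lambda>k. approx f k x) \<longlonglongrightarrow> f x" and fin: "T g k0 x < top"
  shows "\<bar>f x - approx f k0 x\<bar> \<le> 2 * Kc * enn2real (T g k0 x) powr (1 / p)"
proof -
  define t where "t = enn2real (T g k0 x)"
  have T_eq: "T g k0 x = ennreal t" using fin by (simp add: t_def)
  have step: "\<bar>approx f (Suc (k0 + k)) x - approx f (k0 + k) x\<bar> \<le> Kc * t powr (1 / p) * (1 / 2) ^ k" for k
  proof -
    let ?m = "k0 + k"
    have "(1 / 2) ^ ?m * tau g ?m x \<le> t"
      using T_ge[of k0 k g x] unfolding T_eq by (simp add: t_def)
    then have "tau g ?m x \<le> 2 ^ ?m * t" by (simp add: power_one_over field_simps)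
    then have "tau g ?m x powr (1 / p) \<le> (2 ^ ?m * t) powr (1 / p)"
      using tau_ge_1[of g ?m x] p_gt_1 by (intro powr_mono2) auto
    also have "\<dots> = (2 ^ ?m) powr (1 / p) * t powr (1 / p)" by (rule powr_mult)
    \<comment> \<open>The root of \<open>2 ^ ?m\<close> is bounded by \<open>2 ^ ?m\<close>; against
      the factor \<open>(1/4) ^ ?m\<close> a summable \<open>(1/2) ^ ?m\<close> remains.\<close>
    also have "\<dots> \<le> 2 ^ ?m * t powr (1 / p)"
    proof (rule mult_right_mono)
      have "(2 ^ ?m :: real) powr (1 / p) \<le> (2 ^ ?m) powr 1"
        using p_gt_1 by (intro powr_mono) auto
      then show "(2 ^ ?m :: real) powr (1 / p) \<le> 2 ^ ?m" by simp
    qed simp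
    finally have tau: "tau g ?m x powr (1 / p) \<le> 2 ^ ?m * t powr (1 / p)" .
    have "\<bar>approx f (Suc ?m) x - approx f ?m x\<bar> \<le> Kc * (1 / 4) ^ ?m * tau g ?m x powr (1 / p)"
      using approx_step[OF adm x, of ?m] by (simp add: Kc_def)
    also have "\<dots> \<le> Kc * (1 / 4) ^ ?m * (2 ^ ?m * t powr (1 / p))"
      using Kc_pos by (intro mult_left_mono tau) auto
    also have "\<dots> = Kc * t powr (1 / p) * (1 / 2) ^ ?m"
    proof -
      have "(1 / 4 :: real) ^ ?m * 2 ^ ?m = (1 / 2) ^ ?m" by (simp only: power_mult_distrib[symmetric]) simp
      then show ?thesis by (simp add: mult_ac)
    qed
    \<comment> \<open>The gain \<open>(1/2)^k0\<close> is given away here; smallness will come from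
      the integral of \<open>T g k0\<close>.\<close>
    also have "\<dots> \<le> Kc * t powr (1 / p) * (1 / 2) ^ k"
      using Kc_pos by (intro mult_left_mono power_decreasing) auto
    finally show ?thesis .
  qed
  have bound: "\<bar>approx f (k0 + n) x - approx f k0 x\<bar> \<le> Kc * t powr (1 / p) * (2 - 2 * (1 / 2) ^ n)" for n
  proof (induction n)
    case (Suc n)
    have "\<bar>approx f (k0 + Suc n) x - approx f k0 x\<bar>
        \<le> \<bar>approx f (Suc (k0 + n)) x - approx f (k0 + n) x\<bar> + \<bar>approx f (k0 + n) x - approx f k0 x\<bar>" by simp
    also have "\<dots> \<le> Kc * t powr (1 / p) * (1 / 2) ^ n + Kc * t powr (1 / p) * (2 - 2 * (1 / 2) ^ n)"
      by (intro add_mono step Suc)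
    also have "\<dots> = Kc * t powr (1 / p) * (2 - 2 * (1 / 2) ^ Suc n)" by (simp add: algebra_simps)
    finally show ?case .
  qed simp
  have "\<bar>approx f (k0 + n) x - approx f k0 x\<bar> \<le> 2 * Kc * t powr (1 / p)" for n
  proof -
    have "Kc * t powr (1 / p) * (2 - 2 * (1 / 2) ^ n) \<le> Kc * t powr (1 / p) * 2"
      using Kc_pos by (intro mult_left_mono) auto
    with bound[of n] show ?thesis by simp
  qed
  moreover have "(\<lambda>n. \<bar>approx f (k0 + n) x - approx f k0 x\<bar>) \<longlonglongrightarrow> \<bar>f x - approx f k0 x\<bar>"
    using LIMSEQ_ignore_initial_segment[OF lim, of k0] by (intro tendsto_intros) (simp add: add.commute)
  ultimately show ?thesis
    unfolding t_def by (intro LIMSEQ_le_const2[of _ "\<bar>f x - approx f k0 x\<bar>"]) auto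
qed

text \<open>The distance to a point is 1-Lipschitz, so it inherits the gradient of \<open>u\<close>.
  Integrability follows from \<open>d \<le> 1 + d powr p\<close> on a domain of finite measure. The
  extension by 0 makes the function measurable on the whole space, as the Poincare inequality
  demands.\<close>

lemma dist_admissible:
  fixes Y :: "'z metric"
  assumes u: "separably_measurable \<nu> Y u" and g: "upper_gradient \<Omega> Y u g"
    and fin: "(\<integral>\<^sup>+ x. epow (g x) p \<partial>\<nu>) < top" and y: "y \<in> mspace Y"
    and uy: "(\<integral>\<^sup>+ x. ennreal (mdist Y (u x) y powr p) \<partial>\<nu>) < top" and z: "z \<in> mspace Y"
  shows "admissible (\<lambda>x. if x \<in> \<Omega> then mdist Y (u x) z else 0) g"
proof -
  let ?f = "\<lambda>x. if x \<in> \<Omega> then mdist Y (u x) z else 0"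
  have u_in: "u x \<in> mspace Y" if "x \<in> \<Omega>" for x
    using separably_measurableD(1)[OF u] that by (simp add: space_\<nu>)
  have dz[measurable]: "(\<lambda>x. mdist Y (u x) z) \<in> borel_measurable \<nu>" and dy[measurable]: "(\<lambda>x. mdist Y (u x) y) \<in> borel_measurable \<nu>"
    using separably_measurableD(2)[OF u] y z by auto
  have fin_\<nu>: "emeasure \<nu> \<Omega> < top"
    using \<Omega>_fmeasurable by (subst emeasure_restrict_space) (auto simp: space_\<mu> fmeasurable_def)
  have "integrable \<nu> (\<lambda>x. mdist Y (u x) z)"
  proof (rule integrableI_bounded[OF dz])
    have "(\<integral>\<^sup>+ x. ennreal (norm (mdist Y (u x) z)) \<partial>\<nu>)
        \<le> (\<integral>\<^sup>+ x. ennreal (mdist Y (u x) y powr p) + ennreal (1 + mdist Y y z) \<partial>\<nu>)"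
    proof (rule nn_integral_mono)
      fix x assume x: "x \<in> space \<nu>"
      have "mdist Y (u x) z \<le> mdist Y (u x) y + mdist Y y z"
        using u_in x y z by (intro mdist_triangle) (auto simp: space_\<nu>)
      also have "mdist Y (u x) y \<le> 1 + mdist Y (u x) y powr p"
      proof (cases "mdist Y (u x) y \<le> 1")
        case False
        then have "mdist Y (u x) y powr 1 \<le> mdist Y (u x) y powr p"
          using p_gt_1 by (intro powr_mono) auto
        then show ?thesis using False by simp
      qed (simp add: add_increasing2)
      finally have "mdist Y (u x) z \<le> mdist Y (u x) y powr p + (1 + mdist Y y z)" by simp
      from ennreal_leI[OF this]
      show "ennreal (norm (mdist Y (u x) z)) \<le> ennreal (mdist Y (u x) y powr p) + ennreal (1 + mdist Y y z)"
        by (subst (asm) ennreal_plus) auto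
    qed
    also have "\<dots> = (\<integral>\<^sup>+ x. ennreal (mdist Y (u x) y powr p) \<partial>\<nu>) + ennreal (1 + mdist Y y z) * emeasure \<nu> \<Omega>"
      by (subst nn_integral_add) (auto simp: space_\<nu>)
    also have "\<dots> < \<infinity>" using uy fin_\<nu> by (simp add: ennreal_mult_less_top)
    finally show "(\<integral>\<^sup>+ x. ennreal (norm (mdist Y (u x) z)) \<partial>\<nu>) < \<infinity>" .
  qed
  then have int: "set_integrable \<mu> \<Omega> ?f"
  proof -
    have "integrable \<mu> (\<lambda>x. indicat_real \<Omega> x *\<^sub>R mdist Y (u x) z)"
      using \<open>integrable \<nu> (\<lambda>x. mdist Y (u x) z)\<close> by (subst (asm) integrable_restrict_space) (simp_all add: space_\<mu>)
    moreover have "(\<lambda>x. indicat_real \<Omega> x *\<^sub>R mdist Y (u x) z) = (\<lambda>x. indicat_real \<Omega> x *\<^sub>R ?f x)"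
      by (auto simp: indicator_def)
    ultimately show ?thesis unfolding set_integrable_def by simp
  qed
  have "?f \<in> borel_measurable \<mu>"
  proof -
    have "(\<lambda>x. indicat_real \<Omega> x *\<^sub>R mdist Y (u x) z) \<in> borel_measurable \<mu>"
      using dz by (subst (asm) borel_measurable_restrict_space_iff) (auto simp: space_\<mu>)
    moreover have "(\<lambda>x. indicat_real \<Omega> x *\<^sub>R mdist Y (u x) z) = ?f" by (auto simp: indicator_def)
    ultimately show ?thesis by simp
  qed
  moreover have "upper_gradient \<Omega> euclidean_metric ?f g"
    unfolding upper_gradient_def
  proof (intro conjI ballI, goal_cases)
    case 1
    show ?case using g by (simp add: upper_gradient_def)
  next
    case (2 c)
    obtain \<gamma> L where c: "c = (\<gamma>, L)" by force
    with 2 have \<gamma>: "(\<gamma>, L) \<in> curves_in \<Omega>" by simp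
    then have L: "\<gamma> 0 \<in> \<Omega>" "\<gamma> L \<in> \<Omega>" by (auto simp: curves_in_def arclength_curve_def)
    have "mdist Y (u (\<gamma> L)) z \<le> mdist Y (u (\<gamma> L)) (u (\<gamma> 0)) + mdist Y (u (\<gamma> 0)) z"
      "mdist Y (u (\<gamma> 0)) z \<le> mdist Y (u (\<gamma> 0)) (u (\<gamma> L)) + mdist Y (u (\<gamma> L)) z"
      using L u_in z by (auto intro!: mdist_triangle)
    then have "dist (?f (\<gamma> L)) (?f (\<gamma> 0)) \<le> mdist Y (u (\<gamma> L)) (u (\<gamma> 0))"
      using L by (simp add: dist_real_def mdist_commute abs_le_iff)
    then have "ennreal (dist (?f (\<gamma> L)) (?f (\<gamma> 0))) \<le> ennreal (mdist Y (u (\<gamma> L)) (u (\<gamma> 0)))" by (rule ennreal_leI)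
    also have "\<dots> \<le> line_integral g \<gamma> L" using g \<gamma> unfolding upper_gradient_def by blast
    finally show ?case by (simp add: c)
  qed
  ultimately show ?thesis using int fin by (simp add: admissible_def nn_integral_\<nu>)
qed

text \<open>Points of one cell share the means at level \<open>k0\<close> of every function
  \<open>mdist Y (u x) z\<close>, so two tails bound the difference of its values. Countably many
  \<open>z\<close> leave one common null set, and \<open>z\<close> close to \<open>u x'\<close>
  turns the difference into the distance of the values. The bound survives this limit because
  \<open>T\<close> does not involve \<open>z\<close>.\<close>

lemma same_cell_dist_le:
  fixes Y :: "'z metric"
  assumes u: "separably_measurable \<nu> Y u" and g: "upper_gradient \<Omega> Y u g"
    and fin: "(\<integral>\<^sup>+ x. epow (g x) p \<partial>\<nu>) < top" and y: "y \<in> mspace Y"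
    and uy: "(\<integral>\<^sup>+ x. ennreal (mdist Y (u x) y powr p) \<partial>\<nu>) < top"
    and S: "\<And>k. (\<Sum>i<net_n k. P g k i) \<le> S" and S0: "0 \<le> S"
  obtains N where "N \<in> null_sets \<nu>" "\<forall>x\<in>\<Omega> - N. \<forall>x'\<in>\<Omega> - N. cell k0 x = cell k0 x' \<longrightarrow>
    ennreal (mdist Y (u x) (u x') powr p) \<le> ennreal ((4 * Kc) powr p) * (T g k0 x + T g k0 x')"
proof -
  obtain D where D: "countable D" "D \<subseteq> mspace Y" "\<forall>x\<in>space \<nu>. \<forall>e>0. \<exists>z\<in>D. mdist Y (u x) z < e"
    by (rule separably_measurable_dense[OF u])
  let ?f = "\<lambda>z x. if x \<in> \<Omega> then mdist Y (u x) z else 0"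
  have adm: "admissible (?f z) g" if "z \<in> D" for z
    using that D(2) by (intro dist_admissible[OF u g fin y uy]) auto
  have "AE x in \<nu>. \<forall>z\<in>D. (\<lambda>k. approx (?f z) k x) \<longlonglongrightarrow> ?f z x"
    unfolding AE_ball_countable[OF D(1)] by (intro ballI approx_tendsto_AE[OF adm S S0])
  then obtain N where N: "{x \<in> space \<nu>. \<not> (\<forall>z\<in>D. (\<lambda>k. approx (?f z) k x) \<longlonglongrightarrow> ?f z x)} \<subseteq> N"
    "emeasure \<nu> N = 0" "N \<in> sets \<nu>"
    by (rule AE_E)
  have u_in: "u x \<in> mspace Y" if "x \<in> \<Omega>" for x
    using separably_measurableD(1)[OF u] that by (simp add: space_\<nu>)
  have main: "ennreal (mdist Y (u x) (u x') powr p) \<le> ennreal ((4 * Kc) powr p) * (T g k0 x + T g k0 x')"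
    if x: "x \<in> \<Omega> - N" "x' \<in> \<Omega> - N" "cell k0 x = cell k0 x'" for x x'
  proof (cases "T g k0 x = top \<or> T g k0 x' = top")
    case True
    then show ?thesis using Kc_pos by (auto simp: ennreal_mult_top)
  next
    case False
    then have fin': "T g k0 x < top" "T g k0 x' < top" by (auto simp: less_top)
    define t where "t = max (enn2real (T g k0 x)) (enn2real (T g k0 x'))"
    have t0: "0 \<le> t" by (simp add: t_def le_max_iff_disj)
    have tail: "\<bar>?f z w - approx (?f z) k0 w\<bar> \<le> 2 * Kc * t powr (1 / p)"
      if z: "z \<in> D" and w: "w = x \<or> w = x'" for z w
    proof -
      have w': "w \<in> \<Omega>" "T g k0 w < top" "w \<notin> N" "enn2real (T g k0 w) \<le> t" using w x fin' by (auto simp: t_def)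
      have "(\<lambda>k. approx (?f z) k w) \<longlonglongrightarrow> ?f z w"
      proof (rule ccontr)
        assume "\<not> ?thesis"
        then have "w \<in> {x \<in> space \<nu>. \<not> (\<forall>z\<in>D. (\<lambda>k. approx (?f z) k x) \<longlonglongrightarrow> ?f z x)}"
          using w'(1) z unfolding space_\<nu> mem_Collect_eq by blast
        then show False using N(1) w'(3) by blast
      qed
      from approx_tail[OF adm[OF z] w'(1) this w'(2)]
      have "\<bar>?f z w - approx (?f z) k0 w\<bar> \<le> 2 * Kc * enn2real (T g k0 w) powr (1 / p)" .
      also have "\<dots> \<le> 2 * Kc * t powr (1 / p)"
        using Kc_pos p_gt_1 w'(4) by (intro mult_left_mono powr_mono2) auto
      finally show ?thesis .
    qed
    have close: "mdist Y (u x) z \<le> mdist Y (u x') z + 4 * Kc * t powr (1 / p)" if z: "z \<in> D" for z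
    proof -
      have "approx (?f z) k0 x = approx (?f z) k0 x'" using x(3) by (simp add: approx_def center_def)
      then show ?thesis using tail[OF z, of x] tail[OF z, of x'] x by (simp add: abs_le_iff)
    qed
    have "mdist Y (u x) (u x') \<le> 4 * Kc * t powr (1 / p) + e" if e: "0 < e" for e
    proof -
      obtain z where z: "z \<in> D" "mdist Y (u x') z < e / 2"
        using D(3) x e by (metis DiffD1 half_gt_zero space_\<nu>)
      have "mdist Y (u x) (u x') \<le> mdist Y (u x) z + mdist Y z (u x')"
        using x u_in D(2) z(1) by (intro mdist_triangle) auto
      then show ?thesis using close[OF z(1)] z(2) by (simp add: mdist_commute)
    qed
    then have "mdist Y (u x) (u x') \<le> 4 * Kc * t powr (1 / p)" by (rule field_le_epsilon)
    then have "mdist Y (u x) (u x') powr p \<le> (4 * Kc * t powr (1 / p)) powr p"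
      using p_gt_1 by (intro powr_mono2) auto
    also have "\<dots> = (4 * Kc) powr p * t"
      using p_gt_1 t0 by (subst powr_mult) (simp add: powr_powr)
    also have "\<dots> \<le> (4 * Kc) powr p * (enn2real (T g k0 x) + enn2real (T g k0 x'))"
      unfolding t_def by (intro mult_left_mono) auto
    finally have "ennreal (mdist Y (u x) (u x') powr p) \<le> ennreal ((4 * Kc) powr p * (enn2real (T g k0 x) + enn2real (T g k0 x')))"
      by (rule ennreal_leI)
    also have "\<dots> = ennreal ((4 * Kc) powr p) * (T g k0 x + T g k0 x')"
      using fin' by (simp add: ennreal_mult ennreal_plus)
    finally show ?thesis .
  qed
  show thesis
  proof (rule that[of N])
    show "N \<in> null_sets \<nu>" using N(2,3) by (rule null_setsI)
  qed (intro ballI impI main)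
qed

end

section \<open>Approximation by maps constant on cells\<close>

lemma exists_le_twice_average:
  assumes f: "f \<in> borel_measurable M" and A: "A \<in> sets M" "0 < emeasure M A" "emeasure M A < top"
    and N: "N \<in> null_sets M" and pos: "\<And>x. x \<in> A \<Longrightarrow> 0 < f x"
  shows "\<exists>x\<in>A - N. f x * emeasure M A \<le> 2 * (\<integral>\<^sup>+ x\<in>A. f x \<partial>M)"
proof (rule ccontr)
  assume no: "\<not> ?thesis"
  note [measurable] = f A(1)
  let ?I = "\<integral>\<^sup>+ x\<in>A. f x \<partial>M"
  have gt: "2 * ?I < f x * emeasure M A" if "x \<in> A - N" for x using no that by (auto simp: not_le)
  \<comment> \<open>The contradiction \<open>2 * ?I \<le> ?I\<close> needs an integral that is
    neither 0 nor infinite. Positivity of \<open>f\<close> on a set of positive measure excludes 0;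
    the strict inequality \<open>gt\<close> at one point excludes infinity.\<close>
  have I_pos: "0 < ?I"
  proof (rule ccontr)
    assume "\<not> 0 < ?I"
    then have "AE x in M. f x * indicator A x = 0"
      by (subst nn_integral_0_iff_AE[symmetric]) auto
    then have "AE x in M. x \<notin> A"
    proof (rule eventually_mono)
      fix x assume "f x * indicator A x = 0"
      then show "x \<notin> A" using pos[of x] by (cases "x \<in> A") auto
    qed
    then have "emeasure M A = 0"
      using AE_iff_measurable[of A M "\<lambda>x. x \<notin> A"] A(1) sets.sets_into_space[OF A(1)] by auto
    then show False using A(2) by simp
  qed
  have "A - N \<noteq> {}"
  proof
    assume "A - N = {}"
    then have "emeasure M A \<le> emeasure M N" using N by (intro emeasure_mono) auto
    then show False using A N by (simp add: null_sets_def)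
  qed
  then obtain x0 where "2 * ?I < f x0 * emeasure M A" using gt by blast
  then have I_fin: "?I < top" by (cases "?I") (auto simp: ennreal_mult_top)
  have "(2 * ?I) * emeasure M A = (\<integral>\<^sup>+ x\<in>A. 2 * ?I \<partial>M)"
    by (rule nn_integral_cmult_indicator[symmetric]) (rule A)
  also have "\<dots> \<le> (\<integral>\<^sup>+ x. emeasure M A * (f x * indicator A x) \<partial>M)"
  proof (rule nn_integral_mono_AE, rule AE_mp[OF AE_not_in[OF N]], intro AE_I2 impI)
    fix x assume "x \<notin> N"
    then show "2 * ?I * indicator A x \<le> emeasure M A * (f x * indicator A x)"
      using gt[of x] by (cases "x \<in> A") (auto simp: mult.commute less_imp_le)
  qed
  also have "\<dots> = ?I * emeasure M A" by (subst nn_integral_cmult) (auto simp: mult.commute)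
  finally have le: "(2 * ?I) * emeasure M A \<le> ?I * emeasure M A" .
  obtain i where i: "0 < i" "?I = ennreal i" using I_pos I_fin by (cases ?I) auto
  obtain m where m: "0 < m" "emeasure M A = ennreal m" using A by (cases "emeasure M A") auto
  have "ennreal (2 * i * m) \<le> ennreal (i * m)"
    using le i m by (simp add: ennreal_mult)
  then show False using i m by (simp add: ennreal_le_iff)
qed

context poincare_domain
begin

definition cell_set :: "nat \<Rightarrow> nat \<Rightarrow> 'x set" where "cell_set k i = {x \<in> \<Omega>. cell k x = i}"

lemma cell_set_sets [measurable]: "cell_set k i \<in> sets \<nu>"
proof -
  have "cell_set k i = \<Omega> \<inter> {x \<in> \<Omega>. cell k x = i}" by (auto simp: cell_set_def)
  then show ?thesis unfolding sets_restrict_space sets_\<mu> by (rule image_eqI) (rule cell_sets)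
qed

lemma nn_integral_cell_sets:
  assumes [measurable]: "F \<in> borel_measurable \<nu>"
  shows "(\<integral>\<^sup>+ x. F x \<partial>\<nu>) = (\<Sum>i<net_n k. \<integral>\<^sup>+ x\<in>cell_set k i. F x \<partial>\<nu>)"
proof -
  have "(\<integral>\<^sup>+ x. F x \<partial>\<nu>) = (\<integral>\<^sup>+ x. (\<Sum>i<net_n k. F x * indicator (cell_set k i) x) \<partial>\<nu>)"
  proof (rule nn_integral_cong)
    fix x assume "x \<in> space \<nu>"
    then have x: "x \<in> \<Omega>" by (simp add: space_\<nu>)
    have "(\<Sum>i<net_n k. F x * indicator (cell_set k i) x) = (\<Sum>i<net_n k. if i = cell k x then F x else 0)"
      using x by (intro sum.cong) (auto simp: cell_set_def indicator_def)
    also have "\<dots> = F x" using cell(1)[OF x, of k] by simp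
    finally show "F x = (\<Sum>i<net_n k. F x * indicator (cell_set k i) x)" by simp
  qed
  also have "\<dots> = (\<Sum>i<net_n k. \<integral>\<^sup>+ x\<in>cell_set k i. F x \<partial>\<nu>)"
    by (rule nn_integral_sum) measurable
  finally show ?thesis .
qed

lemma emeasure_cell_set_finite: "emeasure \<nu> (cell_set k i) < top"
proof -
  have "emeasure \<nu> (cell_set k i) \<le> emeasure \<nu> (space \<nu>)" by (rule emeasure_space)
  also have "\<dots> < top"
    using \<Omega>_fmeasurable unfolding space_\<nu> by (subst emeasure_restrict_space) (auto simp: space_\<mu> fmeasurable_def)
  finally show ?thesis .
qed

text \<open>On a cell of positive measure the value is \<open>u x0\<close> at a point
  \<open>x0\<close> outside the null set where \<open>T\<close> is at most twice its mean, so the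
  cell contributes at most three times the integral of \<open>T\<close>; the other factor 2 in 6
  comes from \<open>nn_integral_T_le\<close>. Null cells receive the value \<open>y\<close>, which
  keeps all values near \<open>y\<close>.\<close>

lemma cell_approximation:
  fixes Y :: "'z metric"
  assumes u: "separably_measurable \<nu> Y u" and g: "upper_gradient \<Omega> Y u g"
    and fin: "(\<integral>\<^sup>+ x. epow (g x) p \<partial>\<nu>) < top" and y: "y \<in> mspace Y"
    and uy: "(\<integral>\<^sup>+ x. ennreal (mdist Y (u x) y powr p) \<partial>\<nu>) < top"
    and S: "\<And>k. (\<Sum>i<net_n k. P g k i) \<le> S" and S0: "0 \<le> S"
  obtains w where "\<forall>i. w i \<in> mspace Y" "\<forall>i. emeasure \<nu> (cell_set k0 i) = 0 \<longrightarrow> w i = y"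
    "(\<integral>\<^sup>+ x. ennreal (mdist Y (u x) (w (cell k0 x)) powr p) \<partial>\<nu>)
      \<le> ennreal (6 * (4 * Kc) powr p * S * (1 / 2) ^ k0)"
proof -
  let ?K = "ennreal ((4 * Kc) powr p)"
  obtain N where N: "N \<in> null_sets \<nu>" "\<forall>x\<in>\<Omega> - N. \<forall>x'\<in>\<Omega> - N. cell k0 x = cell k0 x' \<longrightarrow>
    ennreal (mdist Y (u x) (u x') powr p) \<le> ?K * (T g k0 x + T g k0 x')"
    by (rule same_cell_dist_le[OF u g fin y uy S S0])
  note [measurable] = T_measurable[of g k0]
  have u_in: "u x \<in> mspace Y" if "x \<in> \<Omega>" for x
    using separably_measurableD(1)[OF u] that by (simp add: space_\<nu>)
  have "\<forall>i. \<exists>z. z \<in> mspace Y \<and> (emeasure \<nu> (cell_set k0 i) = 0 \<longrightarrow> z = y) \<and>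
    (\<integral>\<^sup>+ x\<in>cell_set k0 i. ennreal (mdist Y (u x) z powr p) \<partial>\<nu>) \<le> 3 * ?K * (\<integral>\<^sup>+ x\<in>cell_set k0 i. T g k0 x \<partial>\<nu>)"
  proof
    fix i
    let ?C = "cell_set k0 i"
    let ?I = "\<integral>\<^sup>+ x\<in>?C. T g k0 x \<partial>\<nu>"
    show "\<exists>z. z \<in> mspace Y \<and> (emeasure \<nu> ?C = 0 \<longrightarrow> z = y) \<and>
      (\<integral>\<^sup>+ x\<in>?C. ennreal (mdist Y (u x) z powr p) \<partial>\<nu>) \<le> 3 * ?K * ?I"
    proof (cases "emeasure \<nu> ?C = 0")
      case True
      then have "?C \<in> null_sets \<nu>" by (intro null_setsI cell_set_sets)
      then have "(\<integral>\<^sup>+ x\<in>?C. ennreal (mdist Y (u x) y powr p) \<partial>\<nu>) = 0"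
        by (rule nn_integral_null_set)
      then show ?thesis using y by (intro exI[of _ y]) simp
    next
      case False
      then have pos: "0 < emeasure \<nu> ?C" by (simp add: zero_less_iff_neq_zero)
      obtain x0 where x0: "x0 \<in> ?C - N" "T g k0 x0 * emeasure \<nu> ?C \<le> 2 * ?I"
        using exists_le_twice_average[OF T_measurable cell_set_sets pos emeasure_cell_set_finite N(1) T_pos] by blast
      have x0\<Omega>: "x0 \<in> \<Omega> - N" "cell k0 x0 = i" using x0(1) by (auto simp: cell_set_def)
      have "(\<integral>\<^sup>+ x\<in>?C. ennreal (mdist Y (u x) (u x0) powr p) \<partial>\<nu>)
          \<le> (\<integral>\<^sup>+ x. ?K * (T g k0 x * indicator ?C x + T g k0 x0 * indicator ?C x) \<partial>\<nu>)"
      proof (rule nn_integral_mono_AE, rule AE_mp[OF AE_not_in[OF N(1)]], intro AE_I2 impI)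
        fix x assume "x \<notin> N"
        show "ennreal (mdist Y (u x) (u x0) powr p) * indicator ?C x
            \<le> ?K * (T g k0 x * indicator ?C x + T g k0 x0 * indicator ?C x)"
        proof (cases "x \<in> ?C")
          case True
          then have "x \<in> \<Omega> - N" "cell k0 x = cell k0 x0"
            using \<open>x \<notin> N\<close> x0\<Omega> by (auto simp: cell_set_def)
          then show ?thesis using N(2) x0\<Omega>(1) True by simp
        qed simp
      qed
      also have "\<dots> = ?K * (?I + T g k0 x0 * emeasure \<nu> ?C)"
        by (simp add: nn_integral_cmult nn_integral_add nn_integral_cmult_indicator)
      also have "\<dots> \<le> ?K * (?I + 2 * ?I)"
        by (intro mult_left_mono add_left_mono x0(2)) simp
      also have "?I + 2 * ?I = 3 * ?I"
      proof -
        have "3 * ?I = (1 + 2) * ?I" by simp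
        also have "\<dots> = ?I + 2 * ?I" unfolding distrib_right by simp
        finally show ?thesis by simp
      qed
      finally show ?thesis using False u_in[of x0] x0\<Omega>(1) by (intro exI[of _ "u x0"]) (simp add: mult_ac)
    qed
  qed
  from choice[OF this] obtain w where w: "\<forall>i. w i \<in> mspace Y \<and> (emeasure \<nu> (cell_set k0 i) = 0 \<longrightarrow> w i = y) \<and>
    (\<integral>\<^sup>+ x\<in>cell_set k0 i. ennreal (mdist Y (u x) (w i) powr p) \<partial>\<nu>) \<le> 3 * ?K * (\<integral>\<^sup>+ x\<in>cell_set k0 i. T g k0 x \<partial>\<nu>)" ..
  have meas: "(\<lambda>x. ennreal (mdist Y (u x) (w (cell k0 x)) powr p)) \<in> borel_measurable \<nu>"
  proof -
    have "(\<lambda>x. (\<lambda>i x. ennreal (mdist Y (u x) (w i) powr p)) (cell k0 x) x) \<in> borel_measurable \<nu>"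
    proof (rule measurable_compose_countable[OF _ cell_measurable])
      fix i
      have [measurable]: "(\<lambda>x. mdist Y (u x) (w i)) \<in> borel_measurable \<nu>"
        using separably_measurableD(2)[OF u] w by blast
      show "(\<lambda>x. ennreal (mdist Y (u x) (w i) powr p)) \<in> borel_measurable \<nu>" by measurable
    qed
    then show ?thesis by simp
  qed
  have "(\<integral>\<^sup>+ x. ennreal (mdist Y (u x) (w (cell k0 x)) powr p) \<partial>\<nu>)
      = (\<Sum>i<net_n k0. \<integral>\<^sup>+ x\<in>cell_set k0 i. ennreal (mdist Y (u x) (w (cell k0 x)) powr p) \<partial>\<nu>)"
    by (rule nn_integral_cell_sets[OF meas])
  also have "\<dots> \<le> (\<Sum>i<net_n k0. 3 * ?K * (\<integral>\<^sup>+ x\<in>cell_set k0 i. T g k0 x \<partial>\<nu>))"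
  proof (rule sum_mono)
    fix i
    have "(\<integral>\<^sup>+ x\<in>cell_set k0 i. ennreal (mdist Y (u x) (w (cell k0 x)) powr p) \<partial>\<nu>)
        = (\<integral>\<^sup>+ x\<in>cell_set k0 i. ennreal (mdist Y (u x) (w i) powr p) \<partial>\<nu>)"
      by (rule nn_integral_cong) (auto simp: cell_set_def indicator_def)
    then show "(\<integral>\<^sup>+ x\<in>cell_set k0 i. ennreal (mdist Y (u x) (w (cell k0 x)) powr p) \<partial>\<nu>)
        \<le> 3 * ?K * (\<integral>\<^sup>+ x\<in>cell_set k0 i. T g k0 x \<partial>\<nu>)" using w by simp
  qed
  also have "\<dots> = 3 * ?K * (\<integral>\<^sup>+ x. T g k0 x \<partial>\<nu>)"
    by (simp add: sum_distrib_left[symmetric] nn_integral_cell_sets[OF T_measurable, of g k0 k0])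
  also have "\<dots> \<le> 3 * ?K * ennreal (2 * S * (1 / 2) ^ k0)"
    by (intro mult_left_mono nn_integral_T_le S S0) simp
  also have "\<dots> = ennreal 3 * ?K * ennreal (2 * S * (1 / 2) ^ k0)" by simp
  also have "\<dots> = ennreal (6 * (4 * Kc) powr p * S * (1 / 2) ^ k0)"
    using S0 by (simp only: ennreal_mult[symmetric] powr_ge_zero zero_le_numeral zero_le_mult_iff zero_le_power
        zero_le_divide_iff zero_le_one simp_thms disj_imp not_le) (simp add: mult_ac)
  finally show thesis using that[of w] w by blast
qed

text \<open>The order of the quantifiers is essential: the cells and the radius \<open>R\<close> are
  fixed before \<open>Y\<close>, \<open>u\<close>, \<open>g\<close> and \<open>y\<close>. Hence the
  values of different maps can be matched cell by cell, and their mutual distances stay bounded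
  along a sequence of maps.\<close>

lemma sobolev_discretization:
  assumes B: "0 \<le> B" and \<epsilon>: "0 < \<epsilon>"
  obtains n \<iota> R where "\<forall>x\<in>\<Omega>. \<iota> x < (n::nat)" "\<iota> \<in> measurable \<nu> (count_space UNIV)"
    "\<forall>(Y::'z metric) u g y. separably_measurable \<nu> Y u \<longrightarrow> upper_gradient \<Omega> Y u g \<longrightarrow>
      (\<integral>\<^sup>+ x. epow (g x) p \<partial>\<nu>) \<le> ennreal B \<longrightarrow> y \<in> mspace Y \<longrightarrow>
      (\<integral>\<^sup>+ x. ennreal (mdist Y (u x) y powr p) \<partial>\<nu>) \<le> ennreal B \<longrightarrow>
      (\<exists>w. (\<forall>i. w i \<in> mspace Y \<and> mdist Y (w i) y \<le> R) \<and>
        (\<integral>\<^sup>+ x. ennreal (mdist Y (u x) (w (\<iota> x)) powr p) \<partial>\<nu>) \<le> ennreal \<epsilon>)"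
proof -
  obtain M where M: "0 \<le> M" "\<forall>k g B. g \<in> borel_measurable borel \<longrightarrow> 0 \<le> B \<longrightarrow>
    (\<integral>\<^sup>+ y\<in>\<Omega>. epow (g y) p \<partial>\<mu>) \<le> ennreal B \<longrightarrow> (\<Sum>i<net_n k. P g k i) \<le> M * (measure \<mu> \<Omega> + B)"
    by (rule sum_P_bound)
  define S where "S = M * (measure \<mu> \<Omega> + B)"
  have S0: "0 \<le> S" using M(1) B by (simp add: S_def)
  define A where "A = 6 * (4 * Kc) powr p * S"
  have A0: "0 \<le> A" using S0 by (simp add: A_def)
  obtain k where k: "(1 / 2 :: real) ^ k < \<epsilon> / (A + 1)"
    using real_arch_pow_inv[of "\<epsilon> / (A + 1)" "1 / 2"] \<epsilon> A0 by auto
  have Ak: "A * (1 / 2) ^ k \<le> \<epsilon>"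
  proof -
    have "A * (1 / 2) ^ k \<le> (A + 1) * (1 / 2) ^ k" by (intro mult_right_mono) auto
    also have "\<dots> \<le> (A + 1) * (\<epsilon> / (A + 1))" using k A0 by (intro mult_left_mono) auto
    finally show ?thesis using A0 by simp
  qed
  define m where "m i = measure \<nu> (cell_set k i)" for i
  have m: "emeasure \<nu> (cell_set k i) = ennreal (m i)" for i
    unfolding m_def using emeasure_cell_set_finite[of k i] by (intro emeasure_eq_ennreal_measure) auto
  \<comment> \<open>Obtained by integrating \<open>mdist Y (w i) y powr p\<close> over a cell of
    measure \<open>m i\<close>, with the two integrals bounded by \<epsilon> and \<open>B\<close>.
    For a null cell division by zero gives 0, in accordance with \<open>w i = y\<close>.\<close>
  define \<rho> where "\<rho> i = (2 powr p * (\<epsilon> + B) / m i) powr (1 / p)" for i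
  define R where "R = (\<Sum>i<net_n k. \<rho> i)"
  have \<rho>_le: "\<rho> i \<le> R" if "i < net_n k" for i
    unfolding R_def using that by (intro member_le_sum) (auto simp: \<rho>_def)
  have R0: "0 \<le> R" unfolding R_def by (intro sum_nonneg) (simp add: \<rho>_def)
  have "\<exists>w. (\<forall>i. w i \<in> mspace Y \<and> mdist Y (w i) y \<le> R) \<and>
        (\<integral>\<^sup>+ x. ennreal (mdist Y (u x) (w (cell k x)) powr p) \<partial>\<nu>) \<le> ennreal \<epsilon>"
    if u: "separably_measurable \<nu> Y u" and g: "upper_gradient \<Omega> Y u g"
      and gB: "(\<integral>\<^sup>+ x. epow (g x) p \<partial>\<nu>) \<le> ennreal B" and y: "y \<in> mspace Y"
      and uy: "(\<integral>\<^sup>+ x. ennreal (mdist Y (u x) y powr p) \<partial>\<nu>) \<le> ennreal B"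
    for Y :: "'z metric" and u g y
  proof -
    have g_borel: "g \<in> borel_measurable borel" using g by (simp add: upper_gradient_def)
    have PS: "(\<Sum>i<net_n j. P g j i) \<le> S" for j
      using M(2) g_borel B gB unfolding S_def nn_integral_\<nu> by simp
    have fin: "(\<integral>\<^sup>+ x. epow (g x) p \<partial>\<nu>) < top" "(\<integral>\<^sup>+ x. ennreal (mdist Y (u x) y powr p) \<partial>\<nu>) < top"
      using gB uy by (auto intro: le_less_trans)
    obtain w where w: "\<forall>i. w i \<in> mspace Y" "\<forall>i. emeasure \<nu> (cell_set k i) = 0 \<longrightarrow> w i = y"
      "(\<integral>\<^sup>+ x. ennreal (mdist Y (u x) (w (cell k x)) powr p) \<partial>\<nu>) \<le> ennreal (6 * (4 * Kc) powr p * S * (1 / 2) ^ k)"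
      by (rule cell_approximation[OF u g fin(1) y fin(2) PS S0])
    have close: "(\<integral>\<^sup>+ x. ennreal (mdist Y (u x) (w (cell k x)) powr p) \<partial>\<nu>) \<le> ennreal \<epsilon>"
      using w(3) ennreal_leI[OF Ak] unfolding A_def by (rule order_trans)
    have u_in: "u x \<in> mspace Y" if "x \<in> \<Omega>" for x
      using separably_measurableD(1)[OF u] that by (simp add: space_\<nu>)
    have "mdist Y (w i) y \<le> R" for i
    proof (cases "emeasure \<nu> (cell_set k i) = 0")
      case True
      then show ?thesis using w(2) y R0 by (simp add: mdist_self)
    next
      case False
      then have mi: "0 < m i" unfolding m by (simp add: m_def zero_less_measure_iff measure_nonneg less_le)
      then have "cell_set k i \<noteq> {}" by (auto simp: m_def)
      then have i: "i < net_n k" using cell(1) by (auto simp: cell_set_def)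
      have [measurable]: "(\<lambda>x. mdist Y (u x) (w i)) \<in> borel_measurable \<nu>" "(\<lambda>x. mdist Y (u x) y) \<in> borel_measurable \<nu>"
        using separably_measurableD(2)[OF u] w(1) y by auto
      have "ennreal (mdist Y (w i) y powr p * m i) = (\<integral>\<^sup>+ x\<in>cell_set k i. ennreal (mdist Y (w i) y powr p) \<partial>\<nu>)"
        using mi by (simp add: nn_integral_cmult_indicator m ennreal_mult)
      also have "\<dots> \<le> (\<integral>\<^sup>+ x. ennreal (2 powr p) * (ennreal (mdist Y (u x) (w i) powr p) * indicator (cell_set k i) x
          + ennreal (mdist Y (u x) y powr p)) \<partial>\<nu>)"
      proof (rule nn_integral_mono)
        fix x assume x: "x \<in> space \<nu>"
        have "ennreal (mdist Y (w i) y powr p)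
            \<le> ennreal (2 powr p) * (ennreal (mdist Y (u x) (w i) powr p) + ennreal (mdist Y (u x) y powr p))"
        proof -
          have "mdist Y (w i) y \<le> mdist Y (w i) (u x) + mdist Y (u x) y"
            using x u_in w(1) y by (intro mdist_triangle) (auto simp: space_\<nu>)
          then have "ennreal (mdist Y (w i) y) \<le> ennreal (mdist Y (u x) (w i) + mdist Y (u x) y)"
            by (intro ennreal_leI) (simp add: mdist_commute[of Y "w i" "u x"])
          then have "ennreal (mdist Y (w i) y) \<le> ennreal (mdist Y (u x) (w i)) + ennreal (mdist Y (u x) y)"
            by (simp add: ennreal_plus)
          then have "epow (ennreal (mdist Y (w i) y)) p \<le> epow (ennreal (mdist Y (u x) (w i)) + ennreal (mdist Y (u x) y)) p"
            using p_gt_1 by (intro epow_mono) auto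
          also have "\<dots> \<le> ennreal (2 powr p) * (epow (ennreal (mdist Y (u x) (w i))) p + epow (ennreal (mdist Y (u x) y)) p)"
            using p_gt_1 by (intro epow_add_le) auto
          finally show ?thesis by (simp add: epow_ennreal)
        qed
        then show "ennreal (mdist Y (w i) y powr p) * indicator (cell_set k i) x
            \<le> ennreal (2 powr p) * (ennreal (mdist Y (u x) (w i) powr p) * indicator (cell_set k i) x
          + ennreal (mdist Y (u x) y powr p))"
          by (cases "x \<in> cell_set k i") auto
      qed
      also have "\<dots> = ennreal (2 powr p) * ((\<integral>\<^sup>+ x\<in>cell_set k i. ennreal (mdist Y (u x) (w i) powr p) \<partial>\<nu>)
          + (\<integral>\<^sup>+ x. ennreal (mdist Y (u x) y powr p) \<partial>\<nu>))"
        by (simp add: nn_integral_cmult nn_integral_add)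
      also have "\<dots> \<le> ennreal (2 powr p) * (ennreal \<epsilon> + ennreal B)"
      proof (intro mult_left_mono add_mono uy)
        have "(\<integral>\<^sup>+ x\<in>cell_set k i. ennreal (mdist Y (u x) (w i) powr p) \<partial>\<nu>)
            \<le> (\<integral>\<^sup>+ x. ennreal (mdist Y (u x) (w (cell k x)) powr p) \<partial>\<nu>)"
          by (rule nn_integral_mono) (auto simp: cell_set_def indicator_def)
        then show "(\<integral>\<^sup>+ x\<in>cell_set k i. ennreal (mdist Y (u x) (w i) powr p) \<partial>\<nu>) \<le> ennreal \<epsilon>"
          using close by (rule order_trans)
      qed simp
      also have "\<dots> = ennreal (2 powr p * (\<epsilon> + B))" using \<epsilon> B by (simp add: ennreal_mult)
      finally have "mdist Y (w i) y powr p * m i \<le> 2 powr p * (\<epsilon> + B)" using \<epsilon> B by (simp add: ennreal_le_iff)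
      then have "mdist Y (w i) y powr p \<le> 2 powr p * (\<epsilon> + B) / m i" using mi by (simp add: pos_le_divide_eq)
      then have "(mdist Y (w i) y powr p) powr (1 / p) \<le> \<rho> i"
        unfolding \<rho>_def using p_gt_1 by (intro powr_mono2) auto
      then have "mdist Y (w i) y \<le> \<rho> i" using p_gt_1 by (simp add: powr_powr)
      then show ?thesis using \<rho>_le[OF i] by simp
    qed
    then show ?thesis using w(1) close by (intro exI[of _ w]) blast
  qed
  note main = this
  show thesis
    by (rule that[of "cell k" "net_n k" R]) (use cell(1) cell_measurable main in \<open>blast+\<close>)
qed

end

subsection \<open>Uniform convexity of powers\<close>

text \<open>Both sides agree at \<open>t = 1\<close>, and the defect strictly decreases up to there:
  its derivative compares \<open>x powr (p - 1)\<close> with the same power of the larger number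
  \<open>(1 + x) / 2\<close>.\<close>

lemma powr_midpoint_defect_pos:
  fixes p t :: real
  assumes p: "1 < p" and t: "0 \<le> t" "t < 1"
  shows "((1 + t) / 2) powr p < (1 + t powr p) / 2"
proof -
  let ?\<phi> = "\<lambda>t. (1 + t powr p) / 2 - ((1 + t) / 2) powr p"
  have "?\<phi> 1 < ?\<phi> t"
  proof (rule DERIV_neg_imp_decreasing_open[OF t(2)])
    fix x assume x: "t < x" "x < 1"
    have "(?\<phi> has_real_derivative (p * x powr (p - 1)) / 2 - p * ((1 + x) / 2) powr (p - 1) * (1 / 2)) (at x)"
      using x t by (auto intro!: derivative_eq_intros)
    moreover have "x powr (p - 1) < ((1 + x) / 2) powr (p - 1)"
      using x t p by (intro powr_less_mono2) auto
    then have "(p * x powr (p - 1)) / 2 - p * ((1 + x) / 2) powr (p - 1) * (1 / 2) < 0"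
      using p by simp
    ultimately show "\<exists>y. (?\<phi> has_real_derivative y) (at x) \<and> y < 0" by blast
  next
    show "continuous_on {t..1} ?\<phi>"
      using t p by (intro continuous_intros continuous_on_powr') auto
  qed
  then show ?thesis by simp
qed

lemma powr_midpoint_le:
  fixes p a b :: real
  assumes p: "1 < p" and "0 \<le> a" "0 \<le> b"
  shows "((a + b) / 2) powr p \<le> (a powr p + b powr p) / 2"
proof -
  have *: "((a + b) / 2) powr p \<le> (a powr p + b powr p) / 2" if ab: "0 \<le> a" "a \<le> b" for a b
  proof (cases "a = b")
    case False
    then have b: "0 < b" using ab by simp
    have "((1 + a / b) / 2) powr p \<le> (1 + (a / b) powr p) / 2"
      using powr_midpoint_defect_pos[OF p, of "a / b"] b ab False by (simp add: less_imp_le)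
    then have "b powr p * ((1 + a / b) / 2) powr p \<le> b powr p * ((1 + (a / b) powr p) / 2)"
      by (intro mult_left_mono) auto
    also have "b powr p * ((1 + a / b) / 2) powr p = (b * ((1 + a / b) / 2)) powr p"
      by (rule powr_mult[symmetric])
    also have "b * ((1 + a / b) / 2) = (a + b) / 2" using b by (simp add: field_simps)
    also have "b powr p * ((1 + (a / b) powr p) / 2) = (a powr p + b powr p) / 2"
      using b ab by (simp add: powr_divide field_simps)
    finally show ?thesis .
  qed simp
  show ?thesis
    using *[of a b] *[of b a] assms by (cases "a \<le> b") (auto simp: add.commute)
qed

text \<open>By homogeneity only the ratio \<open>t\<close> of the numbers matters. If
  \<open>t\<close> is near 1 the difference is paid for by \<eta>; otherwise the midpoint defect is
  bounded below on a compact interval and a multiple \<open>C\<close> of it pays. This form covers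
  all \<open>p > 1\<close> at once, and with the midpoint term on the left it can be integrated
  without subtraction.\<close>

lemma powr_uniform_convexity:
  fixes p \<eta> :: real
  assumes p: "1 < p" and \<eta>: "0 < \<eta>"
  obtains C where "0 \<le> C"
    "\<forall>a b. 0 \<le> a \<and> a \<le> b \<longrightarrow>
       (b - a) powr p + C * ((a + b) / 2) powr p \<le> (\<eta> + C / 2) * (a powr p + b powr p)"
proof -
  define \<kappa> where "\<kappa> = \<eta> powr (1 / p)"
  have \<kappa>: "0 < \<kappa>" "\<kappa> powr p = \<eta>" using p \<eta> by (auto simp: \<kappa>_def powr_powr)
  let ?\<phi> = "\<lambda>t. (1 + t powr p) / 2 - ((1 + t) / 2) powr p"
  have \<phi>_pos: "0 < ?\<phi> t" if "0 \<le> t" "t < 1" for t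
    using powr_midpoint_defect_pos[OF p that] by simp
  have \<phi>_nonneg: "0 \<le> ?\<phi> t" if "0 \<le> t" "t \<le> 1" for t
    using \<phi>_pos[of t] that by (cases "t = 1") auto
  obtain C where C: "0 \<le> C" "\<And>t. 0 \<le> t \<Longrightarrow> t \<le> 1 - \<kappa> \<Longrightarrow> 1 \<le> C * ?\<phi> t"
  proof (cases "0 \<le> 1 - \<kappa>")
    case True
    have "\<exists>x\<in>{0..1 - \<kappa>}. \<forall>y\<in>{0..1 - \<kappa>}. ?\<phi> x \<le> ?\<phi> y"
      using p True by (intro continuous_attains_inf continuous_intros continuous_on_powr') auto
    then obtain x where x: "0 \<le> x" "x \<le> 1 - \<kappa>" "\<And>y. 0 \<le> y \<Longrightarrow> y \<le> 1 - \<kappa> \<Longrightarrow> ?\<phi> x \<le> ?\<phi> y" by auto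
    have pos: "0 < ?\<phi> x" using \<phi>_pos[of x] x \<kappa> by simp
    show ?thesis
    proof (rule that[of "1 / ?\<phi> x"])
      show "0 \<le> 1 / ?\<phi> x" using pos by simp
      show "1 \<le> 1 / ?\<phi> x * ?\<phi> t" if "0 \<le> t" "t \<le> 1 - \<kappa>" for t
        using x(3)[OF that] pos by simp
    qed
  \<comment> \<open>For \<kappa> above 1 the range of \<open>t\<close> is empty, and
    \<open>C = 0\<close> will do.\<close>
  qed (rule that[of 0], auto)
  have unit: "(1 - t) powr p + C * ((1 + t) / 2) powr p \<le> (\<eta> + C / 2) * (1 + t powr p)"
    if t: "0 \<le> t" "t \<le> 1" for t
  proof -
    have "(1 - t) powr p \<le> \<eta> + C * ?\<phi> t"
    proof (cases "t \<le> 1 - \<kappa>")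
      case True
      have "(1 - t) powr p \<le> 1" using t p by (simp add: powr_le1)
      then show ?thesis using C(2)[OF t(1) True] \<eta> by simp
    next
      case False
      then have "(1 - t) powr p \<le> \<kappa> powr p" using t p by (intro powr_mono2) auto
      then show ?thesis using \<kappa> C(1) \<phi>_nonneg[OF t] by (simp add: add_increasing2)
    qed
    moreover have "\<eta> \<le> \<eta> * (1 + t powr p)" using \<eta> by simp
    ultimately show ?thesis by (simp add: algebra_simps add_divide_distrib)
  qed
  have "(b - a) powr p + C * ((a + b) / 2) powr p \<le> (\<eta> + C / 2) * (a powr p + b powr p)"
    if ab: "0 \<le> a" "a \<le> b" for a b
  proof (cases "b = 0")
    case False
    then have b: "0 < b" using ab by simp
    let ?t = "a / b"
    have "b powr p * ((1 - ?t) powr p + C * ((1 + ?t) / 2) powr p)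
        \<le> b powr p * ((\<eta> + C / 2) * (1 + ?t powr p))"
      using unit[of ?t] ab b by (intro mult_left_mono) auto
    moreover have "b * (1 - ?t) = b - a" "b * ((1 + ?t) / 2) = (a + b) / 2" "b * ?t = a"
      using b by (simp_all add: right_diff_distrib distrib_left add_divide_distrib)
    then have "b powr p * (1 - ?t) powr p = (b - a) powr p"
      "b powr p * ((1 + ?t) / 2) powr p = ((a + b) / 2) powr p"
      "b powr p * ?t powr p = a powr p"
      by (metis powr_mult)+
    ultimately show ?thesis by (simp add: algebra_simps)
  qed (use ab in simp)
  then show thesis using that[of C] C(1) by blast
qed

text \<open>Subtraction is cut off at 0, so \<open>b - a\<close> is a positive part and vanishes if
  \<open>b \<le> a\<close>. This one-sided form suffices for building a majorant, where only upward
  increments count.\<close>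

lemma epow_uniform_convexity:
  assumes p: "1 < p" and \<eta>: "0 < \<eta>"
  obtains C :: real where "0 \<le> C"
    "\<forall>a b. epow (b - a) p + ennreal C * epow ((a + b) / 2) p \<le> ennreal (\<eta> + C / 2) * (epow a p + epow b p)"
proof -
  obtain C where C: "0 \<le> C" "\<forall>a b. 0 \<le> a \<and> a \<le> b \<longrightarrow>
       (b - a) powr p + C * ((a + b) / 2) powr p \<le> (\<eta> + C / 2) * (a powr p + b powr p)"
    by (rule powr_uniform_convexity[OF p \<eta>])
  have "epow (b - a) p + ennreal C * epow ((a + b) / 2) p \<le> ennreal (\<eta> + C / 2) * (epow a p + epow b p)" for a b
  proof (cases "a = top \<or> b = top")
    case True
    then have "ennreal (\<eta> + C / 2) * (epow a p + epow b p) = top"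
      using C(1) \<eta> by (auto simp: ennreal_mult_top)
    then show ?thesis by simp
  next
    case False
    then obtain x y where xy: "0 \<le> x" "a = ennreal x" "0 \<le> y" "b = ennreal y"
      by (metis ennreal_cases)
    have mid: "(a + b) / 2 = ennreal ((x + y) / 2)"
      using xy by (simp add: divide_ennreal[symmetric])
    have "(max 0 (y - x)) powr p + C * ((x + y) / 2) powr p \<le> (\<eta> + C / 2) * (x powr p + y powr p)"
    proof (cases "x \<le> y")
      case True
      then show ?thesis using C(2) xy by (simp add: max_def)
    next
      case False
      then have "C * ((x + y) / 2) powr p \<le> (\<eta> + C / 2) * (x powr p + y powr p)"
        using C(2)[rule_format, of y x] xy by (auto simp: add.commute intro: order_trans[rotated])
      then show ?thesis using False p by (simp add: max_def)
    qed
    then have "ennreal ((max 0 (y - x)) powr p + C * ((x + y) / 2) powr p)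
        \<le> ennreal ((\<eta> + C / 2) * (x powr p + y powr p))"
      by (rule ennreal_leI)
    moreover have "b - a = ennreal (max 0 (y - x))"
      using xy by (simp add: ennreal_minus ennreal_eq_0_iff max_def ennreal_neg)
    ultimately show ?thesis
      unfolding mid using xy C(1) \<eta> by (simp add: epow_ennreal ennreal_mult ennreal_plus del: ennreal_plus[symmetric])
  qed
  then show thesis using that[of C] C(1) by blast
qed

subsection \<open>Compactness in the target\<close>

text \<open>A complete target in which \<open>mid\<close> replaces linear structure;
  \<open>z0\<close> is the default value at points where a sequence of maps fails to be
  Cauchy.\<close>

locale newton_target =
  fixes \<mu> :: "'x::metric_space measure" and \<Omega> :: "'x set" and p :: real
    and Z :: "'z metric" and mid :: "'z \<Rightarrow> 'z \<Rightarrow> 'z" and z0 :: 'z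
  assumes sets_\<mu>: "sets \<mu> = sets borel" and open_\<Omega>: "open \<Omega>" and p: "1 < p"
    and complete: "mcomplete_of Z" and z0: "z0 \<in> mspace Z"
    and mid_in: "a \<in> mspace Z \<Longrightarrow> b \<in> mspace Z \<Longrightarrow> mid a b \<in> mspace Z"
    and mid_self: "mid a a = a"
    and mid_dist: "a \<in> mspace Z \<Longrightarrow> b \<in> mspace Z \<Longrightarrow> a' \<in> mspace Z \<Longrightarrow> b' \<in> mspace Z \<Longrightarrow>
      mdist Z (mid a b) (mid a' b') \<le> (mdist Z a a' + mdist Z b b') / 2"
begin

abbreviation \<nu> where "\<nu> \<equiv> restrict_space \<mu> \<Omega>"

abbreviation sep where "sep \<equiv> separably_measurable \<nu> Z"

definition dp :: "('x \<Rightarrow> 'z) \<Rightarrow> ('x \<Rightarrow> 'z) \<Rightarrow> ennreal" where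
  "dp w w' = (\<integral>\<^sup>+ x. ennreal (mdist Z (w x) (w' x) powr p) \<partial>\<nu>)"

definition En :: "('x \<Rightarrow> ennreal) \<Rightarrow> ennreal" where
  "En h = (\<integral>\<^sup>+ x. epow (h x) p \<partial>\<nu>)"

lemma space_\<nu>: "space \<nu> = \<Omega>"
  using sets_eq_imp_space_eq[OF sets_\<mu>] by (simp add: space_restrict_space)

lemma borel_\<nu>: "f \<in> borel_measurable borel \<Longrightarrow> (f :: 'x \<Rightarrow> ennreal) \<in> borel_measurable \<nu>"
  by (rule borel_measurable_restrict_space_borel[OF sets_\<mu>])

lemma sep_in: "sep w \<Longrightarrow> x \<in> \<Omega> \<Longrightarrow> w x \<in> mspace Z"
  using separably_measurableD(1)[of \<nu> Z w x] by (simp add: space_\<nu>)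

lemma power_powr_quarter: "(2 ^ n) powr p * ((1 / 4) ^ n) powr p = ((1 / 2 :: real) ^ n) powr p"
  by (subst powr_mult[symmetric]) (auto simp: power_mult_distrib[symmetric])

lemma half_power_powr_le: "((1 / 2 :: real) ^ n) powr p \<le> (1 / 2) ^ n"
proof -
  have "((1 / 2 :: real) ^ n) powr p \<le> ((1 / 2) ^ n) powr 1"
    using p by (intro powr_mono') (auto simp: power_le_one)
  then show ?thesis by simp
qed

text \<open>A Borel-Cantelli argument: after multiplication by \<open>2 ^ n\<close> the
  \<open>p\<close>-th powers have summable integrals, so at almost every point they tend to 0 and
  are eventually below 1.\<close>

lemma AE_eventually_le_half_power:
  assumes f: "\<And>n. f n \<in> borel_measurable \<nu>" and f0: "\<And>n x. 0 \<le> f n x"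
    and le: "\<And>n. (\<integral>\<^sup>+ x. ennreal (f n x powr p) \<partial>\<nu>) \<le> ennreal (C * ((1 / 4) ^ n) powr p)"
  shows "AE x in \<nu>. \<forall>\<^sub>F n in sequentially. f n x \<le> (1 / 2 :: real) ^ n"
proof -
  note [measurable] = f
  have "(\<integral>\<^sup>+ x. ennreal ((2 ^ n * f n x) powr p) \<partial>\<nu>) \<le> ennreal (\<bar>C\<bar> * (1 / 2) ^ n)" for n
  proof -
    have "(\<integral>\<^sup>+ x. ennreal ((2 ^ n * f n x) powr p) \<partial>\<nu>)
        = (\<integral>\<^sup>+ x. ennreal ((2 ^ n) powr p) * ennreal (f n x powr p) \<partial>\<nu>)"
      using f0 by (simp add: powr_mult ennreal_mult)
    also have "\<dots> = ennreal ((2 ^ n) powr p) * (\<integral>\<^sup>+ x. ennreal (f n x powr p) \<partial>\<nu>)"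
      by (rule nn_integral_cmult) measurable
    also have "\<dots> \<le> ennreal ((2 ^ n) powr p) * ennreal (C * ((1 / 4) ^ n) powr p)"
      by (intro mult_left_mono le) auto
    also have "\<dots> = ennreal ((2 ^ n) powr p * (C * ((1 / 4) ^ n) powr p))"
      by (rule ennreal_mult'[symmetric]) simp
    also have "(2 ^ n) powr p * (C * ((1 / 4) ^ n) powr p) = C * ((1 / 2) ^ n) powr p"
      using power_powr_quarter[of n] by (simp add: mult.left_commute)
    also have "ennreal (C * ((1 / 2) ^ n) powr p) \<le> ennreal (\<bar>C\<bar> * (1 / 2) ^ n)"
      by (intro ennreal_leI mult_mono half_power_powr_le) auto
    finally show ?thesis .
  qed
  then have "(\<Sum>n. \<integral>\<^sup>+ x. ennreal ((2 ^ n * f n x) powr p) \<partial>\<nu>) \<le> (\<Sum>n. ennreal (\<bar>C\<bar> * (1 / 2) ^ n))"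
    by (intro suminf_le) auto
  also have "\<dots> < top"
    by (subst suminf_ennreal2) (auto intro!: summable_mult simp: complete_algebra_summable_geometric)
  finally have "(\<integral>\<^sup>+ x. (\<Sum>n. ennreal ((2 ^ n * f n x) powr p)) \<partial>\<nu>) < top"
    by (subst nn_integral_suminf) auto
  then have "AE x in \<nu>. (\<Sum>n. ennreal ((2 ^ n * f n x) powr p)) \<noteq> \<infinity>"
    by (intro nn_integral_noteq_infinite) auto
  then show ?thesis
  proof (rule eventually_mono)
    fix x assume "(\<Sum>n. ennreal ((2 ^ n * f n x) powr p)) \<noteq> \<infinity>"
    then have "summable (\<lambda>n. (2 ^ n * f n x) powr p)"
      by (intro summable_suminf_not_top) (auto simp: infinity_ennreal_def)
    then have "(\<lambda>n. (2 ^ n * f n x) powr p) \<longlonglongrightarrow> 0" by (rule summable_LIMSEQ_zero)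
    then have "\<forall>\<^sub>F n in sequentially. (2 ^ n * f n x) powr p < 1" by (rule order_tendstoD) simp
    then show "\<forall>\<^sub>F n in sequentially. f n x \<le> (1 / 2) ^ n"
    proof (rule eventually_mono)
      fix n assume "(2 ^ n * f n x) powr p < 1"
      then have "2 ^ n * f n x \<le> 1"
        using p f0[of n x] ge_one_powr_ge_zero[of "2 ^ n * f n x" p] by (metis less_eq_real_def linorder_not_less order_less_le_trans zero_le_one less_trans)
      then show "f n x \<le> (1 / 2) ^ n" by (simp add: power_one_over field_simps)
    qed
  qed
qed

definition Cauchy_at :: "(nat \<Rightarrow> 'x \<Rightarrow> 'z) \<Rightarrow> 'x \<Rightarrow> bool" where
  "Cauchy_at w x \<longleftrightarrow> (\<forall>e>0. \<exists>N. \<forall>m\<ge>N. \<forall>n\<ge>N. mdist Z (w m x) (w n x) < e)"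

lemma limit_exists:
  assumes w: "\<And>n. w n x \<in> mspace Z" and C: "Cauchy_at w x"
  shows "\<exists>l\<in>mspace Z. (\<lambda>n. mdist Z (w n x) l) \<longlonglongrightarrow> 0"
proof -
  interpret Metric_space "mspace Z" "mdist Z" by simp
  have "MCauchy (\<lambda>n. w n x)"
    using w C unfolding MCauchy_def Cauchy_at_def by blast
  then obtain l where "limitin mtopology (\<lambda>n. w n x) l sequentially"
    using complete unfolding mcomplete_of_def mcomplete_def by blast
  then have l: "l \<in> mspace Z" "\<And>e. e > 0 \<Longrightarrow> \<forall>\<^sub>F n in sequentially. mdist Z (w n x) l < e"
    unfolding limitin_metric by (auto elim!: eventually_mono)
  then show ?thesis
    by (intro bexI[of _ l] tendstoI) (auto simp: dist_real_def)
qed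

lemma Cauchy_at_of_tendsto:
  assumes w: "\<And>n. w n x \<in> mspace Z" "l \<in> mspace Z" and "(\<lambda>n. mdist Z (w n x) l) \<longlonglongrightarrow> 0"
  shows "Cauchy_at w x"
  unfolding Cauchy_at_def
proof (intro allI impI)
  fix e :: real assume "e > 0"
  then obtain N where N: "\<And>n. n \<ge> N \<Longrightarrow> mdist Z (w n x) l < e / 2"
    using order_tendstoD(2)[OF assms(3), of "e / 2"] unfolding eventually_sequentially by auto
  have "mdist Z (w m x) (w n x) < e" if "m \<ge> N" "n \<ge> N" for m n
    using mdist_triangle[OF w(1)[of m] w(2) w(1)[of n]] N[OF that(1)] N[OF that(2)]
    by (simp add: mdist_commute)
  then show "\<exists>N. \<forall>m\<ge>N. \<forall>n\<ge>N. mdist Z (w m x) (w n x) < e" by blast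
qed

lemma sep_mdist [measurable (raw)]:
  "sep w \<Longrightarrow> sep w' \<Longrightarrow> (\<lambda>x. mdist Z (w x) (w' x)) \<in> borel_measurable \<nu>"
  by (rule separably_measurable_mdist)

text \<open>Because \<open>mid\<close> is Lipschitz, the condition that the distance of the midpoint
  to \<open>z\<close> is less than \<open>c\<close> can be tested on midpoints of countably many
  pairs, with the approximation errors added to the distance.\<close>

lemma sep_mid:
  assumes w: "sep w" and w': "sep w'"
  shows "sep (\<lambda>x. mid (w x) (w' x))"
proof -
  obtain D where D: "countable D" "D \<subseteq> mspace Z" "\<forall>x\<in>space \<nu>. \<forall>e>0. \<exists>z\<in>D. mdist Z (w x) z < e"
    by (rule separably_measurable_dense[OF w])
  obtain D' where D': "countable D'" "D' \<subseteq> mspace Z" "\<forall>x\<in>space \<nu>. \<forall>e>0. \<exists>z\<in>D'. mdist Z (w' x) z < e"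
    by (rule separably_measurable_dense[OF w'])
  have in_Z: "mid (w x) (w' x) \<in> mspace Z" "w x \<in> mspace Z" "w' x \<in> mspace Z" if "x \<in> space \<nu>" for x
    using that sep_in[OF w] sep_in[OF w'] mid_in by (auto simp: space_\<nu>)
  have near: "\<exists>a\<in>D. \<exists>b\<in>D'. mdist Z (w x) a < e \<and> mdist Z (w' x) b < e" if "x \<in> space \<nu>" "0 < e" for x e
    using D(3) D'(3) that by blast
  have "{x \<in> space \<nu>. mdist Z (mid (w x) (w' x)) z < c} \<in> sets \<nu>" if z: "z \<in> mspace Z" for z c
  proof -
    have "{x \<in> space \<nu>. mdist Z (mid (w x) (w' x)) z < c} = (\<Union>q\<in>D \<times> D'. {x \<in> space \<nu>.
        mdist Z (mid (fst q) (snd q)) z + (mdist Z (w x) (fst q) + mdist Z (w' x) (snd q)) / 2 < c})"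
    proof (intro set_eqI iffI)
      fix x assume "x \<in> {x \<in> space \<nu>. mdist Z (mid (w x) (w' x)) z < c}"
      then have x: "x \<in> space \<nu>" "mdist Z (mid (w x) (w' x)) z < c" by auto
      obtain a b where ab: "a \<in> D" "b \<in> D'" "mdist Z (w x) a < (c - mdist Z (mid (w x) (w' x)) z) / 2"
        "mdist Z (w' x) b < (c - mdist Z (mid (w x) (w' x)) z) / 2"
        using near[OF x(1), of "(c - mdist Z (mid (w x) (w' x)) z) / 2"] x(2) by auto
      have "mdist Z (mid a b) z \<le> mdist Z (mid a b) (mid (w x) (w' x)) + mdist Z (mid (w x) (w' x)) z"
        using ab D D' in_Z[OF x(1)] z by (intro mdist_triangle mid_in) auto
      moreover have "mdist Z (mid a b) (mid (w x) (w' x)) \<le> (mdist Z a (w x) + mdist Z b (w' x)) / 2"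
        using ab D D' in_Z[OF x(1)] z by (intro mid_dist) auto
      ultimately have "mdist Z (mid a b) z + (mdist Z (w x) a + mdist Z (w' x) b) / 2 < c"
        using ab by (simp add: mdist_commute field_simps)
      then show "x \<in> (\<Union>q\<in>D \<times> D'. {x \<in> space \<nu>.
          mdist Z (mid (fst q) (snd q)) z + (mdist Z (w x) (fst q) + mdist Z (w' x) (snd q)) / 2 < c})"
        using x ab by auto
    next
      fix x assume "x \<in> (\<Union>q\<in>D \<times> D'. {x \<in> space \<nu>.
          mdist Z (mid (fst q) (snd q)) z + (mdist Z (w x) (fst q) + mdist Z (w' x) (snd q)) / 2 < c})"
      then obtain a b where ab: "a \<in> D" "b \<in> D'" "x \<in> space \<nu>"
        "mdist Z (mid a b) z + (mdist Z (w x) a + mdist Z (w' x) b) / 2 < c" by auto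
      have "mdist Z (mid (w x) (w' x)) z \<le> mdist Z (mid (w x) (w' x)) (mid a b) + mdist Z (mid a b) z"
        using ab D D' in_Z[OF ab(3)] z by (intro mdist_triangle mid_in) auto
      moreover have "mdist Z (mid (w x) (w' x)) (mid a b) \<le> (mdist Z (w x) a + mdist Z (w' x) b) / 2"
        using ab D D' in_Z[OF ab(3)] z by (intro mid_dist) auto
      ultimately have "mdist Z (mid (w x) (w' x)) z < c"
        using ab(4) by linarith
      then show "x \<in> {x \<in> space \<nu>. mdist Z (mid (w x) (w' x)) z < c}"
        using ab(3) by simp
    qed
    also have "\<dots> \<in> sets \<nu>"
    proof (rule sets.countable_UN'')
      show "countable (D \<times> D')" using D D' by simp
      fix q assume q: "q \<in> D \<times> D'"
      have [measurable]: "(\<lambda>x. mdist Z (w x) (fst q)) \<in> borel_measurable \<nu>" "(\<lambda>x. mdist Z (w' x) (snd q)) \<in> borel_measurable \<nu>"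
        using q D D' by (auto intro!: separably_measurableD(2)[OF w] separably_measurableD(2)[OF w'])
      show "{x \<in> space \<nu>. mdist Z (mid (fst q) (snd q)) z + (mdist Z (w x) (fst q) + mdist Z (w' x) (snd q)) / 2 < c} \<in> sets \<nu>"
        by measurable
    qed
    finally show ?thesis .
  qed
  then have "\<forall>z\<in>mspace Z. (\<lambda>x. mdist Z (mid (w x) (w' x)) z) \<in> borel_measurable \<nu>"
    by (simp add: borel_measurable_iff_less)
  moreover have "\<exists>z\<in>(\<lambda>(a, b). mid a b) ` (D \<times> D'). mdist Z (mid (w x) (w' x)) z < e"
    if x: "x \<in> space \<nu>" and e: "0 < e" for x e
  proof -
    obtain a b where ab: "a \<in> D" "b \<in> D'" "mdist Z (w x) a < e" "mdist Z (w' x) b < e"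
      using near[OF x e] by auto
    have "mdist Z (mid (w x) (w' x)) (mid a b) \<le> (mdist Z (w x) a + mdist Z (w' x) b) / 2"
      using ab D D' in_Z[OF x] by (intro mid_dist) auto
    then show ?thesis using ab by (intro bexI[of _ "mid a b"]) (auto simp: field_simps)
  qed
  moreover have "countable ((\<lambda>(a, b). mid a b) ` (D \<times> D'))" using D D' by simp
  moreover have "(\<lambda>(a, b). mid a b) ` (D \<times> D') \<subseteq> mspace Z"
    using subsetD[OF D(2)] subsetD[OF D'(2)] mid_in by auto
  ultimately show ?thesis
    unfolding separably_measurable_def using in_Z
    by (intro conjI exI[of _ "(\<lambda>(a, b). mid a b) ` (D \<times> D')"]) auto
qed

text \<open>The limit is taken at every point where the sequence is Cauchy, a measurable set by its
  description with countable quantifiers. It is not enough to know it almost everywhere, since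
  gradient inequalities refer to endpoints of individual curves.\<close>

lemma sep_limit:
  assumes w: "\<And>n. sep (w n)"
  obtains v where "sep v" "\<forall>x\<in>\<Omega>. Cauchy_at w x \<longrightarrow> (\<lambda>n. mdist Z (w n x) (v x)) \<longlonglongrightarrow> 0"
proof -
  define v where "v x = (if Cauchy_at w x then SOME l. l \<in> mspace Z \<and> (\<lambda>n. mdist Z (w n x) l) \<longlonglongrightarrow> 0 else z0)" for x
  have v: "v x \<in> mspace Z \<and> (\<lambda>n. mdist Z (w n x) (v x)) \<longlonglongrightarrow> 0" if "x \<in> \<Omega>" "Cauchy_at w x" for x
  proof -
    have "\<exists>l. l \<in> mspace Z \<and> (\<lambda>n. mdist Z (w n x) l) \<longlonglongrightarrow> 0"
      using limit_exists[of w x] that sep_in[OF w] by blast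
    from someI_ex[OF this] show ?thesis using that by (simp add: v_def)
  qed
  have v_in: "v x \<in> mspace Z" if "x \<in> \<Omega>" for x
    using v[OF that] z0 by (cases "Cauchy_at w x") (auto simp: v_def)
  define E where "E = {x \<in> space \<nu>. \<forall>i::nat. \<exists>N. \<forall>m\<in>{N..}. \<forall>n\<in>{N..}. mdist Z (w m x) (w n x) < 1 / Suc i}"
  have [measurable]: "(\<lambda>x. mdist Z (w m x) (w n x)) \<in> borel_measurable \<nu>" for m n
    using sep_mdist[OF w w] .
  have E_sets: "E \<in> sets \<nu>"
    unfolding E_def by measurable
  have E_iff: "x \<in> E \<longleftrightarrow> x \<in> \<Omega> \<and> Cauchy_at w x" for x
  proof
    assume x: "x \<in> E"
    have "\<exists>N. \<forall>m\<ge>N. \<forall>n\<ge>N. mdist Z (w m x) (w n x) < e" if e: "e > 0" for e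
    proof -
      obtain i where i: "1 / real (Suc i) < e" using nat_approx_posE[OF e] by auto
      obtain N where "\<forall>m\<in>{N..}. \<forall>n\<in>{N..}. mdist Z (w m x) (w n x) < 1 / real (Suc i)"
        using x unfolding E_def by blast
      then show ?thesis using i by (intro exI[of _ N]) (auto intro: less_trans)
    qed
    then show "x \<in> \<Omega> \<and> Cauchy_at w x" using x by (auto simp: E_def space_\<nu> Cauchy_at_def)
  next
    assume x: "x \<in> \<Omega> \<and> Cauchy_at w x"
    have "\<exists>N. \<forall>m\<in>{N..}. \<forall>n\<in>{N..}. mdist Z (w m x) (w n x) < 1 / real (Suc i)" for i
      using x[THEN conjunct2, unfolded Cauchy_at_def, rule_format, of "1 / real (Suc i)"] by auto
    then show "x \<in> E" using x by (simp add: E_def space_\<nu>)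
  qed
  have meas: "(\<lambda>x. mdist Z (v x) z) \<in> borel_measurable \<nu>" if z: "z \<in> mspace Z" for z
  proof -
    have w_meas: "(\<lambda>x. mdist Z (w n x) z) \<in> borel_measurable \<nu>" for n
      using separably_measurableD(2)[OF w z] .
    have lim: "(\<lambda>n. if x \<in> E then mdist Z (w n x) z else mdist Z z0 z) \<longlonglongrightarrow> mdist Z (v x) z" if x: "x \<in> space \<nu>" for x
    proof (cases "x \<in> E")
      case True
      then have x\<Omega>: "x \<in> \<Omega>" "Cauchy_at w x" using E_iff by auto
      have "(\<lambda>n. mdist Z (w n x) z) \<longlonglongrightarrow> mdist Z (v x) z"
      proof (rule LIM_zero_cancel, rule Lim_null_comparison)
        show "(\<lambda>n. mdist Z (w n x) (v x)) \<longlonglongrightarrow> 0" using v[OF x\<Omega>] by simp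
        show "\<forall>\<^sub>F n in sequentially. norm (mdist Z (w n x) z - mdist Z (v x) z) \<le> mdist Z (w n x) (v x)"
        proof (intro always_eventually allI)
          fix n
          have "mdist Z (w n x) z \<le> mdist Z (w n x) (v x) + mdist Z (v x) z"
            "mdist Z (v x) z \<le> mdist Z (v x) (w n x) + mdist Z (w n x) z"
            using x\<Omega> v_in z sep_in[OF w] by (auto intro!: mdist_triangle)
          then show "norm (mdist Z (w n x) z - mdist Z (v x) z) \<le> mdist Z (w n x) (v x)"
            by (simp add: mdist_commute abs_le_iff)
        qed
      qed
      then show ?thesis using True by simp
    next
      case False
      then have "v x = z0" using x E_iff by (auto simp: v_def space_\<nu>)
      then show ?thesis using False by simp
    qed
    have "(\<lambda>x. if x \<in> E then mdist Z (w n x) z else mdist Z z0 z) \<in> borel_measurable \<nu>" for n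
      using w_meas E_sets by (intro measurable_If_set) auto
    from borel_measurable_LIMSEQ_real[OF lim this] show ?thesis .
  qed
  have "\<forall>n. \<exists>D. countable D \<and> D \<subseteq> mspace Z \<and> (\<forall>x\<in>space \<nu>. \<forall>e>0. \<exists>z\<in>D. mdist Z (w n x) z < e)"
    using w unfolding separably_measurable_def by simp
  from choice[OF this] obtain D where
    D: "\<forall>n. countable (D n) \<and> D n \<subseteq> mspace Z \<and> (\<forall>x\<in>space \<nu>. \<forall>e>0. \<exists>z\<in>D n. mdist Z (w n x) z < e)" ..
  let ?D = "insert z0 (\<Union>n. D n)"
  have dense: "\<exists>z\<in>?D. mdist Z (v x) z < e" if x: "x \<in> space \<nu>" and e: "0 < e" for x and e :: real
  proof (cases "Cauchy_at w x")
    case True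
    have x\<Omega>: "x \<in> \<Omega>" using x by (simp add: space_\<nu>)
    have "\<forall>\<^sub>F n in sequentially. mdist Z (w n x) (v x) < e / 2"
      using v[OF x\<Omega> True] e by (intro order_tendstoD(2)[of _ 0]) auto
    then obtain n where n: "mdist Z (w n x) (v x) < e / 2" unfolding eventually_sequentially by blast
    obtain d where d: "d \<in> D n" "mdist Z (w n x) d < e / 2"
      using D x e by (metis half_gt_zero)
    have "mdist Z (v x) d \<le> mdist Z (v x) (w n x) + mdist Z (w n x) d"
      using d D x\<Omega> v_in sep_in[OF w] by (intro mdist_triangle) auto
    then show ?thesis using n d by (intro bexI[of _ d]) (auto simp: mdist_commute)
  next
    case False
    then show ?thesis using z0 e by (auto simp: v_def mdist_self)
  qed
  have "sep v"
    unfolding separably_measurable_def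
  proof (intro conjI ballI meas)
    show "v ` space \<nu> \<subseteq> mspace Z" using v_in by (auto simp: space_\<nu>)
    show "\<exists>D. countable D \<and> D \<subseteq> mspace Z \<and> (\<forall>x\<in>space \<nu>. \<forall>e>0. \<exists>z\<in>D. mdist Z (v x) z < e)"
      using D dense z0 by (intro exI[of _ ?D]) auto
  qed
  then show thesis using that v by blast
qed

lemma mdist_tendsto:
  assumes w: "\<And>n. w n x \<in> mspace Z" "v x \<in> mspace Z" and z: "z \<in> mspace Z"
    and lim: "(\<lambda>n. mdist Z (w n x) (v x)) \<longlonglongrightarrow> 0"
  shows "(\<lambda>n. mdist Z z (w n x)) \<longlonglongrightarrow> mdist Z z (v x)"
proof (rule LIM_zero_cancel, rule Lim_null_comparison[OF _ lim], intro always_eventually allI)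
  fix n
  have "mdist Z z (w n x) \<le> mdist Z z (v x) + mdist Z (v x) (w n x)"
    "mdist Z z (v x) \<le> mdist Z z (w n x) + mdist Z (w n x) (v x)"
    using w z by (auto intro!: mdist_triangle)
  then show "norm (mdist Z z (w n x) - mdist Z z (v x)) \<le> mdist Z (w n x) (v x)"
    by (simp add: mdist_commute abs_le_iff)
qed

text \<open>The Riesz-Fischer argument for maps: a subsequence with increments of size
  \<open>(1/4)^k\<close> is Cauchy almost everywhere, and Fatou's lemma bounds the distance of the
  whole sequence to its limit.\<close>

lemma Lp_complete:
  fixes w :: "nat \<Rightarrow> 'x \<Rightarrow> 'z"
  assumes w: "\<And>n. sep (w n)" and C: "\<And>e. 0 < e \<Longrightarrow> \<exists>N. \<forall>m\<ge>N. \<forall>n\<ge>N. dp (w m) (w n) \<le> ennreal e"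
  obtains v where "sep v" "\<forall>e>0. \<exists>N. \<forall>n\<ge>N. dp (w n) v \<le> ennreal e"
proof -
  have "\<forall>k::nat. \<exists>N. \<forall>m\<ge>N. \<forall>n\<ge>N. dp (w m) (w n) \<le> ennreal (((1 / 4) ^ k) powr p)"
    by (intro allI C) simp
  from choice[OF this] obtain N where
    N: "\<forall>k. \<forall>m\<ge>N k. \<forall>n\<ge>N k. dp (w m) (w n) \<le> ennreal (((1 / 4) ^ k) powr p)" ..
  \<comment> \<open>The sum exceeds \<open>N k\<close> at both \<open>k\<close> and
    \<open>Suc k\<close>, and the summand \<open>k\<close> makes the indices tend to
    infinity.\<close>
  define s where "s k = (\<Sum>i\<le>k. N i) + k" for k
  have s_ge: "N k \<le> s k" "k \<le> s k" "N k \<le> s (Suc k)" for k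
    using member_le_sum[of k "{..k}" N] by (auto simp: s_def)
  define f where "f k x = mdist Z (w (s k) x) (w (s (Suc k)) x)" for k x
  have "AE x in \<nu>. \<forall>\<^sub>F k in sequentially. f k x \<le> (1 / 2) ^ k"
  proof (rule AE_eventually_le_half_power[of f 1])
    show "f k \<in> borel_measurable \<nu>" for k
      unfolding f_def using sep_mdist[OF w w] .
    show "(\<integral>\<^sup>+ x. ennreal (f k x powr p) \<partial>\<nu>) \<le> ennreal (1 * ((1 / 4) ^ k) powr p)" for k
      using N s_ge[of k] by (simp add: dp_def f_def)
  qed (simp add: f_def)
  then have AE_C: "AE x in \<nu>. Cauchy_at (\<lambda>k. w (s k)) x"
  proof (rule AE_mp, intro AE_I2 impI)
    fix x assume x: "x \<in> space \<nu>" and f: "\<forall>\<^sub>F k in sequentially. f k x \<le> (1 / 2) ^ k"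
    have in_Z: "w n x \<in> mspace Z" for n using sep_in[OF w] x by (simp add: space_\<nu>)
    obtain K where K: "\<And>k. k \<ge> K \<Longrightarrow> f k x \<le> (1 / 2) ^ k"
      using f unfolding eventually_sequentially by blast
    have tail: "mdist Z (w (s m) x) (w (s (m + j)) x) \<le> 2 * (1 / 2) ^ m - 2 * (1 / 2) ^ (m + j)" if "m \<ge> K" for m j
    proof (induction j)
      case 0 show ?case using in_Z by (simp add: mdist_self)
    next
      case (Suc j)
      have "mdist Z (w (s m) x) (w (s (m + Suc j)) x)
          \<le> mdist Z (w (s m) x) (w (s (m + j)) x) + f (m + j) x"
        using in_Z unfolding f_def by (simp add: mdist_triangle)
      also have "\<dots> \<le> (2 * (1 / 2) ^ m - 2 * (1 / 2) ^ (m + j)) + (1 / 2) ^ (m + j)"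
        using that by (intro add_mono Suc K) auto
      finally show ?case by simp
    qed
    have tail': "mdist Z (w (s m) x) (w (s n) x) \<le> 2 * (1 / 2) ^ m" if "m \<ge> K" "m \<le> n" for m n
      using tail[OF that(1), of "n - m"] that(2)
      by (simp, smt (verit) zero_le_power divide_nonneg_nonneg)
    show "Cauchy_at (\<lambda>k. w (s k)) x"
      unfolding Cauchy_at_def
    proof (intro allI impI)
      fix e :: real assume "e > 0"
      then obtain M where M: "(1 / 2 :: real) ^ M < e / 2"
        using real_arch_pow_inv[of "e / 2" "1 / 2"] by auto
      have le: "(1 / 2 :: real) ^ n \<le> (1 / 2) ^ M" if "n \<ge> M" for n
        using that by (intro power_decreasing) auto
      have "mdist Z (w (s m) x) (w (s n) x) < e" if "m \<ge> max K M" "n \<ge> max K M" for m n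
      proof (cases "m \<le> n")
        case True
        have "mdist Z (w (s m) x) (w (s n) x) \<le> 2 * (1 / 2) ^ m" using tail'[of m n] True that by simp
        moreover have "(1 / 2 :: real) ^ m \<le> (1 / 2) ^ M" using that by (intro le) simp
        ultimately show ?thesis using M by linarith
      next
        case False
        have "mdist Z (w (s n) x) (w (s m) x) \<le> 2 * (1 / 2) ^ n" using tail'[of n m] False that by simp
        moreover have "(1 / 2 :: real) ^ n \<le> (1 / 2) ^ M" using that by (intro le) simp
        ultimately show ?thesis using M mdist_commute[of Z "w (s m) x" "w (s n) x"] by linarith
      qed
      then show "\<exists>N. \<forall>m\<ge>N. \<forall>n\<ge>N. mdist Z (w (s m) x) (w (s n) x) < e" by blast
    qed
  qed
  obtain v where v: "sep v" "\<forall>x\<in>\<Omega>. Cauchy_at (\<lambda>k. w (s k)) x \<longrightarrow> (\<lambda>n. mdist Z (w (s n) x) (v x)) \<longlonglongrightarrow> 0"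
    by (rule sep_limit[of "\<lambda>k. w (s k)", OF w])
  have "\<exists>N. \<forall>n\<ge>N. dp (w n) v \<le> ennreal e" if e: "0 < e" for e
  proof -
    obtain M where M: "\<And>m n. m \<ge> M \<Longrightarrow> n \<ge> M \<Longrightarrow> dp (w m) (w n) \<le> ennreal e"
      using C[OF e] by blast
    have "dp (w n) v \<le> ennreal e" if n: "n \<ge> M" for n
    proof -
      let ?g = "\<lambda>k x. ennreal (mdist Z (w n x) (w (s k) x) powr p)"
      have "dp (w n) v = (\<integral>\<^sup>+ x. liminf (\<lambda>k. ?g k x) \<partial>\<nu>)"
        unfolding dp_def
      proof (rule nn_integral_cong_AE, rule AE_mp[OF AE_C], intro AE_I2 impI)
        fix x assume x: "x \<in> space \<nu>" "Cauchy_at (\<lambda>k. w (s k)) x"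
        have "(\<lambda>k. mdist Z (w n x) (w (s k) x)) \<longlonglongrightarrow> mdist Z (w n x) (v x)"
          using x v sep_in[OF w] sep_in[OF v(1)] by (intro mdist_tendsto) (auto simp: space_\<nu>)
        then have "(\<lambda>k. ?g k x) \<longlonglongrightarrow> ennreal (mdist Z (w n x) (v x) powr p)"
          using p by (intro tendsto_ennrealI tendsto_powr') auto
        from lim_imp_Liminf[OF _ this] show "ennreal (mdist Z (w n x) (v x) powr p) = liminf (\<lambda>k. ?g k x)"
          by simp
      qed
      also have "\<dots> \<le> liminf (\<lambda>k. \<integral>\<^sup>+ x. ?g k x \<partial>\<nu>)"
      proof (rule nn_integral_liminf)
        fix k
        have [measurable]: "(\<lambda>x. mdist Z (w n x) (w (s k) x)) \<in> borel_measurable \<nu>"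
          using sep_mdist[OF w w] .
        show "(\<lambda>x. ?g k x) \<in> borel_measurable \<nu>" by measurable
      qed
      also have "\<dots> \<le> ennreal e"
      proof (rule Liminf_le)
        show "\<forall>\<^sub>F k in sequentially. (\<integral>\<^sup>+ x. ?g k x \<partial>\<nu>) \<le> ennreal e"
          unfolding eventually_sequentially
        proof (intro exI[of _ M] allI impI)
          fix k assume "M \<le> k"
          then show "(\<integral>\<^sup>+ x. ?g k x \<partial>\<nu>) \<le> ennreal e"
            using M[of n "s k"] n s_ge(2)[of k] by (simp add: dp_def)
        qed
      qed simp
      finally show ?thesis .
    qed
    then show ?thesis by blast
  qed
  then show thesis using that v(1) by blast
qed



text \<open>Balls around \<open>v\<close> are stable under midpoints: \<open>mid (v x) (v x)\<close>
  is \<open>v x\<close>, and \<open>t powr p\<close> is convex. Midpoints therefore stay competitors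
  in the minimization below.\<close>

lemma dp_mid_le:
  assumes w: "sep w" and w': "sep w'" and v: "sep v" and "dp w v \<le> ennreal e" "dp w' v \<le> ennreal e" "0 \<le> e"
  shows "dp (\<lambda>x. mid (w x) (w' x)) v \<le> ennreal e"
proof -
  have [measurable]: "(\<lambda>x. mdist Z (w x) (v x)) \<in> borel_measurable \<nu>" "(\<lambda>x. mdist Z (w' x) (v x)) \<in> borel_measurable \<nu>"
    using sep_mdist[OF w v] sep_mdist[OF w' v] by auto
  have "dp (\<lambda>x. mid (w x) (w' x)) v
      \<le> (\<integral>\<^sup>+ x. ennreal (1 / 2) * (ennreal (mdist Z (w x) (v x) powr p) + ennreal (mdist Z (w' x) (v x) powr p)) \<partial>\<nu>)"
    unfolding dp_def
  proof (rule nn_integral_mono)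
    fix x assume x: "x \<in> space \<nu>"
    have "mdist Z (mid (w x) (w' x)) (mid (v x) (v x)) \<le> (mdist Z (w x) (v x) + mdist Z (w' x) (v x)) / 2"
      using x sep_in[OF w] sep_in[OF w'] sep_in[OF v] by (intro mid_dist) (auto simp: space_\<nu>)
    then have "mdist Z (mid (w x) (w' x)) (v x) powr p \<le> ((mdist Z (w x) (v x) + mdist Z (w' x) (v x)) / 2) powr p"
      using p by (intro powr_mono2) (auto simp: mid_self)
    also have "\<dots> \<le> (mdist Z (w x) (v x) powr p + mdist Z (w' x) (v x) powr p) / 2"
      by (rule powr_midpoint_le[OF p]) auto
    finally have "mdist Z (mid (w x) (w' x)) (v x) powr p
        \<le> 1 / 2 * (mdist Z (w x) (v x) powr p + mdist Z (w' x) (v x) powr p)" by simp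
    from ennreal_leI[OF this]
    show "ennreal (mdist Z (mid (w x) (w' x)) (v x) powr p)
        \<le> ennreal (1 / 2) * (ennreal (mdist Z (w x) (v x) powr p) + ennreal (mdist Z (w' x) (v x) powr p))"
      by (subst (asm) ennreal_mult) auto
  qed
  also have "\<dots> = ennreal (1 / 2) * (dp w v + dp w' v)"
    unfolding dp_def by (subst nn_integral_cmult, measurable, subst nn_integral_add, measurable)
  also have "\<dots> \<le> ennreal (1 / 2) * (ennreal e + ennreal e)"
    using assms by (intro mult_left_mono add_mono) auto
  also have "\<dots> = ennreal e"
    by (subst ennreal_plus[symmetric, OF \<open>0 \<le> e\<close> \<open>0 \<le> e\<close>], subst ennreal_mult[symmetric])
      (use \<open>0 \<le> e\<close> in auto)
  finally show ?thesis .
qed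

lemma upper_gradient_mid:
  assumes w: "sep w" and w': "sep w'" and h: "upper_gradient \<Omega> Z w h" and h': "upper_gradient \<Omega> Z w' h'"
  shows "upper_gradient \<Omega> Z (\<lambda>x. mid (w x) (w' x)) (\<lambda>x. (h x + h' x) / 2)"
  unfolding upper_gradient_def
proof (intro conjI ballI, goal_cases)
  case 1
  have [measurable]: "h \<in> borel_measurable borel" "h' \<in> borel_measurable borel"
    using h h' by (auto simp: upper_gradient_def)
  show ?case by measurable
next
  case (2 c)
  obtain \<gamma> L where c: "c = (\<gamma>, L)" by force
  with 2 have \<gamma>: "(\<gamma>, L) \<in> curves_in \<Omega>" by simp
  then have L: "arclength_curve \<gamma> L" "0 \<le> L" "\<gamma> 0 \<in> \<Omega>" "\<gamma> L \<in> \<Omega>"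
    by (auto simp: curves_in_def arclength_curve_def)
  have [measurable]: "(\<lambda>r. h (\<gamma> r) * indicator {0..L} r) \<in> borel_measurable borel"
    "(\<lambda>r. h' (\<gamma> r) * indicator {0..L} r) \<in> borel_measurable borel"
    using h h' L by (auto simp: upper_gradient_def intro!: curve_integrand_measurable)
  have "line_integral (\<lambda>x. (h x + h' x) / 2) \<gamma> L
      = (\<integral>\<^sup>+ r. (h (\<gamma> r) * indicator {0..L} r + h' (\<gamma> r) * indicator {0..L} r) / 2 \<partial>lborel)"
    unfolding line_integral_def by (intro nn_integral_cong) (auto simp: indicator_def)
  also have "\<dots> = (line_integral h \<gamma> L + line_integral h' \<gamma> L) / 2"
    unfolding line_integral_def by (simp add: nn_integral_divide nn_integral_add)
  finally have eq: "line_integral (\<lambda>x. (h x + h' x) / 2) \<gamma> L = (line_integral h \<gamma> L + line_integral h' \<gamma> L) / 2" .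
  have "mdist Z (mid (w (\<gamma> L)) (w' (\<gamma> L))) (mid (w (\<gamma> 0)) (w' (\<gamma> 0)))
      \<le> (mdist Z (w (\<gamma> L)) (w (\<gamma> 0)) + mdist Z (w' (\<gamma> L)) (w' (\<gamma> 0))) / 2"
    using L sep_in[OF w] sep_in[OF w'] by (intro mid_dist) auto
  then have "ennreal (mdist Z (mid (w (\<gamma> L)) (w' (\<gamma> L))) (mid (w (\<gamma> 0)) (w' (\<gamma> 0))))
      \<le> (ennreal (mdist Z (w (\<gamma> L)) (w (\<gamma> 0))) + ennreal (mdist Z (w' (\<gamma> L)) (w' (\<gamma> 0)))) / 2"
    by (subst ennreal_plus[symmetric], simp, simp, subst ennreal_numeral[symmetric], subst divide_ennreal)
      (auto intro!: ennreal_leI)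
  also have "\<dots> \<le> (line_integral h \<gamma> L + line_integral h' \<gamma> L) / 2"
    using h h' \<gamma> unfolding upper_gradient_def by (intro divide_right_mono_ennreal add_mono) auto
  finally have "ennreal (mdist Z (mid (w (\<gamma> L)) (w' (\<gamma> L))) (mid (w (\<gamma> 0)) (w' (\<gamma> 0))))
      \<le> line_integral (\<lambda>x. (h x + h' x) / 2) \<gamma> L" unfolding eq .
  then show ?case by (simp add: c)
qed

text \<open>With one gradient for all \<open>n\<close> the maps are equicontinuous along curves with
  finite integral. Making the gradient infinite on the null set forces such a curve to leave it at
  times near any given one, and the Cauchy property spreads from there to all times. Both endpoints
  thus lie where the limit exists.\<close>

lemma upper_gradient_limit:
  assumes w: "\<And>n. sep (w n)" and ug: "\<And>n. upper_gradient \<Omega> Z (w n) G" and AE_C: "AE x in \<nu>. Cauchy_at w x"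
  obtains v G' where "sep v" "\<forall>x\<in>\<Omega>. Cauchy_at w x \<longrightarrow> (\<lambda>n. mdist Z (w n x) (v x)) \<longlonglongrightarrow> 0"
    "upper_gradient \<Omega> Z v G'" "En G' = En G"
proof -
  obtain v where v: "sep v" "\<forall>x\<in>\<Omega>. Cauchy_at w x \<longrightarrow> (\<lambda>n. mdist Z (w n x) (v x)) \<longlonglongrightarrow> 0"
    by (rule sep_limit[of w, OF w])
  obtain N where N: "{x \<in> space \<nu>. \<not> Cauchy_at w x} \<subseteq> N" "emeasure \<nu> N = 0" "N \<in> sets \<nu>"
    by (rule AE_E[OF AE_C])
  have N_borel: "N \<in> sets borel"
  proof -
    have "N \<in> (\<inter>) \<Omega> ` sets borel"
      using N(3) unfolding sets_restrict_space sets_\<mu> .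
    then obtain A where "N = \<Omega> \<inter> A" "A \<in> sets borel" by (rule imageE)
    then show ?thesis using open_\<Omega> by simp
  qed
  have G[measurable]: "G \<in> borel_measurable borel" using ug[of 0] by (simp add: upper_gradient_def)
  define G' where "G' x = G x + top * indicator N x" for x
  have "upper_gradient \<Omega> Z v G'"
    unfolding upper_gradient_def
  proof (intro conjI ballI, goal_cases)
    case 1
    show ?case unfolding G'_def using N_borel by measurable
  next
    case (2 c)
    obtain \<gamma> L where c: "c = (\<gamma>, L)" by force
    with 2 have \<gamma>: "(\<gamma>, L) \<in> curves_in \<Omega>" by simp
    then have L0: "0 \<le> L" "\<gamma> 0 \<in> \<Omega>" "\<gamma> L \<in> \<Omega>" by (auto simp: curves_in_def arclength_curve_def)
    have "ennreal (mdist Z (v (\<gamma> L)) (v (\<gamma> 0))) \<le> line_integral G' \<gamma> L"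
    proof (cases "L = 0 \<or> line_integral G' \<gamma> L = top")
      case True
      then show ?thesis using sep_in[OF v(1) L0(2)] by (auto simp: mdist_self)
    next
      case False
      then have fin: "line_integral (\<lambda>x. G x + top * indicator N x) \<gamma> L < top" "0 < L"
        using L0 by (auto simp: less_top G'_def[abs_def])
      have C: "Cauchy_at w (\<gamma> s)" if s: "s \<in> {0..L}" for s
        unfolding Cauchy_at_def
      proof (intro allI impI)
        fix e :: real assume "e > 0"
        then have e: "0 < e / 3" by simp
        obtain t where t: "t \<in> {0..L}" "\<gamma> t \<in> \<Omega> - N"
          "\<forall>w. upper_gradient \<Omega> Z w G \<longrightarrow> mdist Z (w (\<gamma> t)) (w (\<gamma> s)) < e / 3"
          by (rule upper_gradient_generic_parameter[OF \<gamma> fin(2) G fin(1) s e])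
        have "Cauchy_at w (\<gamma> t)" using t(2) N(1) by (auto simp: space_\<nu>)
        then obtain K where K: "\<And>m n. m \<ge> K \<Longrightarrow> n \<ge> K \<Longrightarrow> mdist Z (w m (\<gamma> t)) (w n (\<gamma> t)) < e / 3"
          using e unfolding Cauchy_at_def by blast
        have in_Z: "w n (\<gamma> t) \<in> mspace Z" "w n (\<gamma> s) \<in> mspace Z" for n
        proof -
          have "\<gamma> s \<in> \<Omega>" using \<gamma> s by (auto simp: curves_in_def)
          then show "w n (\<gamma> t) \<in> mspace Z" "w n (\<gamma> s) \<in> mspace Z" using sep_in[OF w] t by auto
        qed
        have "mdist Z (w m (\<gamma> s)) (w n (\<gamma> s)) < e" if "m \<ge> K" "n \<ge> K" for m n
        proof -
          have "mdist Z (w m (\<gamma> s)) (w n (\<gamma> s)) \<le> mdist Z (w m (\<gamma> s)) (w m (\<gamma> t)) + mdist Z (w m (\<gamma> t)) (w n (\<gamma> s))"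
            "mdist Z (w m (\<gamma> t)) (w n (\<gamma> s)) \<le> mdist Z (w m (\<gamma> t)) (w n (\<gamma> t)) + mdist Z (w n (\<gamma> t)) (w n (\<gamma> s))"
            using in_Z by (auto intro!: mdist_triangle)
          moreover have "mdist Z (w m (\<gamma> t)) (w m (\<gamma> s)) < e / 3" "mdist Z (w n (\<gamma> t)) (w n (\<gamma> s)) < e / 3"
            using t(3) ug by auto
          ultimately show ?thesis using K[OF that] mdist_commute[of Z "w m (\<gamma> s)" "w m (\<gamma> t)"] by linarith
        qed
        then show "\<exists>N. \<forall>m\<ge>N. \<forall>n\<ge>N. mdist Z (w m (\<gamma> s)) (w n (\<gamma> s)) < e" by blast
      qed
      have G_le: "line_integral G \<gamma> L \<le> line_integral G' \<gamma> L"
        unfolding line_integral_def G'_def by (intro nn_integral_mono mult_right_mono) auto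
      then obtain l where l: "0 \<le> l" "line_integral G \<gamma> L = ennreal l"
        using False by (cases "line_integral G \<gamma> L") (auto simp: top_unique)
      have lim: "(\<lambda>n. mdist Z (w n (\<gamma> L)) (v (\<gamma> L))) \<longlonglongrightarrow> 0" "(\<lambda>n. mdist Z (w n (\<gamma> 0)) (v (\<gamma> 0))) \<longlonglongrightarrow> 0"
        using v(2) L0 C[of L] C[of 0] by auto
      have "(\<lambda>n. l + (mdist Z (w n (\<gamma> L)) (v (\<gamma> L)) + mdist Z (w n (\<gamma> 0)) (v (\<gamma> 0)))) \<longlonglongrightarrow> l + (0 + 0)"
        by (intro tendsto_intros lim)
      moreover have "mdist Z (v (\<gamma> L)) (v (\<gamma> 0)) \<le> l + (mdist Z (w n (\<gamma> L)) (v (\<gamma> L)) + mdist Z (w n (\<gamma> 0)) (v (\<gamma> 0)))" for n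
      proof -
        have "ennreal (mdist Z (w n (\<gamma> L)) (w n (\<gamma> 0))) \<le> ennreal l"
          using ug[of n] \<gamma> l(2) unfolding upper_gradient_def by auto
        then have "mdist Z (w n (\<gamma> L)) (w n (\<gamma> 0)) \<le> l" using l(1) by simp
        moreover have "mdist Z (v (\<gamma> L)) (v (\<gamma> 0)) \<le> mdist Z (v (\<gamma> L)) (w n (\<gamma> L)) + mdist Z (w n (\<gamma> L)) (v (\<gamma> 0))"
          "mdist Z (w n (\<gamma> L)) (v (\<gamma> 0)) \<le> mdist Z (w n (\<gamma> L)) (w n (\<gamma> 0)) + mdist Z (w n (\<gamma> 0)) (v (\<gamma> 0))"
          using sep_in[OF w] sep_in[OF v(1)] L0 by (auto intro!: mdist_triangle)
        ultimately show ?thesis by (simp add: mdist_commute)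
      qed
      ultimately have "mdist Z (v (\<gamma> L)) (v (\<gamma> 0)) \<le> l"
        using LIMSEQ_le_const[of _ "l + (0 + 0)"] by auto
      then show ?thesis by (metis G_le ennreal_leI l(2) order_trans)
    qed
    then show ?case by (simp add: c)
  qed
  moreover have "En G' = En G"
    unfolding En_def
  proof (rule nn_integral_cong_AE)
    have "AE x in \<nu>. x \<notin> N" using N(2,3) by (intro AE_not_in) auto
    then show "AE x in \<nu>. epow (G' x) p = epow (G x) p"
      by (rule eventually_mono) (simp add: G'_def)
  qed
  ultimately show thesis using that v by blast
qed

text \<open>A common majorant \<open>M\<close> of the increments weighted by \<open>2 ^ k\<close>
  still has finite energy, as \<open>2 ^ k\<close> only uses up part of the decay. Summing the
  increments back gives at most \<open>2 * M\<close> above \<open>h 0\<close>.\<close>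

lemma rapid_Lp_increments_majorant:
  assumes h: "\<And>n. h n \<in> borel_measurable borel" and fin: "En (h 0) < top"
    and incr: "\<And>k. En (\<lambda>x. h (Suc k) x - h k x) \<le> ennreal (((1 / 4) ^ k) powr p)"
  obtains G where "G \<in> borel_measurable borel" "\<forall>k x. h k x \<le> G x" "En G < top"
proof -
  note [measurable] = h
  have h_\<nu>[measurable]: "h n \<in> borel_measurable \<nu>" for n by (rule borel_\<nu>[OF h])
  define \<rho> where "\<rho> k x = ennreal (2 ^ k) * (h (Suc k) x - h k x)" for k x
  have \<rho>: "\<rho> k \<in> borel_measurable borel" for k unfolding \<rho>_def by measurable
  obtain M where M: "M \<in> borel_measurable borel" "\<forall>k x. \<rho> k x \<le> M x"
    "(\<integral>\<^sup>+ x. epow (M x) p \<partial>\<nu>) = (\<Sum>k. \<integral>\<^sup>+ x. epow (\<rho> k x) p \<partial>\<nu>)"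
    by (rule Lp_countable_majorant[of p \<rho> borel \<nu>, OF _ \<rho> borel_\<nu>]) (use p in auto)
  have "En (\<rho> k) \<le> ennreal ((1 / 2) ^ k)" for k
  proof -
    have "En (\<rho> k) = (\<integral>\<^sup>+ x. ennreal ((2 ^ k) powr p) * epow (h (Suc k) x - h k x) p \<partial>\<nu>)"
      unfolding En_def \<rho>_def by (simp add: epow_mult del: ennreal_power)
    also have "\<dots> = ennreal ((2 ^ k) powr p) * En (\<lambda>x. h (Suc k) x - h k x)"
      unfolding En_def by (rule nn_integral_cmult) measurable
    also have "\<dots> \<le> ennreal ((2 ^ k) powr p) * ennreal (((1 / 4) ^ k) powr p)"
      by (intro mult_left_mono incr) auto
    also have "\<dots> = ennreal (((1 / 2) ^ k) powr p)"
      by (simp only: ennreal_mult[symmetric] powr_ge_zero power_powr_quarter)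
    also have "\<dots> \<le> ennreal ((1 / 2) ^ k)" by (rule ennreal_leI[OF half_power_powr_le])
    finally show ?thesis .
  qed
  then have "En M \<le> (\<Sum>k. ennreal ((1 / 2) ^ k))"
    unfolding En_def M(3) by (intro suminf_le) auto
  also have "\<dots> < top"
    by (subst suminf_ennreal2) (auto simp: complete_algebra_summable_geometric)
  finally have M_fin: "En M < top" .
  define G where "G x = h 0 x + ennreal 2 * M x" for x
  have [measurable]: "M \<in> borel_measurable borel" by (rule M)
  have [measurable]: "M \<in> borel_measurable \<nu>" by (rule borel_\<nu>[OF M(1)])
  have "h k x \<le> h 0 x + ennreal (\<Sum>j<k. (1 / 2) ^ j) * M x" for k x
  proof (induction k)
    case (Suc k)
    have "h (Suc k) x - h k x = ennreal ((1 / 2) ^ k) * \<rho> k x"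
      unfolding \<rho>_def mult.assoc[symmetric]
      by (subst ennreal_mult[symmetric]) (auto simp: power_mult_distrib[symmetric])
    also have "\<dots> \<le> ennreal ((1 / 2) ^ k) * M x" using M(2) by (intro mult_left_mono) auto
    finally have diff: "h (Suc k) x - h k x \<le> ennreal ((1 / 2) ^ k) * M x" .
    \<comment> \<open>Where \<open>h\<close> decreases the truncated increment is 0, so upward
      increments alone control the growth.\<close>
    have "h (Suc k) x \<le> h k x + (h (Suc k) x - h k x)"
      by (cases "h k x \<le> h (Suc k) x") (auto simp: add_diff_inverse_ennreal diff_eq_0_ennreal intro: order_trans[of _ "h k x"])
    also have "\<dots> \<le> (h 0 x + ennreal (\<Sum>j<k. (1 / 2) ^ j) * M x) + ennreal ((1 / 2) ^ k) * M x"
      by (intro add_mono Suc diff)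
    also have "\<dots> = h 0 x + ennreal (\<Sum>j<Suc k. (1 / 2) ^ j) * M x"
      by (simp add: ennreal_plus sum_nonneg distrib_right add.assoc)
    finally show ?case .
  qed simp
  moreover have "ennreal (\<Sum>j<k. (1 / 2 :: real) ^ j) * m \<le> ennreal 2 * m" for k m
  proof (intro mult_right_mono ennreal_leI)
    have "(\<Sum>j<k. (1 / 2 :: real) ^ j) = 2 - 2 * (1 / 2) ^ k" by (subst sum_gp_strict) (auto simp: field_simps)
    then show "(\<Sum>j<k. (1 / 2 :: real) ^ j) \<le> 2" by simp
  qed simp
  ultimately have "\<forall>k x. h k x \<le> G x"
    unfolding G_def by (meson add_left_mono order_trans)
  moreover have "En G < top"
  proof -
    have "En G \<le> (\<integral>\<^sup>+ x. ennreal (2 powr p) * (epow (h 0 x) p + ennreal (2 powr p) * epow (M x) p) \<partial>\<nu>)"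
      unfolding En_def G_def
      using p by (intro nn_integral_mono order_trans[OF epow_add_le]) (auto simp: epow_mult simp del: ennreal_numeral)
    also have "\<dots> = ennreal (2 powr p) * (En (h 0) + ennreal (2 powr p) * En M)"
      unfolding En_def by (simp add: nn_integral_cmult nn_integral_add)
    also have "\<dots> < top" using fin M_fin by (simp add: ennreal_mult_less_top)
    finally show ?thesis .
  qed
  moreover have "G \<in> borel_measurable borel" unfolding G_def by measurable
  ultimately show thesis using that by blast
qed

text \<open>The infimal energies in shrinking neighbourhoods of \<open>v\<close> increase and are
  bounded by \<open>B\<close>, hence converge. Nearly minimal gradients at different late stages
  therefore have midpoints that save almost no energy, and by uniform convexity the upward
  increments are small.\<close>

lemma common_gradient_sequence:
  assumes v: "sep v" and ex: "\<And>e. 0 < e \<Longrightarrow>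
    \<exists>w h. sep w \<and> upper_gradient \<Omega> Z w h \<and> dp w v \<le> ennreal e \<and> En h \<le> ennreal B"
  obtains w G where "\<forall>n. sep (w n)" "\<forall>n. upper_gradient \<Omega> Z (w n) G"
    "\<forall>n. dp (w n) v \<le> ennreal (((1 / 4) ^ n) powr p)" "En G < top"
proof -
  define \<delta> where "\<delta> n = ((1 / 4 :: real) ^ n) powr p" for n
  have \<delta>_pos: "0 < \<delta> n" for n by (simp add: \<delta>_def)
  have \<delta>_mono: "\<delta> n \<le> \<delta> m" if "m \<le> n" for m n
    unfolding \<delta>_def using p that by (intro powr_mono2 power_decreasing) auto
  \<comment> \<open>The infimum runs over maps near \<open>v\<close> together with their gradients,
    so that the midpoint of two pairs competes again.\<close>
  define A where "A n = {(w, h). sep w \<and> upper_gradient \<Omega> Z w h \<and> dp w v \<le> ennreal (\<delta> n)}" for n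
  have A_mono: "A n \<subseteq> A m" if "m \<le> n" for m n
    using ennreal_leI[OF \<delta>_mono[OF that]] by (auto simp: A_def intro: order_trans)
  define a where "a n = (INF (w, h)\<in>A n. En h)" for n
  have a_le: "a n \<le> ennreal B" for n
  proof -
    obtain w h where "sep w" "upper_gradient \<Omega> Z w h" "dp w v \<le> ennreal (\<delta> n)" "En h \<le> ennreal B"
      using ex[OF \<delta>_pos[of n]] by (elim exE conjE)
    then show ?thesis unfolding a_def A_def by (intro INF_lower2[of "(w, h)"]) auto
  qed
  define \<alpha> where "\<alpha> n = enn2real (a n)" for n
  have a_eq: "a n = ennreal (\<alpha> n)" for n
    unfolding \<alpha>_def using a_le[of n] by (simp add: top_unique less_top order_le_less_trans)
  have \<alpha>_le: "0 \<le> \<alpha> n" "\<alpha> n \<le> \<bar>B\<bar>" for n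
    using a_le[of n] unfolding a_eq by (auto simp: \<alpha>_def ennreal_le_iff2 split: if_splits)
  have "incseq \<alpha>"
  proof (rule incseq_SucI)
    fix n
    have "a n \<le> a (Suc n)" unfolding a_def by (rule INF_superset_mono[OF A_mono]) auto
    then show "\<alpha> n \<le> \<alpha> (Suc n)" using \<alpha>_le[of "Suc n"] by (simp add: a_eq)
  qed
  then have "convergent \<alpha>"
    using \<alpha>_le by (intro Bseq_monoseq_convergent) (auto simp: Bseq_def monoseq_iff intro!: exI[of _ "\<bar>B\<bar> + 1"] intro: order_trans[of _ "\<bar>B\<bar>"])
  then have \<alpha>_Cauchy: "Cauchy \<alpha>" by (simp add: Cauchy_convergent_iff)
  have "\<forall>n. \<exists>c. c \<in> A n \<and> En (snd c) < ennreal (\<alpha> n + (1 / 2) ^ n)"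
  proof
    fix n
    have "a n < ennreal (\<alpha> n + (1 / 2) ^ n)"
      unfolding a_eq using \<alpha>_le[of n] by (simp add: ennreal_less_iff)
    then obtain q where "q \<in> A n" "(case q of (w, h) \<Rightarrow> En h) < ennreal (\<alpha> n + (1 / 2) ^ n)"
      unfolding a_def INF_less_iff by (elim bexE)
    then show "\<exists>c. c \<in> A n \<and> En (snd c) < ennreal (\<alpha> n + (1 / 2) ^ n)"
      by (intro exI[of _ q]) (simp add: case_prod_beta)
  qed
  from choice[OF this] obtain c where c: "\<forall>n. c n \<in> A n \<and> En (snd (c n)) < ennreal (\<alpha> n + (1 / 2) ^ n)" ..
  define w where "w n = fst (c n)" for n
  define h where "h n = snd (c n)" for n
  have w: "sep (w n)" "upper_gradient \<Omega> Z (w n) (h n)" "dp (w n) v \<le> ennreal (\<delta> n)" for n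
    using c[rule_format, of n] by (auto simp: A_def w_def h_def case_prod_beta)
  define H where "H n = enn2real (En (h n))" for n
  have H: "En (h n) = ennreal (H n)" "0 \<le> H n" "H n \<le> \<alpha> n + (1 / 2) ^ n" for n
  proof -
    have lt: "En (h n) < ennreal (\<alpha> n + (1 / 2) ^ n)" using c by (simp add: h_def)
    then have "En (h n) < top" by (rule less_trans) simp
    then show eq: "En (h n) = ennreal (H n)" by (simp add: H_def less_top)
    show "0 \<le> H n" by (simp add: H_def)
    show "H n \<le> \<alpha> n + (1 / 2) ^ n"
      using less_imp_le[OF lt] \<alpha>_le[of n] unfolding eq by (subst (asm) ennreal_le_iff) auto
  qed
  have h[measurable]: "h n \<in> borel_measurable borel" for n using w(2)[of n] by (simp add: upper_gradient_def)
  have [measurable]: "h n \<in> borel_measurable \<nu>" for n by (rule borel_\<nu>[OF h])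
  \<comment> \<open>The later pair also lies in the larger class \<open>A n\<close>, hence so does
    the midpoint.\<close>
  have mid_ge: "ennreal (\<alpha> n) \<le> En (\<lambda>x. (h n x + h m x) / 2)" if "n \<le> m" for n m
  proof -
    have "dp (w m) v \<le> ennreal (\<delta> n)" using w(3)[of m] ennreal_leI[OF \<delta>_mono[OF that]] by (rule order_trans)
    then have "(\<lambda>x. mid (w n x) (w m x), \<lambda>x. (h n x + h m x) / 2) \<in> A n"
      unfolding A_def using w v \<delta>_pos[of n]
      by (auto intro!: sep_mid upper_gradient_mid dp_mid_le)
    then show ?thesis unfolding a_eq[symmetric] a_def by (auto intro: INF_lower2)
  qed
  have "\<exists>N. \<forall>n\<ge>N. \<forall>m\<ge>n. En (\<lambda>x. h m x - h n x) \<le> ennreal e" if e: "0 < e" for e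
  proof -
    \<comment> \<open>Energies are at most \<open>\<bar>B\<bar> + 1\<close> from the beginning, so
      the \<eta>-term contributes \<open>e / 2\<close>. Only afterwards is \<open>C\<close> known,
      and the threshold \<open>e / (4 * (C + 1))\<close> is chosen; it is used three times, for a
      difference of \<alpha> and two half powers, which together contribute at most
      \<open>3 / 8 * e\<close>.\<close>
    define \<eta> where "\<eta> = e / (4 * (\<bar>B\<bar> + 1))"
    have "2 * (e / (4 * b)) * b = e / 2" if "b \<noteq> 0" for b :: real using that by simp
    from this[of "\<bar>B\<bar> + 1"] have \<eta>: "0 < \<eta>" "2 * \<eta> * (\<bar>B\<bar> + 1) = e / 2"
      using e by (auto simp: \<eta>_def)
    obtain C where C: "0 \<le> C"
      "\<forall>a b. epow (b - a) p + ennreal C * epow ((a + b) / 2) p \<le> ennreal (\<eta> + C / 2) * (epow a p + epow b p)"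
      by (rule epow_uniform_convexity[OF p \<eta>(1)])
    have e': "0 < e / (4 * (C + 1))" using e C by simp
    obtain N1 where N1: "\<And>m n. m \<ge> N1 \<Longrightarrow> n \<ge> N1 \<Longrightarrow> \<bar>\<alpha> m - \<alpha> n\<bar> < e / (4 * (C + 1))"
      using \<alpha>_Cauchy e' unfolding Cauchy_def dist_real_def by blast
    obtain N2 where N2: "(1 / 2 :: real) ^ N2 < e / (4 * (C + 1))"
      using real_arch_pow_inv[OF e', of "1 / 2"] by auto
    have "En (\<lambda>x. h m x - h n x) \<le> ennreal e" if nm: "n \<ge> max N1 N2" "m \<ge> n" for m n
    proof -
      have "En (\<lambda>x. h m x - h n x) + ennreal C * En (\<lambda>x. (h n x + h m x) / 2)
          = (\<integral>\<^sup>+ x. epow (h m x - h n x) p + ennreal C * epow ((h n x + h m x) / 2) p \<partial>\<nu>)"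
        unfolding En_def by (simp add: nn_integral_add nn_integral_cmult)
      also have "\<dots> \<le> (\<integral>\<^sup>+ x. ennreal (\<eta> + C / 2) * (epow (h n x) p + epow (h m x) p) \<partial>\<nu>)"
        using C(2) by (intro nn_integral_mono) blast
      also have "\<dots> = ennreal (\<eta> + C / 2) * (En (h n) + En (h m))"
        unfolding En_def by (simp add: nn_integral_add nn_integral_cmult)
      also have "\<dots> = ennreal ((\<eta> + C / 2) * (H n + H m))"
        unfolding H(1) using H(2) C(1) \<eta>(1) by (simp add: ennreal_mult)
      finally have "En (\<lambda>x. h m x - h n x) + ennreal C * ennreal (\<alpha> n) \<le> ennreal ((\<eta> + C / 2) * (H n + H m))"
        using mid_ge[OF nm(2)] by (elim order_trans[rotated]) (intro add_left_mono mult_left_mono, auto)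
      then have le: "En (\<lambda>x. h m x - h n x) + ennreal (C * \<alpha> n) \<le> ennreal ((\<eta> + C / 2) * (H n + H m))"
        using C(1) \<alpha>_le by (simp add: ennreal_mult)
      then obtain d where d: "0 \<le> d" "En (\<lambda>x. h m x - h n x) = ennreal d"
        by (cases "En (\<lambda>x. h m x - h n x)") (auto simp: top_unique)
      have "ennreal (d + C * \<alpha> n) \<le> ennreal ((\<eta> + C / 2) * (H n + H m))"
        using le unfolding d(2) using d(1) C(1) \<alpha>_le[of n] by (simp add: ennreal_plus)
      then have "d + C * \<alpha> n \<le> (\<eta> + C / 2) * (H n + H m)"
        using H(2) C(1) \<eta>(1) by (simp add: ennreal_le_iff)
      then have "d \<le> \<eta> * (H n + H m) + C / 2 * (H n + H m - 2 * \<alpha> n)"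
        by (simp add: algebra_simps)
      also have "\<dots> \<le> \<eta> * (2 * (\<bar>B\<bar> + 1)) + C / 2 * (3 * (e / (4 * (C + 1))))"
      proof (intro add_mono mult_left_mono)
        have pw: "(1 / 2 :: real) ^ k \<le> (1 / 2) ^ N2" "(1 / 2 :: real) ^ k \<le> 1" if "k \<ge> N2" for k
          using that by (auto intro!: power_decreasing power_le_one)
        have N: "n \<ge> N2" "m \<ge> N2" "n \<ge> N1" "m \<ge> N1" using nm by auto
        show "H n + H m \<le> 2 * (\<bar>B\<bar> + 1)"
          using add_mono[OF order_trans[OF H(3) add_mono[OF \<alpha>_le(2) pw(2)[OF N(1)]]]
              order_trans[OF H(3) add_mono[OF \<alpha>_le(2) pw(2)[OF N(2)]]]] by simp
        show "H n + H m - 2 * \<alpha> n \<le> 3 * (e / (4 * (C + 1)))"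
          using add_mono[OF order_trans[OF H(3) add_left_mono[OF pw(1)[OF N(1)]]]
              order_trans[OF H(3) add_left_mono[OF pw(1)[OF N(2)]]]] N1[OF N(4,3)] N2
          by (simp add: abs_less_iff)
      qed (use \<eta> C in auto)
      also have "\<dots> \<le> e"
      proof -
        have "C / 2 * (3 * (e / (4 * (C + 1)))) = (C / (C + 1)) * (3 / 8 * e)" by (simp add: field_simps)
        also have "\<dots> \<le> 1 * (3 / 8 * e)" using C(1) e by (intro mult_right_mono) auto
        finally have "C / 2 * (3 * (e / (4 * (C + 1)))) \<le> 3 / 8 * e" by simp
        moreover have "\<eta> * (2 * (\<bar>B\<bar> + 1)) = e / 2"
          using \<eta>(2) by (simp only: mult.commute mult.left_commute mult.assoc)
        ultimately show ?thesis using e by linarith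
      qed
      finally show ?thesis unfolding d(2) by (rule ennreal_leI)
    qed
    then show ?thesis by blast
  qed
  then have "\<forall>k. \<exists>N. \<forall>n\<ge>N. \<forall>m\<ge>n. En (\<lambda>x. h m x - h n x) \<le> ennreal (\<delta> k)"
    using \<delta>_pos by blast
  from choice[OF this] obtain N where N: "\<forall>k. \<forall>n\<ge>N k. \<forall>m\<ge>n. En (\<lambda>x. h m x - h n x) \<le> ennreal (\<delta> k)" ..
  define s where "s k = (\<Sum>i\<le>k. N i) + k" for k
  have s: "N k \<le> s k" "k \<le> s k" "s k \<le> s (Suc k)" for k
    using member_le_sum[of k "{..k}" N] by (auto simp: s_def)
  obtain G where G: "G \<in> borel_measurable borel" "\<forall>k x. h (s k) x \<le> G x" "En G < top"
  proof (rule rapid_Lp_increments_majorant[of "\<lambda>k. h (s k)", OF h])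
    show "En (h (s 0)) < top" unfolding H(1) by simp
    show "En (\<lambda>x. h (s (Suc k)) x - h (s k) x) \<le> ennreal (((1 / 4) ^ k) powr p)" for k
      using N s unfolding \<delta>_def by blast
  qed
  show thesis
  proof (rule that[of "\<lambda>k. w (s k)" G])
    show "\<forall>n. sep (w (s n))" using w by blast
    show "\<forall>n. upper_gradient \<Omega> Z (w (s n)) G"
      using upper_gradient_mono[OF w(2) G(1)] G(2) by blast
    show "\<forall>n. dp (w (s n)) v \<le> ennreal (((1 / 4) ^ n) powr p)"
      using w(3) ennreal_leI[OF \<delta>_mono[OF s(2)]] unfolding \<delta>_def by (blast intro: order_trans)
  qed (rule G)
qed

text \<open>The limit \<open>v0\<close> in \<open>p\<close>-mean is determined only up to null sets,
  while an upper gradient concerns every curve. The maps with common gradient therefore serve to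
  construct another representative \<open>v\<close> as a pointwise limit; it equals
  \<open>v0\<close> almost everywhere, so the convergence carries over.\<close>

lemma Lp_limit_upper_gradient:
  fixes U :: "nat \<Rightarrow> 'x \<Rightarrow> 'z"
  assumes U: "\<And>n. sep (U n)" and g: "\<And>n. upper_gradient \<Omega> Z (U n) (g n)" "\<And>n. En (g n) \<le> ennreal B"
    and C: "\<And>e. 0 < e \<Longrightarrow> \<exists>N. \<forall>m\<ge>N. \<forall>n\<ge>N. dp (U m) (U n) \<le> ennreal e"
  obtains v G where "sep v" "upper_gradient \<Omega> Z v G" "En G < top"
    "\<forall>e>0. \<exists>N. \<forall>n\<ge>N. dp (U n) v \<le> ennreal e"
proof -
  obtain v0 where v0: "sep v0" "\<forall>e>0. \<exists>N. \<forall>n\<ge>N. dp (U n) v0 \<le> ennreal e"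
    by (rule Lp_complete[OF U C])
  have "\<exists>w h. sep w \<and> upper_gradient \<Omega> Z w h \<and> dp w v0 \<le> ennreal e \<and> En h \<le> ennreal B" if e: "0 < e" for e
  proof -
    obtain N where "\<forall>n\<ge>N. dp (U n) v0 \<le> ennreal e" using v0(2) e by blast
    then show ?thesis using U g by (intro exI[of _ "U N"] exI[of _ "g N"]) auto
  qed
  then obtain w G where w: "\<forall>n. sep (w n)" "\<forall>n. upper_gradient \<Omega> Z (w n) G"
    "\<forall>n. dp (w n) v0 \<le> ennreal (((1 / 4) ^ n) powr p)" "En G < top"
    by (rule common_gradient_sequence[OF v0(1)])
  have lim: "AE x in \<nu>. (\<lambda>n. mdist Z (w n x) (v0 x)) \<longlonglongrightarrow> 0"
  proof -
    have "AE x in \<nu>. \<forall>\<^sub>F n in sequentially. mdist Z (w n x) (v0 x) \<le> (1 / 2) ^ n"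
      by (rule AE_eventually_le_half_power[of _ 1]) (use w v0 sep_mdist in \<open>auto simp: dp_def\<close>)
    then show ?thesis
    proof (rule eventually_mono)
      fix x assume "\<forall>\<^sub>F n in sequentially. mdist Z (w n x) (v0 x) \<le> (1 / 2) ^ n"
      then show "(\<lambda>n. mdist Z (w n x) (v0 x)) \<longlonglongrightarrow> 0"
        by (intro Lim_null_comparison[OF _ LIMSEQ_realpow_zero[of "1 / 2"]]) auto
    qed
  qed
  have AE_C: "AE x in \<nu>. Cauchy_at w x"
    using lim
  proof (rule AE_mp, intro AE_I2 impI)
    fix x assume x: "x \<in> space \<nu>" "(\<lambda>n. mdist Z (w n x) (v0 x)) \<longlonglongrightarrow> 0"
    show "Cauchy_at w x"
      by (rule Cauchy_at_of_tendsto[where l = "v0 x"]) (use x w v0 sep_in in \<open>auto simp: space_\<nu>\<close>)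
  qed
  obtain v G' where v: "sep v" "\<forall>x\<in>\<Omega>. Cauchy_at w x \<longrightarrow> (\<lambda>n. mdist Z (w n x) (v x)) \<longlonglongrightarrow> 0"
    "upper_gradient \<Omega> Z v G'" "En G' = En G"
    by (rule upper_gradient_limit[OF w(1)[rule_format] w(2)[rule_format] AE_C])
  have v_eq: "AE x in \<nu>. v x = v0 x"
    using AE_conjI[OF lim AE_C]
  proof (rule AE_mp, intro AE_I2 impI)
    fix x assume x: "x \<in> space \<nu>" "(\<lambda>n. mdist Z (w n x) (v0 x)) \<longlonglongrightarrow> 0 \<and> Cauchy_at w x"
    have in_Z: "v x \<in> mspace Z" "v0 x \<in> mspace Z" "w n x \<in> mspace Z" for n
      using x w(1) v0(1) v(1) sep_in by (auto simp: space_\<nu>)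
    have "(\<lambda>n. mdist Z (v x) (w n x)) \<longlonglongrightarrow> mdist Z (v x) (v0 x)"
      by (rule mdist_tendsto) (use in_Z x in auto)
    moreover have "(\<lambda>n. mdist Z (v x) (w n x)) \<longlonglongrightarrow> 0"
      using v(2) x by (auto simp: mdist_commute space_\<nu>)
    ultimately have "mdist Z (v x) (v0 x) = 0" by (rule LIMSEQ_unique)
    then show "v x = v0 x" using in_Z by simp
  qed
  have "dp (U n) v = dp (U n) v0" for n
    unfolding dp_def by (rule nn_integral_cong_AE) (use v_eq in \<open>auto elim!: eventually_mono\<close>)
  then show thesis using that[OF v(1,3)] v(4) w(4) v0(2) by simp
qed

end

subsection \<open>The compactness theorem\<close>

text \<open>The countable set approximating the values may lie outside the range. For each of its
  points and each radius \<open>1 / Suc n\<close> a nearby point of the range is selected, if there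
  is one.\<close>

lemma separable_space_range:
  assumes w: "separably_measurable \<nu> Z w"
  shows "separable_space (subtopology (mtopology_of Z) (w ` space \<nu>))"
proof -
  interpret Metric_space "mspace Z" "mdist Z" by simp
  let ?S = "w ` space \<nu>"
  obtain D where D: "countable D" "D \<subseteq> mspace Z" "\<forall>x\<in>space \<nu>. \<forall>e>0. \<exists>z\<in>D. mdist Z (w x) z < e"
    by (rule separably_measurable_dense[OF w])
  have S: "?S \<subseteq> mspace Z" using separably_measurableD(1)[OF w] by auto
  define pick where "pick = (\<lambda>(d, n::nat). SOME s. s \<in> ?S \<and> mdist Z s d < 1 / Suc n)"
  define I where "I = {(d, n::nat). d \<in> D \<and> (\<exists>s. s \<in> ?S \<and> mdist Z s d < 1 / Suc n)}"
  have pick: "pick (d, n) \<in> ?S \<and> mdist Z (pick (d, n)) d < 1 / Suc n" if "(d, n) \<in> I" for d n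
  proof -
    have "\<exists>s. s \<in> ?S \<and> mdist Z s d < 1 / Suc n" using that by (simp add: I_def)
    from someI_ex[OF this] show ?thesis by (simp add: pick_def)
  qed
  have top: "topspace (subtopology mtopology ?S) = ?S" using S by auto
  have sub: "pick ` I \<subseteq> ?S" using pick by auto
  have "?S \<subseteq> subtopology mtopology ?S closure_of (pick ` I)"
  proof
    fix x assume x: "x \<in> ?S"
    show "x \<in> subtopology mtopology ?S closure_of (pick ` I)"
      unfolding in_closure_of top
    proof (intro conjI allI impI x)
      fix T assume T: "x \<in> T \<and> openin (subtopology mtopology ?S) T"
      then obtain U where U: "openin mtopology U" "T = U \<inter> ?S" unfolding openin_subtopology by blast
      then obtain r where r: "0 < r" "mball x r \<subseteq> U" using T unfolding openin_mtopology by blast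
      obtain n where n: "1 / real (Suc n) < r / 2" using nat_approx_posE[of "r / 2"] r by auto
      obtain d where d: "d \<in> D" "mdist Z x d < 1 / Suc n"
        using D(3) x by (metis imageE of_nat_0_less_iff zero_less_Suc zero_less_divide_1_iff)
      have dn: "(d, n) \<in> I" using d x by (auto simp: I_def)
      have p: "pick (d, n) \<in> ?S" "mdist Z (pick (d, n)) d < 1 / Suc n" using pick[OF dn] by auto
      have "mdist Z x (pick (d, n)) \<le> mdist Z x d + mdist Z d (pick (d, n))"
        using x p d D(2) S by (intro triangle) auto
      also have "\<dots> < r" using d(2) p(2) n commute[of d] by simp
      finally have "pick (d, n) \<in> mball x r" using x p S by auto
      then show "\<exists>y. y \<in> pick ` I \<and> y \<in> T" using r(2) U(2) p(1) dn by blast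
    qed
  qed
  then have "subtopology mtopology ?S closure_of (pick ` I) = ?S"
    using closure_of_subset_topspace[of "subtopology mtopology ?S" "pick ` I"] unfolding top by blast
  moreover have "countable (pick ` I)"
  proof -
    have "I \<subseteq> D \<times> UNIV" by (auto simp: I_def)
    then show ?thesis using D(1) by (intro countable_image countable_subset[of I]) auto
  qed
  ultimately show ?thesis
    unfolding separable_space_def mtopology_of_def top using sub by blast
qed

lemma isometric_embeddingD:
  assumes "isometric_embedding A B f"
  shows "a \<in> mspace A \<Longrightarrow> f a \<in> mspace B"
    and "a \<in> mspace A \<Longrightarrow> b \<in> mspace A \<Longrightarrow> mdist B (f a) (f b) = mdist A a b"
  using assms by (auto simp: isometric_embedding_def)

text \<open>For \<open>z\<close> outside the image of \<phi> the distance to \<open>z\<close> is not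
  a distance in \<open>Y\<close>. The countable dense set splits it into a distance in
  \<open>Y\<close> and a constant.\<close>

lemma separably_measurable_isometric:
  assumes u: "separably_measurable \<nu> Y u" and \<phi>: "isometric_embedding Y Z \<phi>"
  shows "separably_measurable \<nu> Z (\<lambda>x. \<phi> (u x))"
proof -
  obtain D where D: "countable D" "D \<subseteq> mspace Y" "\<forall>x\<in>space \<nu>. \<forall>e>0. \<exists>z\<in>D. mdist Y (u x) z < e"
    by (rule separably_measurable_dense[OF u])
  have u_in: "u x \<in> mspace Y" if "x \<in> space \<nu>" for x by (rule separably_measurableD(1)[OF u that])
  have dense: "\<exists>z\<in>\<phi> ` D. mdist Z (\<phi> (u x)) z < e" if x: "x \<in> space \<nu>" and e: "0 < e" for x and e :: real
  proof -
    obtain d where d: "d \<in> D" "mdist Y (u x) d < e" using D(3) x e by blast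
    then have "mdist Z (\<phi> (u x)) (\<phi> d) < e"
      using isometric_embeddingD(2)[OF \<phi> u_in[OF x], of d] D(2) by auto
    then show ?thesis using d(1) by blast
  qed
  have "{x \<in> space \<nu>. mdist Z (\<phi> (u x)) z < c} \<in> sets \<nu>" if z: "z \<in> mspace Z" for z c
  proof -
    have "{x \<in> space \<nu>. mdist Z (\<phi> (u x)) z < c} = (\<Union>d\<in>D. {x \<in> space \<nu>. mdist Y (u x) d + mdist Z z (\<phi> d) < c})"
    proof -
      have "mdist Z (\<phi> (u x)) z < c \<longleftrightarrow> (\<exists>d\<in>D. mdist Y (u x) d + mdist Z z (\<phi> d) < c)" if x: "x \<in> space \<nu>" for x
      proof -
        have "mdist Z (\<phi> (u x)) z < c \<longleftrightarrow> (\<exists>d\<in>\<phi> ` D. mdist Z (\<phi> (u x)) d + mdist Z z d < c)"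
          by (rule mdist_less_iff_dense)
            (use dense[OF x] isometric_embeddingD(1)[OF \<phi>] u_in x D(2) z in auto)
        also have "\<dots> \<longleftrightarrow> (\<exists>d\<in>D. mdist Y (u x) d + mdist Z z (\<phi> d) < c)"
          using isometric_embeddingD(2)[OF \<phi> u_in[OF x]] D(2)
          unfolding bex_simps(7) by (intro bex_cong refl) (auto simp: subset_iff)
        finally show ?thesis .
      qed
      then show ?thesis by auto
    qed
    also have "\<dots> \<in> sets \<nu>"
    proof (rule sets.countable_UN''[OF D(1)])
      fix d assume "d \<in> D"
      then have [measurable]: "(\<lambda>x. mdist Y (u x) d) \<in> borel_measurable \<nu>"
        using separably_measurableD(2)[OF u] D(2) by blast
      show "{x \<in> space \<nu>. mdist Y (u x) d + mdist Z z (\<phi> d) < c} \<in> sets \<nu>" by measurable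
    qed
    finally show ?thesis .
  qed
  then have "\<forall>z\<in>mspace Z. (\<lambda>x. mdist Z (\<phi> (u x)) z) \<in> borel_measurable \<nu>"
    by (simp add: borel_measurable_iff_less)
  then show ?thesis
    unfolding separably_measurable_def
    using dense D(1,2) u_in isometric_embeddingD(1)[OF \<phi>]
    by (intro conjI exI[of _ "\<phi> ` D"]) auto
qed

lemma upper_gradient_isometric:
  assumes g: "upper_gradient \<Omega> Y u g" and \<phi>: "isometric_embedding Y Z \<phi>" and u: "\<And>x. x \<in> \<Omega> \<Longrightarrow> u x \<in> mspace Y"
  shows "upper_gradient \<Omega> Z (\<lambda>x. \<phi> (u x)) g"
  unfolding upper_gradient_def
proof (intro conjI ballI, goal_cases)
  case 1
  show ?case using g by (simp add: upper_gradient_def)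
next
  case (2 c)
  obtain \<gamma> L where c: "c = (\<gamma>, L)" by force
  with 2 have \<gamma>: "(\<gamma>, L) \<in> curves_in \<Omega>" by simp
  then have "\<gamma> 0 \<in> \<Omega>" "\<gamma> L \<in> \<Omega>" by (auto simp: curves_in_def arclength_curve_def)
  then have "u (\<gamma> 0) \<in> mspace Y" "u (\<gamma> L) \<in> mspace Y" by (auto intro: u)
  then have "mdist Z (\<phi> (u (\<gamma> L))) (\<phi> (u (\<gamma> 0))) = mdist Y (u (\<gamma> L)) (u (\<gamma> 0))"
    using isometric_embeddingD(2)[OF \<phi>] by blast
  moreover have "ennreal (mdist Y (u (\<gamma> L)) (u (\<gamma> 0))) \<le> line_integral g \<gamma> L"
    using g \<gamma> unfolding upper_gradient_def by blast
  ultimately show ?case by (simp add: c)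
qed

lemma upper_gradient_imp_weak:
  fixes \<mu> :: "'x::metric_space measure"
  assumes "upper_gradient \<Omega> Z u g"
  shows "weak_upper_gradient \<mu> p \<Omega> Z u g"
proof -
  have "modulus \<mu> \<Omega> p {} \<le> (\<integral>\<^sup>+ x\<in>\<Omega>. epow ((\<lambda>_. 0) x) p \<partial>\<mu>)"
    unfolding modulus_def by (intro INF_lower) simp
  then have "modulus \<mu> \<Omega> p {} = 0" by simp
  then show ?thesis
    using assms unfolding weak_upper_gradient_def upper_gradient_def by (intro conjI exI[of _ "{}"]) auto
qed

lemma mdist_cell_measurable:
  assumes u: "separably_measurable \<nu> Y u" and \<iota>: "\<iota> \<in> measurable \<nu> (count_space (UNIV :: nat set))"
    and w: "\<And>i. w i \<in> mspace Y"
  shows "(\<lambda>x. mdist Y (u x) (w (\<iota> x))) \<in> borel_measurable \<nu>"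
  using measurable_compose_countable[OF separably_measurableD(2)[OF u w] \<iota>] by simp

lemma mdist_powr_triangle3:
  assumes p: "0 \<le> p" and in_Z: "a \<in> mspace Z" "b \<in> mspace Z" "c \<in> mspace Z" "d \<in> mspace Z"
  shows "ennreal (mdist Z a d powr p)
    \<le> ennreal (4 powr p) * (ennreal (mdist Z a b powr p) + ennreal (mdist Z b c powr p) + ennreal (mdist Z c d powr p))"
proof -
  let ?m = "max (mdist Z a b) (max (mdist Z b c) (mdist Z c d))"
  have "mdist Z a d \<le> mdist Z a b + (mdist Z b c + mdist Z c d)"
    using in_Z mdist_triangle[of a Z b d] mdist_triangle[of b Z c d] by simp
  also have "\<dots> \<le> 4 * ?m"
  proof -
    have "mdist Z a b \<le> ?m" "mdist Z b c \<le> ?m" "mdist Z c d \<le> ?m" by auto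
    moreover have "0 \<le> ?m" by (rule order_trans[OF mdist_nonneg[of Z a b]]) simp
    ultimately show ?thesis by linarith
  qed
  finally have "mdist Z a d powr p \<le> (4 * ?m) powr p" using p by (intro powr_mono2) auto
  also have "\<dots> = 4 powr p * ?m powr p" by (rule powr_mult)
  also have "\<dots> \<le> 4 powr p * (mdist Z a b powr p + mdist Z b c powr p + mdist Z c d powr p)"
    by (intro mult_left_mono) (auto simp: max_def)
  finally have "ennreal (mdist Z a d powr p) \<le> ennreal (4 powr p * (mdist Z a b powr p + mdist Z b c powr p + mdist Z c d powr p))"
    by (rule ennreal_leI)
  then show ?thesis by (simp add: ennreal_mult ennreal_plus)
qed

text \<open>The nets of level \<open>l\<close> are padded by repetition so that the same index range
  \<open>i < kN l\<close> serves all \<open>m\<close>. Net points can then be followed along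
  \<open>m\<close> by their index \<open>(l, i)\<close>.\<close>

lemma uniformly_compact_nets:
  assumes uc: "uniformly_compact Y K" and ne: "\<And>m. K m \<noteq> {}"
  obtains kN and kn :: "nat \<Rightarrow> nat \<Rightarrow> nat \<Rightarrow> 'y" where "\<forall>l m i. kn l m i \<in> K m"
    "\<forall>l m. \<forall>z\<in>K m. \<exists>i<kN l. mdist (Y m) (kn l m i) z < 1 / real (Suc l)"
proof -
  have "\<forall>l. \<exists>N::nat. \<forall>m. \<exists>C. finite C \<and> card C \<le> N \<and> C \<subseteq> K m \<and>
      K m \<subseteq> (\<Union>c \<in> C. {y \<in> K m. mdist (Y m) c y < 1 / real (Suc l)})"
    using uc unfolding uniformly_compact_def by simp
  from choice[OF this] obtain N where N: "\<forall>l. \<forall>m. \<exists>C. finite C \<and> card C \<le> N l \<and> C \<subseteq> K m \<and>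
      K m \<subseteq> (\<Union>c \<in> C. {y \<in> K m. mdist (Y m) c y < 1 / real (Suc l)})" ..
  have *: "\<exists>h. (\<forall>i. h i \<in> K m) \<and> (\<forall>z\<in>K m. \<exists>i<N l. mdist (Y m) (h i) z < 1 / real (Suc l))" for l m
  proof -
    obtain C where "finite C \<and> card C \<le> N l \<and> C \<subseteq> K m \<and>
      K m \<subseteq> (\<Union>c \<in> C. {y \<in> K m. mdist (Y m) c y < 1 / real (Suc l)})"
      using N[rule_format, of l m] by (elim exE)
    then have C: "finite C" "card C \<le> N l" "C \<subseteq> K m"
      "K m \<subseteq> (\<Union>c \<in> C. {y \<in> K m. mdist (Y m) c y < 1 / real (Suc l)})" by auto
    obtain z0 where z0: "z0 \<in> K m" using ne by blast
    obtain h where h: "bij_betw h {0..<card C} C" using ex_bij_betw_nat_finite[OF C(1)] by blast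
    let ?h = "\<lambda>i. if i < card C then h i else z0"
    have "?h i \<in> K m" for i using bij_betwE[OF h] C(3) z0 by auto
    moreover have "\<exists>i<N l. mdist (Y m) (?h i) z < 1 / real (Suc l)" if z: "z \<in> K m" for z
    proof -
      have "z \<in> (\<Union>c \<in> C. {y \<in> K m. mdist (Y m) c y < 1 / real (Suc l)})" using C(4) z by (rule subsetD)
      then obtain c where c: "c \<in> C" "mdist (Y m) c z < 1 / real (Suc l)" by auto
      then obtain i where "i < card C" "h i = c" using bij_betw_imp_surj_on[OF h] by (metis atLeastLessThan_iff imageE)
      then show ?thesis using c C(2) by (intro exI[of _ i]) auto
    qed
    ultimately show ?thesis by (intro exI[of _ ?h] conjI allI ballI)
  qed
  define kn where "kn l m = (SOME h. (\<forall>i. h i \<in> K m) \<and>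
      (\<forall>z\<in>K m. \<exists>i<N l. mdist (Y m) (h i) z < 1 / real (Suc l)))" for l m
  have "(\<forall>i. kn l m i \<in> K m) \<and> (\<forall>z\<in>K m. \<exists>i<N l. mdist (Y m) (kn l m i) z < 1 / real (Suc l))" for l m
    unfolding kn_def by (rule someI_ex[OF *])
  then show thesis by (intro that[of kn N]) auto
qed

text \<open>For late \<open>k\<close> the finitely many net points of level \<open>l\<close> are
  close to those of a fixed stage \<open>M\<close>, so the nets of the stages up to \<open>M\<close>
  form a finite net for the whole union.\<close>

lemma embedded_compact_union:
  fixes Y :: "nat \<Rightarrow> 'y metric" and kn :: "nat \<Rightarrow> nat \<Rightarrow> nat \<Rightarrow> 'y"
  assumes Z: "mcomplete_of Z" and \<phi>: "\<And>k. isometric_embedding (Y k) Z (\<phi> k)" and K: "\<And>k. K k \<subseteq> mspace (Y k)"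
    and kn: "\<forall>l m i. kn l m i \<in> K m" "\<forall>l m. \<forall>z\<in>K m. \<exists>i<kN l. mdist (Y m) (kn l m i) z < 1 / real (Suc l)"
    and close: "\<And>l i \<epsilon>. \<epsilon> > 0 \<Longrightarrow> \<exists>N. \<forall>m\<ge>N. \<forall>n\<ge>N. mdist Z (\<phi> m (kn l m i)) (\<phi> n (kn l n i)) < \<epsilon>"
  shows "\<exists>KZ. compactin (mtopology_of Z) KZ \<and> (\<Union>k. \<phi> k ` K k) \<subseteq> KZ"
proof (rule mcomplete_totally_bounded_subset_compact[OF Z])
  have in_Z: "\<phi> k y \<in> mspace Z" if "y \<in> K k" for k y
    using isometric_embeddingD(1)[OF \<phi>] K that by blast
  then show "(\<Union>k. \<phi> k ` K k) \<subseteq> mspace Z" by blast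
  fix \<epsilon> :: real assume "\<epsilon> > 0"
  then have e: "0 < \<epsilon> / 2" by simp
  obtain l where l: "1 / real (Suc l) < \<epsilon> / 2" using nat_approx_posE[OF e] by auto
  have "\<forall>i. \<exists>N. \<forall>m\<ge>N. \<forall>n\<ge>N. mdist Z (\<phi> m (kn l m i)) (\<phi> n (kn l n i)) < \<epsilon> / 2" using close[OF e] by blast
  from choice[OF this] obtain N where
    N: "\<forall>i. \<forall>m\<ge>N i. \<forall>n\<ge>N i. mdist Z (\<phi> m (kn l m i)) (\<phi> n (kn l n i)) < \<epsilon> / 2" ..
  define M where "M = (\<Sum>i<kN l. N i)"
  have M: "N i \<le> M" if "i < kN l" for i unfolding M_def using that by (intro member_le_sum) auto
  let ?F = "\<Union>k\<le>M. (\<lambda>i. \<phi> k (kn l k i)) ` {..<kN l}"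
  have "\<exists>c\<in>?F. mdist Z c y < \<epsilon>" if y: "y \<in> (\<Union>k. \<phi> k ` K k)" for y
  proof -
    obtain k z where z: "z \<in> K k" "y = \<phi> k z" using y by blast
    obtain i where i: "i < kN l" "mdist (Y k) (kn l k i) z < 1 / real (Suc l)" using kn(2) z(1) by blast
    have d: "mdist Z (\<phi> k (kn l k i)) y < \<epsilon> / 2"
      using isometric_embeddingD(2)[OF \<phi>, of "kn l k i" k z] kn(1) K z i l by (auto simp: subset_iff)
    show ?thesis
    proof (cases "k \<le> M")
      case True
      then show ?thesis using d i \<open>\<epsilon> > 0\<close> by (intro bexI[of _ "\<phi> k (kn l k i)"]) auto
    next
      case False
      have "mdist Z (\<phi> M (kn l M i)) (\<phi> k (kn l k i)) < \<epsilon> / 2"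
        using N M[OF i(1)] False by simp
      moreover have "mdist Z (\<phi> M (kn l M i)) y \<le> mdist Z (\<phi> M (kn l M i)) (\<phi> k (kn l k i)) + mdist Z (\<phi> k (kn l k i)) y"
        using in_Z kn(1) z by (intro mdist_triangle) auto
      ultimately show ?thesis using d i by (intro bexI[of _ "\<phi> M (kn l M i)"]) auto
    qed
  qed
  moreover have "finite ?F" "?F \<subseteq> mspace Z" using in_Z kn(1) by auto
  ultimately show "\<exists>F. finite F \<and> F \<subseteq> mspace Z \<and> (\<forall>y\<in>(\<Union>k. \<phi> k ` K k). \<exists>c\<in>F. mdist Z c y < \<epsilon>)"
    by (intro exI[of _ ?F]) simp
qed

text \<open>Distances are compared through the discretizations, whose finitely many values converge
  uniformly over the cells. The discretization error \<open>d\<close> persists in the bound and is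
  made small afterwards by the choice of the scale.\<close>

lemma Cauchy_of_discretizations:
  fixes Y :: "nat \<Rightarrow> 'y metric" and w :: "nat \<Rightarrow> nat \<Rightarrow> 'y"
  assumes \<phi>: "\<And>k. isometric_embedding (Y k) Z (\<phi> k)" and p: "0 < p"
    and u: "\<And>k. separably_measurable \<nu> (Y k) (u k)" and fin: "emeasure \<nu> (space \<nu>) \<le> ennreal V" "0 \<le> V"
    and \<iota>: "\<iota> \<in> measurable \<nu> (count_space UNIV)" "\<forall>x\<in>space \<nu>. \<iota> x < (n::nat)"
    and w: "\<And>k i. w k i \<in> mspace (Y k)"
    and d: "\<And>k. (\<integral>\<^sup>+ x. ennreal (mdist (Y k) (u k x) (w k (\<iota> x)) powr p) \<partial>\<nu>) \<le> ennreal d" "0 \<le> d"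
    and close: "\<And>i \<epsilon>. \<epsilon> > 0 \<Longrightarrow> \<exists>N. \<forall>m\<ge>N. \<forall>n\<ge>N. mdist Z (\<phi> m (w m i)) (\<phi> n (w n i)) < \<epsilon>"
    and e: "0 < e"
  shows "\<exists>N. \<forall>j\<ge>N. \<forall>k\<ge>N. (\<integral>\<^sup>+ x. ennreal (mdist Z (\<phi> j (u j x)) (\<phi> k (u k x)) powr p) \<partial>\<nu>)
    \<le> ennreal (4 powr p * 2 * d + e)"
proof -
  \<comment> \<open>Chosen so that the middle term contributes at most \<open>e\<close> after
    integration over a set of measure at most \<open>V\<close>; \<open>V + 1\<close> avoids a zero
    denominator.\<close>
  define \<eta> where "\<eta> = (e / (4 powr p * (V + 1))) powr (1 / p)"
  have c: "0 < 4 powr p * (V + 1)" using fin(2) by simp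
  have \<eta>: "0 < \<eta>" "\<eta> powr p = e / (4 powr p * (V + 1))"
    using e c p by (auto simp: \<eta>_def powr_powr)
  have "\<forall>i. \<exists>N. \<forall>j\<ge>N. \<forall>k\<ge>N. mdist Z (\<phi> j (w j i)) (\<phi> k (w k i)) < \<eta>" using close[OF \<eta>(1)] by blast
  from choice[OF this] obtain N where N: "\<forall>i. \<forall>j\<ge>N i. \<forall>k\<ge>N i. mdist Z (\<phi> j (w j i)) (\<phi> k (w k i)) < \<eta>" ..
  define M where "M = (\<Sum>i<n. N i)"
  have M: "N i \<le> M" if "i < n" for i unfolding M_def using that by (intro member_le_sum) auto
  have "(\<integral>\<^sup>+ x. ennreal (mdist Z (\<phi> j (u j x)) (\<phi> k (u k x)) powr p) \<partial>\<nu>) \<le> ennreal (4 powr p * 2 * d + e)"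
    if jk: "j \<ge> M" "k \<ge> M" for j k
  proof -
    have [measurable]: "(\<lambda>x. mdist (Y k) (u k x) (w k (\<iota> x))) \<in> borel_measurable \<nu>" for k
      by (rule mdist_cell_measurable[OF u \<iota>(1) w])
    let ?a = "\<lambda>k x. ennreal (mdist (Y k) (u k x) (w k (\<iota> x)) powr p)"
    have "(\<integral>\<^sup>+ x. ennreal (mdist Z (\<phi> j (u j x)) (\<phi> k (u k x)) powr p) \<partial>\<nu>)
        \<le> (\<integral>\<^sup>+ x. ennreal (4 powr p) * (?a j x + ennreal (\<eta> powr p) + ?a k x) \<partial>\<nu>)"
    proof (rule nn_integral_mono)
      fix x assume x: "x \<in> space \<nu>"
      have u_in: "u k x \<in> mspace (Y k)" for k by (rule separably_measurableD(1)[OF u x])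
      have "ennreal (mdist Z (\<phi> j (u j x)) (\<phi> k (u k x)) powr p)
          \<le> ennreal (4 powr p) * (ennreal (mdist Z (\<phi> j (u j x)) (\<phi> j (w j (\<iota> x))) powr p)
            + ennreal (mdist Z (\<phi> j (w j (\<iota> x))) (\<phi> k (w k (\<iota> x))) powr p)
            + ennreal (mdist Z (\<phi> k (w k (\<iota> x))) (\<phi> k (u k x)) powr p))"
        using p u_in w isometric_embeddingD(1)[OF \<phi>] by (intro mdist_powr_triangle3) auto
      also have "\<dots> \<le> ennreal (4 powr p) * (?a j x + ennreal (\<eta> powr p) + ?a k x)"
      proof (intro mult_left_mono add_mono)
        have "\<iota> x < n" using \<iota>(2) x by blast
        from M[OF this] have "mdist Z (\<phi> j (w j (\<iota> x))) (\<phi> k (w k (\<iota> x))) < \<eta>" using N jk by simp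
        then show "ennreal (mdist Z (\<phi> j (w j (\<iota> x))) (\<phi> k (w k (\<iota> x))) powr p) \<le> ennreal (\<eta> powr p)"
          using p by (intro ennreal_leI powr_mono2) auto
      qed (use isometric_embeddingD(2)[OF \<phi>] u_in w in \<open>auto simp: mdist_commute\<close>)
      finally show "ennreal (mdist Z (\<phi> j (u j x)) (\<phi> k (u k x)) powr p)
          \<le> ennreal (4 powr p) * (?a j x + ennreal (\<eta> powr p) + ?a k x)" .
    qed
    also have "\<dots> = ennreal (4 powr p) * ((\<integral>\<^sup>+ x. ?a j x \<partial>\<nu>) + ennreal (\<eta> powr p) * emeasure \<nu> (space \<nu>) + (\<integral>\<^sup>+ x. ?a k x \<partial>\<nu>))"
      by (simp add: nn_integral_cmult nn_integral_add)
    also have "\<dots> \<le> ennreal (4 powr p) * (ennreal d + ennreal (\<eta> powr p) * ennreal V + ennreal d)"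
      by (intro mult_left_mono add_mono d fin) auto
    also have "\<dots> = ennreal (4 powr p * (d + \<eta> powr p * V + d))"
      using d(2) fin(2)
      by (simp only: ennreal_mult'[symmetric] ennreal_plus[symmetric] add_nonneg_nonneg mult_nonneg_nonneg powr_ge_zero)
    also have "\<dots> \<le> ennreal (4 powr p * 2 * d + e)"
    proof (rule ennreal_leI)
      have "4 powr p * (\<eta> powr p * V) \<le> 4 powr p * (\<eta> powr p * (V + 1))" by (intro mult_left_mono) auto
      also have "\<dots> = e"
      proof -
        have "V + 1 \<noteq> 0" using fin(2) by simp
        then show ?thesis unfolding \<eta>(2) by simp
      qed
      finally show "4 powr p * (d + \<eta> powr p * V + d) \<le> 4 powr p * 2 * d + e" by (simp add: algebra_simps)
    qed
    finally show ?thesis .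
  qed
  then show ?thesis by blast
qed

theorem theorem4p3:
  fixes \<mu> :: "'x::{metric_space, complete_space} measure"
    and \<Omega> :: "'x set" and p q :: real
    and Y :: "nat \<Rightarrow> 'y metric" and K :: "nat \<Rightarrow> 'y set"
    and u :: "nat \<Rightarrow> 'x \<Rightarrow> 'y"
  assumes "sets \<mu> = sets borel"
    and "open \<Omega>" and "connected \<Omega>" and "\<Omega> \<noteq> {}" and "bounded \<Omega>"
    and "doubling_on \<mu> \<Omega>"
    and "1 \<le> q" and "q < p" and "poincare_on \<mu> \<Omega> q"
    and "\<And>m. mcomplete_of (Y m)"
    and "\<And>m. compactin (mtopology_of (Y m)) (K m)"
    and "\<And>m. u m \<in> N1p \<mu> p \<Omega> (Y m)"
    and "uniformly_compact Y K"
    and "\<exists>y. (\<forall>m. y m \<in> K m) \<and> (\<exists>B::real. \<forall>m.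
           (\<integral>\<^sup>+ x \<in> \<Omega>. ennreal (mdist (Y m) (u m x) (y m) powr p) \<partial>\<mu>) + p_energy \<mu> p \<Omega> (Y m) (u m)
             \<le> ennreal B)"
  shows "\<exists>r Z KZ \<phi> v. strict_mono (r :: nat \<Rightarrow> nat) \<and>
           mcomplete_of (Z :: (nat \<times> 'y \<Rightarrow> real) metric) \<and>
           compactin (mtopology_of Z) KZ \<and>
           (\<forall>k. isometric_embedding (Y (r k)) Z (\<phi> k) \<and> \<phi> k ` K (r k) \<subseteq> KZ) \<and>
           v \<in> N1p \<mu> p \<Omega> Z \<and>
           ((\<lambda>k. \<integral>\<^sup>+ x \<in> \<Omega>. ennreal (mdist Z (\<phi> k (u (r k) x)) (v x) powr p) \<partial>\<mu>) \<longlonglongrightarrow> 0)"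
proof -
  let ?Z = "bfun_metric :: (nat \<times> 'y \<Rightarrow> real) metric"
  let ?\<nu> = "restrict_space \<mu> \<Omega>"
  have p: "0 < p" "1 < p" using assms(7,8) by auto
  obtain y B0 where y: "\<forall>m. y m \<in> K m" and bd: "\<forall>m. (\<integral>\<^sup>+ x \<in> \<Omega>. ennreal (mdist (Y m) (u m x) (y m) powr p) \<partial>\<mu>)
      + p_energy \<mu> p \<Omega> (Y m) (u m) \<le> ennreal B0"
    using assms(14) by (elim exE conjE)
  \<comment> \<open>The 2 is the cost of the good representatives; the absolute value makes
    \<open>B\<close> nonnegative.\<close>
  define B where "B = \<bar>B0\<bar> + 2"
  have B0: "0 \<le> B" by (simp add: B_def)
  have B0_le: "ennreal B0 + 2 \<le> ennreal B" "ennreal B0 \<le> ennreal B"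
  proof -
    have "ennreal B0 + 2 \<le> ennreal \<bar>B0\<bar> + ennreal 2" by (intro add_mono ennreal_leI) auto
    also have "\<dots> = ennreal B" unfolding B_def by (rule ennreal_plus[symmetric]) auto
    finally show "ennreal B0 + 2 \<le> ennreal B" .
    show "ennreal B0 \<le> ennreal B" unfolding B_def by (rule ennreal_leI) simp
  qed
  have K_sub: "K m \<subseteq> mspace (Y m)" for m using compactin_subset_topspace[OF assms(11)] by simp
  have y_in: "y m \<in> mspace (Y m)" for m using y K_sub by blast
  obtain Cd where dd: "doubling_domain \<mu> \<Omega> Cd"
    by (rule doubling_domainI[OF assms(1,2,4,5,6)])
  obtain Cp lam where "poincare_domain \<mu> \<Omega> Cd p q Cp lam"
    by (rule poincare_domainI[OF dd assms(7,8,9)])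
  then interpret P: poincare_domain \<mu> \<Omega> Cd p q Cp lam .
  interpret N: newton_target \<mu> \<Omega> p ?Z bfun_mid "\<lambda>_. 0"
  proof
    show "(\<lambda>_. 0) \<in> mspace ?Z" unfolding mspace_bfun_metric by (intro exI[of _ 0]) simp
  qed (use assms(1,2) p mcomplete_bfun_metric bfun_mid_in_mspace mdist_bfun_mid in auto)
  have sp: "space ?\<nu> = \<Omega>" by (rule P.space_\<nu>)

  have "\<forall>m. \<exists>u' g. separably_measurable ?\<nu> (Y m) u' \<and> (AE x in ?\<nu>. u' x = u m x) \<and>
    upper_gradient \<Omega> (Y m) u' g \<and> (\<integral>\<^sup>+ x. epow (g x) p \<partial>?\<nu>) \<le> ennreal B"
  proof
    fix m
    have E: "p_energy \<mu> p \<Omega> (Y m) (u m) \<le> ennreal B0"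
      by (rule order_trans[OF _ bd[rule_format, of m]]) simp
    obtain u' g where "separably_measurable ?\<nu> (Y m) u'" "AE x in ?\<nu>. u' x = u m x"
      "upper_gradient \<Omega> (Y m) u' g" "(\<integral>\<^sup>+ x. epow (g x) p \<partial>?\<nu>) \<le> ennreal B0 + 2"
      by (rule N1p_good_representative[OF assms(1,2) p(1) assms(12) E y_in])
    then show "\<exists>u' g. separably_measurable ?\<nu> (Y m) u' \<and> (AE x in ?\<nu>. u' x = u m x) \<and>
        upper_gradient \<Omega> (Y m) u' g \<and> (\<integral>\<^sup>+ x. epow (g x) p \<partial>?\<nu>) \<le> ennreal B"
      using B0_le(1) by (intro exI[of _ u'] exI[of _ g] conjI) (auto intro: order_trans)
  qed
  from choice[OF this] obtain u' where "\<forall>m. \<exists>g. separably_measurable ?\<nu> (Y m) (u' m) \<and> (AE x in ?\<nu>. u' m x = u m x) \<and>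
    upper_gradient \<Omega> (Y m) (u' m) g \<and> (\<integral>\<^sup>+ x. epow (g x) p \<partial>?\<nu>) \<le> ennreal B" ..
  from choice[OF this] obtain g where "\<forall>m. separably_measurable ?\<nu> (Y m) (u' m) \<and> (AE x in ?\<nu>. u' m x = u m x) \<and>
    upper_gradient \<Omega> (Y m) (u' m) (g m) \<and> (\<integral>\<^sup>+ x. epow (g m x) p \<partial>?\<nu>) \<le> ennreal B" ..
  then have u': "separably_measurable ?\<nu> (Y m) (u' m)" "AE x in ?\<nu>. u' m x = u m x"
    "upper_gradient \<Omega> (Y m) (u' m) (g m)" "(\<integral>\<^sup>+ x. epow (g m x) p \<partial>?\<nu>) \<le> ennreal B" for m
    by simp_all
  have u'_in: "u' m x \<in> mspace (Y m)" if "x \<in> \<Omega>" for m x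
    using separably_measurableD(1)[OF u'(1)] that by (simp add: sp)
  have u'_y: "(\<integral>\<^sup>+ x. ennreal (mdist (Y m) (u' m x) (y m) powr p) \<partial>?\<nu>) \<le> ennreal B" for m
  proof -
    have "(\<integral>\<^sup>+ x. ennreal (mdist (Y m) (u' m x) (y m) powr p) \<partial>?\<nu>)
        = (\<integral>\<^sup>+ x. ennreal (mdist (Y m) (u m x) (y m) powr p) \<partial>?\<nu>)"
      by (rule nn_integral_cong_AE) (use u'(2)[of m] in \<open>auto elim!: eventually_mono\<close>)
    also have "\<dots> \<le> ennreal B0"
      unfolding P.nn_integral_\<nu> by (rule order_trans[OF _ bd[rule_format, of m]]) simp
    finally show ?thesis using B0_le(2) by (rule order_trans)
  qed

  have "\<forall>l. \<exists>n \<iota> R. (\<forall>x\<in>\<Omega>. \<iota> x < (n::nat)) \<and> \<iota> \<in> measurable ?\<nu> (count_space UNIV) \<and>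
    (\<forall>m. \<exists>w. (\<forall>i. w i \<in> mspace (Y m) \<and> mdist (Y m) (w i) (y m) \<le> R) \<and>
      (\<integral>\<^sup>+ x. ennreal (mdist (Y m) (u' m x) (w (\<iota> x)) powr p) \<partial>?\<nu>) \<le> ennreal (1 / real (Suc l)))"
  proof
    fix l
    have pos: "0 < 1 / real (Suc l)" by simp
    obtain n \<iota> R where "\<forall>x\<in>\<Omega>. \<iota> x < (n::nat)" "\<iota> \<in> measurable ?\<nu> (count_space UNIV)"
      and main: "\<forall>(Y::'y metric) u g y. separably_measurable ?\<nu> Y u \<longrightarrow> upper_gradient \<Omega> Y u g \<longrightarrow>
      (\<integral>\<^sup>+ x. epow (g x) p \<partial>?\<nu>) \<le> ennreal B \<longrightarrow> y \<in> mspace Y \<longrightarrow>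
      (\<integral>\<^sup>+ x. ennreal (mdist Y (u x) y powr p) \<partial>?\<nu>) \<le> ennreal B \<longrightarrow>
      (\<exists>w. (\<forall>i. w i \<in> mspace Y \<and> mdist Y (w i) y \<le> R) \<and>
        (\<integral>\<^sup>+ x. ennreal (mdist Y (u x) (w (\<iota> x)) powr p) \<partial>?\<nu>) \<le> ennreal (1 / real (Suc l)))"
      by (rule P.sobolev_discretization[OF B0 pos])
    then show "\<exists>n \<iota> R. (\<forall>x\<in>\<Omega>. \<iota> x < (n::nat)) \<and> \<iota> \<in> measurable ?\<nu> (count_space UNIV) \<and>
      (\<forall>m. \<exists>w. (\<forall>i. w i \<in> mspace (Y m) \<and> mdist (Y m) (w i) (y m) \<le> R) \<and>
        (\<integral>\<^sup>+ x. ennreal (mdist (Y m) (u' m x) (w (\<iota> x)) powr p) \<partial>?\<nu>) \<le> ennreal (1 / real (Suc l)))"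
      using main[rule_format, OF u'(1) u'(3) u'(4) y_in u'_y]
      by (intro exI[of _ n] exI[of _ \<iota>] exI[of _ R] conjI allI)
  qed
  from choice[OF this] obtain n where "\<forall>l. \<exists>\<iota> R. (\<forall>x\<in>\<Omega>. \<iota> x < (n l::nat)) \<and> \<iota> \<in> measurable ?\<nu> (count_space UNIV) \<and>
    (\<forall>m. \<exists>w. (\<forall>i. w i \<in> mspace (Y m) \<and> mdist (Y m) (w i) (y m) \<le> R) \<and>
      (\<integral>\<^sup>+ x. ennreal (mdist (Y m) (u' m x) (w (\<iota> x)) powr p) \<partial>?\<nu>) \<le> ennreal (1 / real (Suc l)))" ..
  from choice[OF this] obtain \<iota> where "\<forall>l. \<exists>R. (\<forall>x\<in>\<Omega>. \<iota> l x < (n l::nat)) \<and> \<iota> l \<in> measurable ?\<nu> (count_space UNIV) \<and>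
    (\<forall>m. \<exists>w. (\<forall>i. w i \<in> mspace (Y m) \<and> mdist (Y m) (w i) (y m) \<le> R) \<and>
      (\<integral>\<^sup>+ x. ennreal (mdist (Y m) (u' m x) (w (\<iota> l x)) powr p) \<partial>?\<nu>) \<le> ennreal (1 / real (Suc l)))" ..
  from choice[OF this] obtain R where "\<forall>l. (\<forall>x\<in>\<Omega>. \<iota> l x < (n l::nat)) \<and> \<iota> l \<in> measurable ?\<nu> (count_space UNIV) \<and>
    (\<forall>m. \<exists>w. (\<forall>i. w i \<in> mspace (Y m) \<and> mdist (Y m) (w i) (y m) \<le> R l) \<and>
      (\<integral>\<^sup>+ x. ennreal (mdist (Y m) (u' m x) (w (\<iota> l x)) powr p) \<partial>?\<nu>) \<le> ennreal (1 / real (Suc l)))" ..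
  then have \<iota>: "\<forall>x\<in>\<Omega>. \<iota> l x < n l" "\<iota> l \<in> measurable ?\<nu> (count_space UNIV)"
    and ex_w: "\<exists>w. (\<forall>i. w i \<in> mspace (Y m) \<and> mdist (Y m) (w i) (y m) \<le> R l) \<and>
      (\<integral>\<^sup>+ x. ennreal (mdist (Y m) (u' m x) (w (\<iota> l x)) powr p) \<partial>?\<nu>) \<le> ennreal (1 / real (Suc l))" for l m
    by simp_all
  define w where "w l m = (SOME w. (\<forall>i. w i \<in> mspace (Y m) \<and> mdist (Y m) (w i) (y m) \<le> R l) \<and>
      (\<integral>\<^sup>+ x. ennreal (mdist (Y m) (u' m x) (w (\<iota> l x)) powr p) \<partial>?\<nu>) \<le> ennreal (1 / real (Suc l)))" for l m
  have w: "(\<forall>i. w l m i \<in> mspace (Y m) \<and> mdist (Y m) (w l m i) (y m) \<le> R l) \<and>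
      (\<integral>\<^sup>+ x. ennreal (mdist (Y m) (u' m x) (w l m (\<iota> l x)) powr p) \<partial>?\<nu>) \<le> ennreal (1 / real (Suc l))" for l m
    unfolding w_def by (rule someI_ex[OF ex_w])

  obtain kN and kn :: "nat \<Rightarrow> nat \<Rightarrow> nat \<Rightarrow> 'y" where kn: "\<forall>l m i. kn l m i \<in> K m"
    "\<forall>l m. \<forall>z\<in>K m. \<exists>i<kN l. mdist (Y m) (kn l m i) z < 1 / real (Suc l)"
    by (rule uniformly_compact_nets[OF assms(13)]) (use y in blast)
  obtain Dm where Dm: "\<forall>m. \<forall>a \<in> K m. \<forall>b \<in> K m. mdist (Y m) a b \<le> Dm"
    using assms(13) unfolding uniformly_compact_def by (elim conjE exE)
  \<comment> \<open>Even first components enumerate the nets of \<open>K\<^sub>m\<close>, odd ones the values of the discretizations.\<close>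
  define e where "e m a = (case prod_decode a of (l, i) \<Rightarrow> if even l then kn (l div 2) m i else w (l div 2) m i)" for m a
  \<comment> \<open>Bounds for the distance to \<open>y m\<close> that do not depend on
    \<open>m\<close>: the common diameter bound for net points, as \<open>y m\<close> lies in
    \<open>K m\<close>, and the radius of the discretization for its values.\<close>
  define \<rho> where "\<rho> a = (case prod_decode a of (l, i) \<Rightarrow> if even l then Dm else R (l div 2))" for a
  have e_kn: "e m (prod_encode (2 * l, i)) = kn l m i" for m l i by (simp add: e_def)
  have e_w: "e m (prod_encode (2 * l + 1, i)) = w l m i" for m l i by (simp add: e_def)
  have e_in: "e m a \<in> mspace (Y m)" for m a
    using kn(1) K_sub w by (auto simp: e_def subset_iff split: prod.split)
  have e_y: "mdist (Y m) (e m a) (y m) \<le> \<rho> a" for m a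
    using Dm kn(1) y w by (auto simp: e_def \<rho>_def split: prod.split)
  have e_bd: "\<exists>C. \<forall>m. mdist (Y m) (e m a) (e m b) \<le> C" for a b
  proof (intro exI[of _ "\<rho> a + \<rho> b"] allI)
    fix m
    have "mdist (Y m) (e m a) (e m b) \<le> mdist (Y m) (e m a) (y m) + mdist (Y m) (y m) (e m b)"
      by (intro mdist_triangle e_in y_in)
    then show "mdist (Y m) (e m a) (e m b) \<le> \<rho> a + \<rho> b"
      using e_y[of m a] e_y[of m b] by (simp add: mdist_commute)
  qed
  obtain r :: "nat \<Rightarrow> nat" and \<phi> :: "nat \<Rightarrow> 'y \<Rightarrow> nat \<times> 'y \<Rightarrow> real"
    where r: "strict_mono r" and \<phi>: "\<And>k. isometric_embedding (Y (r k)) ?Z (\<phi> k)"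
    and close: "\<And>a \<epsilon>. \<epsilon> > 0 \<Longrightarrow> \<exists>N. \<forall>m\<ge>N. \<forall>n\<ge>N. mdist ?Z (\<phi> m (e (r m) a)) (\<phi> n (e (r n) a)) < \<epsilon>"
    using gromov_gluing[of e Y, OF e_in e_bd] by metis
  obtain KZ where KZ: "compactin (mtopology_of ?Z) KZ" "(\<Union>k. \<phi> k ` K (r k)) \<subseteq> KZ"
  proof -
    have "\<exists>KZ. compactin (mtopology_of ?Z) KZ \<and> (\<Union>k. \<phi> k ` K (r k)) \<subseteq> KZ"
    proof (rule embedded_compact_union[OF mcomplete_bfun_metric \<phi>, where K = "\<lambda>k. K (r k)" and kn = "\<lambda>l k. kn l (r k)" and kN = kN])
      show "\<exists>N. \<forall>m\<ge>N. \<forall>n\<ge>N. mdist ?Z (\<phi> m (kn l (r m) i)) (\<phi> n (kn l (r n) i)) < \<epsilon>" if "\<epsilon> > 0" for l i \<epsilon>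
        using close[OF that, of "prod_encode (2 * l, i)"] by (simp only: e_kn)
    qed (use K_sub kn in auto)
    then show thesis using that by blast
  qed

  define U where "U k x = \<phi> k (u' (r k) x)" for k x
  have U: "separably_measurable ?\<nu> ?Z (U k)" for k
    unfolding U_def by (rule separably_measurable_isometric[OF u'(1) \<phi>])
  have U_ug: "upper_gradient \<Omega> ?Z (U k) (g (r k))" for k
    unfolding U_def by (rule upper_gradient_isometric[OF u'(3) \<phi> u'_in])
  have U_Cauchy: "\<exists>N. \<forall>j\<ge>N. \<forall>k\<ge>N. N.dp (U j) (U k) \<le> ennreal \<epsilon>" if \<epsilon>: "0 < \<epsilon>" for \<epsilon>
  proof -
    \<comment> \<open>The scale \<open>l\<close> is fixed first, so that the persistent error is at
      most half of \<epsilon>; convergence at this scale provides the other half.\<close>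
    have "0 < \<epsilon> / 2 / (4 powr p * 2)" using \<epsilon> by simp
    then obtain l where l: "1 / real (Suc l) < \<epsilon> / 2 / (4 powr p * 2)" using nat_approx_posE by metis
    have "\<exists>N. \<forall>j\<ge>N. \<forall>k\<ge>N. (\<integral>\<^sup>+ x. ennreal (mdist ?Z (\<phi> j (u' (r j) x)) (\<phi> k (u' (r k) x)) powr p) \<partial>?\<nu>)
        \<le> ennreal (4 powr p * 2 * (1 / real (Suc l)) + \<epsilon> / 2)"
    proof (rule Cauchy_of_discretizations[OF \<phi> p(1), where \<iota> = "\<iota> l" and n = "n l" and w = "\<lambda>k. w l (r k)" and V = "measure \<mu> \<Omega>"])
      show "emeasure ?\<nu> (space ?\<nu>) \<le> ennreal (measure \<mu> \<Omega>)"
        unfolding sp using P.\<Omega>_fmeasurable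
        by (subst emeasure_restrict_space) (auto simp: P.space_\<mu> emeasure_eq_measure2)
      show "\<exists>N. \<forall>m\<ge>N. \<forall>n\<ge>N. mdist ?Z (\<phi> m (w l (r m) i)) (\<phi> n (w l (r n) i)) < \<epsilon>'" if "\<epsilon>' > 0" for i \<epsilon>'
        using close[OF that, of "prod_encode (2 * l + 1, i)"] by (simp only: e_w)
    qed (use u'(1) \<iota> w \<epsilon> sp in auto)
    moreover have "4 powr p * 2 * (1 / real (Suc l)) + \<epsilon> / 2 \<le> \<epsilon>"
    proof -
      have "4 powr p * 2 * (1 / real (Suc l)) \<le> 4 powr p * 2 * (\<epsilon> / 2 / (4 powr p * 2))"
        using l by (intro mult_left_mono) auto
      then show ?thesis by simp
    qed
    ultimately show ?thesis
      unfolding N.dp_def U_def by (meson ennreal_leI order_trans)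
  qed
  obtain v G where v: "separably_measurable ?\<nu> ?Z v" "upper_gradient \<Omega> ?Z v G" "N.En G < top"
    and lim: "\<forall>\<epsilon>>0. \<exists>N. \<forall>k\<ge>N. N.dp (U k) v \<le> ennreal \<epsilon>"
    by (rule N.Lp_limit_upper_gradient[of U "\<lambda>k. g (r k)" B, OF U U_ug _ U_Cauchy])
      (use u'(4) in \<open>simp add: N.En_def\<close>)

  have v_in: "v x \<in> mspace ?Z" if "x \<in> \<Omega>" for x by (rule N.sep_in[OF v(1) that])
  \<comment> \<open>One member of the sequence at distance at most 1 from \<open>v\<close> transfers
    the integrability; the base point is the image of its own \<open>y\<close>.\<close>
  obtain M where M: "N.dp (U M) v \<le> ennreal 1" using lim zero_less_one by blast
  have "Lp_metric \<mu> p \<Omega> ?Z v"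
    unfolding Lp_metric_def
  proof (intro conjI)
    show "v \<in> measurable ?\<nu> (borel_of_top (mtopology_of ?Z))" by (rule separably_measurable_imp_measurable[OF v(1)])
    show "\<exists>N\<in>null_sets \<mu>. separable_space (subtopology (mtopology_of ?Z) (v ` (\<Omega> - N)))"
      using separable_space_range[OF v(1)] by (intro bexI[of _ "{}"]) (auto simp: sp)
    let ?z = "\<phi> M (y (r M))"
    have z: "?z \<in> mspace ?Z" by (rule isometric_embeddingD(1)[OF \<phi> y_in])
    have [measurable]: "(\<lambda>x. mdist ?Z (U M x) (v x)) \<in> borel_measurable ?\<nu>" "(\<lambda>x. mdist ?Z (U M x) ?z) \<in> borel_measurable ?\<nu>"
      using N.sep_mdist[OF U v(1)] separably_measurableD(2)[OF U z] by auto
    have "(\<integral>\<^sup>+ x. ennreal (mdist ?Z (v x) ?z powr p) \<partial>?\<nu>)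
        \<le> (\<integral>\<^sup>+ x. ennreal (4 powr p) * (ennreal (mdist ?Z (U M x) (v x) powr p) + ennreal (mdist ?Z (U M x) ?z powr p)) \<partial>?\<nu>)"
    proof (rule nn_integral_mono)
      fix x assume x: "x \<in> space ?\<nu>"
      have "ennreal (mdist ?Z (v x) ?z powr p) \<le> ennreal (4 powr p) * (ennreal (mdist ?Z (v x) (U M x) powr p)
          + ennreal (mdist ?Z (U M x) ?z powr p) + ennreal (mdist ?Z ?z ?z powr p))"
        using p v_in N.sep_in[OF U] x z by (intro mdist_powr_triangle3) (auto simp: sp)
      then show "ennreal (mdist ?Z (v x) ?z powr p)
          \<le> ennreal (4 powr p) * (ennreal (mdist ?Z (U M x) (v x) powr p) + ennreal (mdist ?Z (U M x) ?z powr p))"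
        by (simp add: mdist_self[OF z] mdist_commute)
    qed
    also have "\<dots> = ennreal (4 powr p) * (N.dp (U M) v + (\<integral>\<^sup>+ x. ennreal (mdist ?Z (U M x) ?z powr p) \<partial>?\<nu>))"
      by (simp add: nn_integral_cmult nn_integral_add N.dp_def)
    also have "(\<integral>\<^sup>+ x. ennreal (mdist ?Z (U M x) ?z powr p) \<partial>?\<nu>)
        = (\<integral>\<^sup>+ x. ennreal (mdist (Y (r M)) (u' (r M) x) (y (r M)) powr p) \<partial>?\<nu>)"
      by (intro nn_integral_cong) (simp add: U_def isometric_embeddingD(2)[OF \<phi>] u'_in y_in sp)
    also have "ennreal (4 powr p) * (N.dp (U M) v + \<dots>) \<le> ennreal (4 powr p) * (ennreal 1 + ennreal B)"
      by (intro mult_left_mono add_mono M u'_y) simp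
    also have "\<dots> < \<infinity>" by (simp add: ennreal_mult_less_top)
    finally show "\<exists>z0\<in>mspace ?Z. (\<integral>\<^sup>+ x\<in>\<Omega>. ennreal (mdist ?Z (v x) z0 powr p) \<partial>\<mu>) < \<infinity>"
      unfolding P.nn_integral_\<nu> using z by blast
  qed
  then have v_N1p: "v \<in> N1p \<mu> p \<Omega> ?Z"
    unfolding N1p_def using upper_gradient_imp_weak[OF v(2)] v(3) by (auto simp: N.En_def P.nn_integral_\<nu>)
  have "(\<lambda>k. N.dp (U k) v) \<longlonglongrightarrow> 0"
  proof (rule order_tendstoI)
    fix a :: ennreal assume "0 < a"
    then obtain \<epsilon> where \<epsilon>: "0 < \<epsilon>" "ennreal \<epsilon> < a"
      by (metis ennreal_less_zero_iff dense ennreal_cases less_top top.not_eq_extremum ennreal_top_neq_zero ennreal_zero_less_top less_trans linorder_not_less order_less_irrefl)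
    obtain N where "\<forall>k\<ge>N. N.dp (U k) v \<le> ennreal \<epsilon>" using lim \<epsilon>(1) by blast
    then show "\<forall>\<^sub>F k in sequentially. N.dp (U k) v < a"
      unfolding eventually_sequentially using \<epsilon>(2) by (intro exI[of _ N]) (auto intro: le_less_trans)
  qed simp
  \<comment> \<open>Integrals ignore null sets, so the original maps return in place of their
    representatives.\<close>
  moreover have "N.dp (U k) v = (\<integral>\<^sup>+ x \<in> \<Omega>. ennreal (mdist ?Z (\<phi> k (u (r k) x)) (v x) powr p) \<partial>\<mu>)" for k
    unfolding N.dp_def P.nn_integral_\<nu>[symmetric] U_def
    by (rule nn_integral_cong_AE) (use u'(2)[of "r k"] in \<open>auto elim!: eventually_mono\<close>)
  ultimately have conv: "(\<lambda>k. \<integral>\<^sup>+ x \<in> \<Omega>. ennreal (mdist ?Z (\<phi> k (u (r k) x)) (v x) powr p) \<partial>\<mu>) \<longlonglongrightarrow> 0"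
    by simp
  show ?thesis
    using r mcomplete_bfun_metric KZ \<phi> v_N1p conv
    by (intro exI[of _ r] exI[of _ ?Z] exI[of _ KZ] exI[of _ \<phi>] exI[of _ v] conjI allI) auto
qed

end
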